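(* For every $1<p\le\infty$, the Banach space $\ell_p(C[0,1])$ has the uniform primary factorisation property. In particular, these spaces are primary.
   Context: The scalar field $\mathbb{K}$ is $\mathbb{R}$ or $\mathbb{C}$. "Operator" means bounded linear map between Banach spaces. $C[0,1]$ is the Banach space of scalar-valued continuous functions on the unit interval with the supremum norm. For a Banach space $X$, $\ell_p(X)$ is the space of sequences $(x_n)_{n\in\mathbb{N}}$ in $X$ with $(\|x_n\|)_n\in\ell_p$, with norm $\|(\|x_n\|)_n\|_{\ell_p}$ (for $p=\infty$: bounded sequences, supremum norm). An operator $S\colon Z\to W$ factors through an operator $T\colon X\to Y$ with constant $C$ if there are operators $V\colon Z\to X$, $U\colon Y\to W$ with $UTV=S$ and $\|U\|\|V\|\le C$. For $C\ge1$, a Banach space $X$ has the $C$-primary factorisation property ($C$-PFP) if for every operator $T\colon X\to X$ the identity $I_X$ factors through $T$ or through $I_X-T$ with constant $C$. $X$ has the uniform primary factorisation property (UPFP) if it has the $C$-PFP for some $C\ge1$. $X$ is primary if for every (bounded linear) projection $P\colon X\to X$, either $PX$ or $(I_X-P)X$ is (linearly) isomorphic to $X$. *)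

theory Defs
  imports "HOL-Analysis.Analysis" "HOL-Library.Function_Algebras"
begin

text \<open>
  The sequence spaces below depend on the exponent, which is a term and not a type, so a normed
  space over the field \<open>'k\<close> is given by its set of elements inside an ambient group \<open>'a\<close>, whose
  addition it inherits, together with its scalar multiplication and its norm. For function types
  the ambient addition is the pointwise one of \<^theory>\<open>HOL-Library.Function_Algebras\<close>.
  Maps between such spaces are considered on the elements of the domain only; their values
  elsewhere are irrelevant.
\<close>

record ('k, 'a) nspace =
  elems :: "'a set"
  smul :: "'k \<Rightarrow> 'a \<Rightarrow> 'a"
  nrm :: "'a \<Rightarrow> real"

definition bounded_op ::
  "('k, 'a::ab_group_add) nspace \<Rightarrow> ('k, 'b::ab_group_add) nspace \<Rightarrow> ('a \<Rightarrow> 'b) \<Rightarrow> bool"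
  where "bounded_op X Y T \<longleftrightarrow>
    (\<forall>x\<in>elems X. T x \<in> elems Y) \<and>
    (\<forall>x\<in>elems X. \<forall>y\<in>elems X. T (x + y) = T x + T y) \<and>
    (\<forall>c. \<forall>x\<in>elems X. T (smul X c x) = smul Y c (T x)) \<and>
    (\<exists>B. \<forall>x\<in>elems X. nrm Y (T x) \<le> B * nrm X x)"

text \<open>As in the library's \<^const>\<open>onorm\<close>, the vector \<open>0\<close> contributes \<open>0 / 0 = 0\<close>.\<close>

definition op_norm ::
  "('k, 'a) nspace \<Rightarrow> ('k, 'b) nspace \<Rightarrow> ('a \<Rightarrow> 'b) \<Rightarrow> real"
  where "op_norm X Y T = (SUP x\<in>elems X. nrm Y (T x) / nrm X x)"

text \<open>\<open>factors_through C Z W S X Y T\<close>: the operator \<open>S : Z \<rightarrow> W\<close> factors through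
  \<open>T : X \<rightarrow> Y\<close> with constant \<open>C\<close>.\<close>

definition factors_through ::
  "real \<Rightarrow> ('k, 'z::ab_group_add) nspace \<Rightarrow> ('k, 'w::ab_group_add) nspace \<Rightarrow> ('z \<Rightarrow> 'w) \<Rightarrow>
   ('k, 'a::ab_group_add) nspace \<Rightarrow> ('k, 'b::ab_group_add) nspace \<Rightarrow> ('a \<Rightarrow> 'b) \<Rightarrow> bool"
  where "factors_through C Z W S X Y T \<longleftrightarrow>
    (\<exists>V U. bounded_op Z X V \<and> bounded_op Y W U \<and>
           (\<forall>z\<in>elems Z. U (T (V z)) = S z) \<and>
           op_norm Y W U * op_norm Z X V \<le> C)"

definition primary_factorisation_property ::
  "real \<Rightarrow> ('k, 'a::ab_group_add) nspace \<Rightarrow> bool"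
  where "primary_factorisation_property C X \<longleftrightarrow>
    (\<forall>T. bounded_op X X T \<longrightarrow>
       factors_through C X X (\<lambda>x. x) X X T \<or>
       factors_through C X X (\<lambda>x. x) X X (\<lambda>x. x - T x))"

definition uniform_primary_factorisation_property ::
  "('k, 'a::ab_group_add) nspace \<Rightarrow> bool"
  where "uniform_primary_factorisation_property X \<longleftrightarrow>
    (\<exists>C\<ge>1. primary_factorisation_property C X)"

definition isomorphic_nspaces ::
  "('k, 'a::ab_group_add) nspace \<Rightarrow> ('k, 'b::ab_group_add) nspace \<Rightarrow> bool"
  where "isomorphic_nspaces X Y \<longleftrightarrow>
    (\<exists>T S. bounded_op X Y T \<and> bounded_op Y X S \<and>
           (\<forall>x\<in>elems X. S (T x) = x) \<and> (\<forall>y\<in>elems Y. T (S y) = y))"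

definition bounded_projection ::
  "('k, 'a::ab_group_add) nspace \<Rightarrow> ('a \<Rightarrow> 'a) \<Rightarrow> bool"
  where "bounded_projection X P \<longleftrightarrow>
    bounded_op X X P \<and> (\<forall>x\<in>elems X. P (P x) = P x)"

definition range_space ::
  "('k, 'a) nspace \<Rightarrow> ('a \<Rightarrow> 'a) \<Rightarrow> ('k, 'a) nspace"
  where "range_space X T = X\<lparr>elems := T ` elems X\<rparr>"

definition primary_space :: "('k, 'a::ab_group_add) nspace \<Rightarrow> bool"
  where "primary_space X \<longleftrightarrow>
    (\<forall>P. bounded_projection X P \<longrightarrow>
       isomorphic_nspaces (range_space X P) X \<or>
       isomorphic_nspaces (range_space X (\<lambda>x. x - P x)) X)"

text \<open>A function on the unit interval is represented by its extension by \<open>0\<close> to the real line, so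
  that equality of elements is equality on the interval. The scalar field \<open>'k\<close> is
  instantiated to \<^typ>\<open>real\<close> or \<^typ>\<open>complex\<close>.\<close>

definition C01 :: "('k::real_normed_field, real \<Rightarrow> 'k) nspace"
  where "C01 =
    \<lparr> elems = {f. continuous_on {0..1} f \<and> (\<forall>t. t \<notin> {0..1} \<longrightarrow> f t = 0)},
      smul = (\<lambda>c f t. c * f t),
      nrm = (\<lambda>f. SUP t\<in>{0..1}. norm (f t)) \<rparr>"

definition lp_seqs :: "ereal \<Rightarrow> (nat \<Rightarrow> real) set"
  where "lp_seqs p =
    (if p = \<infinity> then {a. bdd_above (range (\<lambda>n. \<bar>a n\<bar>))}
     else {a. summable (\<lambda>n. \<bar>a n\<bar> powr real_of_ereal p)})"

definition lp_norm :: "ereal \<Rightarrow> (nat \<Rightarrow> real) \<Rightarrow> real"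
  where "lp_norm p a =
    (if p = \<infinity> then (SUP n. \<bar>a n\<bar>)
     else (\<Sum>n. \<bar>a n\<bar> powr real_of_ereal p) powr (1 / real_of_ereal p))"

definition lp_space ::
  "ereal \<Rightarrow> ('k, 'a) nspace \<Rightarrow> ('k, nat \<Rightarrow> 'a) nspace"
  where "lp_space p X =
    \<lparr> elems = {x. (\<forall>n. x n \<in> elems X) \<and> (\<lambda>n. nrm X (x n)) \<in> lp_seqs p},
      smul = (\<lambda>c x n. smul X c (x n)),
      nrm = (\<lambda>x. lp_norm p (\<lambda>n. nrm X (x n))) \<rparr>"

end

theory Submission imports Defs
begin

text \<open>
  Write \<open>X\<close> for the \<open>l\<^sub>p\<close> sum of copies of \<open>C[0,1]\<close> and view an operator \<open>T\<close> on \<open>X\<close> as a matrix of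
  operators on \<open>C[0,1]\<close>. The proof finds an infinite set of coordinates and, in each of them, a
  nonempty open set \<open>K\<close> of points such that \<open>T\<close>, applied to functions supported in these sets
  and observed on these sets only, is almost a diagonal matrix of scalars.

  The diagonal entries are handled by \<open>locally_scalar\<close>: on a small open set \<open>J\<close>, an operator on
  \<open>C[0,1]\<close> is nearly multiplication by a scalar. In terms of the measures \<open>\<mu>\<^sub>t\<close> representing
  \<open>f \<mapsto> T f t\<close>, it says that \<open>\<mu>\<^sub>t\<close> restricted to \<open>J\<close> is nearly a fixed multiple of the point mass at
  \<open>t\<close>, for all \<open>t \<in> J\<close>. If this failed on every smaller open set, one could
  stack up disjointly supported functions of norm one whose images are all large at a common
  point, and their aligned sum would violate the boundedness of the operator.

  The same stacking argument makes the off-diagonal entries small. A row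
  (\<open>row_small_on_infinite_set\<close>), observed on some smaller open set, is small on sequences supported in
  some infinite set of coordinates, because \<open>k\<close> disjointly supported unit vectors of \<open>X\<close> have a sum
  of norm at most \<open>k powr (1/p)\<close>, which for \<open>p > 1\<close> grows more slowly than \<open>k\<close>. A column (\<open>column_small\<close>) is small on functions supported
  in some open set, after passing to infinitely many coordinates of the target and to smaller
  open sets there. Choosing the coordinates one by one and shrinking in this way each time
  (\<open>fusion\<close>) gives a compression of \<open>T\<close> whose strictly upper rows and strictly lower columns have
  norms adding up to little.

  The diagonal scalars of \<open>T\<close> and \<open>I - T\<close> add up to \<open>1\<close>, so for one of these two operators infinitely
  many of them have modulus at least \<open>1/2\<close>. Each open set \<open>K\<close> supports a copy of \<open>C[0,1]\<close> on which
  restriction is a left inverse; composing with these maps and dividing by the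
  scalars turns the compression into a perturbation of the identity, and a Neumann series finishes the
  factorisation, with constant \<open>4\<close>.

  Finally, if the identity of \<open>X\<close> factors through a projection, then \<open>X\<close> and the range are
  isomorphic to complemented subspaces of each other, and as \<open>X\<close> is isomorphic to the \<open>l\<^sub>p\<close> sum of
  infinitely many copies of itself, Pelczynski's decomposition method shows that they are isomorphic
  (\<open>range_isomorphic_if_identity_factors\<close>).
\<close>

section \<open>The \<open>l_p\<close> norm by its finite sections\<close>

text \<open>\<open>lp_le p a B\<close> bounds the norm through finite sums, so that membership in the sequence space and
  the estimate are proved together and re-indexing needs no rearrangement of series.\<close>

definition lp_le :: "ereal \<Rightarrow> (nat \<Rightarrow> real) \<Rightarrow> real \<Rightarrow> bool" where
  "lp_le p a B \<longleftrightarrow> 0 \<le> B \<and>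
    (if p = \<infinity> then \<forall>n. \<bar>a n\<bar> \<le> B
     else \<forall>F. finite F \<longrightarrow> (\<Sum>n\<in>F. \<bar>a n\<bar> powr real_of_ereal p) \<le> B powr real_of_ereal p)"

lemma exponent_cases:
  assumes "1 < (p::ereal)"
  obtains "p = \<infinity>" | r where "p = ereal r" "1 < r"
  using assms by (cases p) auto

lemma lp_le_iff:
  assumes p: "1 < p" and B: "0 \<le> B"
  shows "lp_le p a B \<longleftrightarrow> a \<in> lp_seqs p \<and> lp_norm p a \<le> B"
  using p
proof (cases rule: exponent_cases)
  case 1
  have "(\<forall>n. \<bar>a n\<bar> \<le> B) \<longleftrightarrow> bdd_above (range (\<lambda>n. \<bar>a n\<bar>)) \<and> (SUP n. \<bar>a n\<bar>) \<le> B"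
    by (meson bdd_aboveI2 cSUP_least cSUP_upper2 UNIV_I UNIV_not_empty order_refl order_trans)
  with 1 B show ?thesis
    by (simp add: lp_le_def lp_seqs_def lp_norm_def)
next
  case (2 r)
  define f where "f = (\<lambda>n. \<bar>a n\<bar> powr r)"
  have f0: "0 \<le> f n" for n by (simp add: f_def)
  have "(\<forall>F. finite F \<longrightarrow> sum f F \<le> B powr r) \<longleftrightarrow> summable f \<and> suminf f \<le> B powr r"
  proof (intro iffI conjI allI impI)
    assume *: "\<forall>F. finite F \<longrightarrow> sum f F \<le> B powr r"
    show s: "summable f"
      using * by (intro summableI_nonneg_bounded[where x = "B powr r"] f0) auto
    show "suminf f \<le> B powr r"
      using * by (intro suminf_le_const s) auto
  next
    fix F :: "nat set" assume *: "summable f \<and> suminf f \<le> B powr r" "finite F"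
    then have "sum f F \<le> suminf f" by (intro sum_le_suminf f0) auto
    with * show "sum f F \<le> B powr r" by linarith
  qed
  moreover have "suminf f \<le> B powr r \<longleftrightarrow> suminf f powr (1/r) \<le> B" if "summable f"
  proof -
    have s0: "0 \<le> suminf f" using that f0 by (rule suminf_nonneg)
    have "(suminf f powr (1/r)) powr r = suminf f" "(B powr r) powr (1/r) = B"
      using 2 s0 B by (simp_all add: powr_powr)
    then show ?thesis
      using powr_mono2[of r "suminf f powr (1/r)" B] powr_mono2[of "1/r" "suminf f" "B powr r"] 2 s0
      by auto
  qed
  ultimately show ?thesis
    using 2 B by (auto simp: lp_le_def lp_seqs_def lp_norm_def f_def)
qed

lemma lp_le_norm: 
  assumes "1 < p" "a \<in> lp_seqs p" shows "lp_le p a (lp_norm p a)" "0 \<le> lp_norm p a"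
proof -
  show *: "0 \<le> lp_norm p a"
    using assms(1)
  proof (cases rule: exponent_cases)
    case 1
    with assms have "\<bar>a 0\<bar> \<le> (SUP n. \<bar>a n\<bar>)" by (intro cSUP_upper) (auto simp: lp_seqs_def)
    then show ?thesis using 1 abs_ge_zero[of "a 0"] unfolding lp_norm_def by simp
  qed (simp add: lp_norm_def)
  then show "lp_le p a (lp_norm p a)" using assms by (simp add: lp_le_iff)
qed

lemma lp_le_nonneg: "lp_le p a B \<Longrightarrow> 0 \<le> B"
  by (simp add: lp_le_def)

lemma lp_le_coord:
  assumes p: "1 < p" and a: "lp_le p a B"
  shows "\<bar>a n\<bar> \<le> B"
  using p
proof (cases rule: exponent_cases)
  case (2 r)
  then have "\<bar>a n\<bar> powr r \<le> B powr r"
    using a by (auto simp: lp_le_def elim: allE[of _ "{n}"])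
  then show ?thesis
    using 2 lp_le_nonneg[OF a] powr_less_mono2[of r B "\<bar>a n\<bar>"] by (auto simp: not_le[symmetric])
qed (use a in \<open>simp add: lp_le_def\<close>)

text \<open>Restricting, re-indexing, shifting and spreading out a sequence are all instances.\<close>

lemma lp_le_reindex:
  assumes p: "1 < p" and a: "lp_le p a B" and inj: "inj_on h S"
    and le: "\<And>n. n \<in> S \<Longrightarrow> \<bar>b n\<bar> \<le> \<bar>a (h n)\<bar>" and zero: "\<And>n. n \<notin> S \<Longrightarrow> b n = 0"
  shows "lp_le p b B"
  using p
proof (cases rule: exponent_cases)
  case 1
  have "\<bar>b n\<bar> \<le> B" for n
    using a le[of n] zero[of n] 1 by (cases "n \<in> S") (auto simp: lp_le_def intro: order_trans)
  then show ?thesis using 1 a by (simp add: lp_le_def)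
next
  case (2 r)
  have "(\<Sum>n\<in>F. \<bar>b n\<bar> powr r) \<le> B powr r" if F: "finite F" for F
  proof -
    have "(\<Sum>n\<in>F. \<bar>b n\<bar> powr r) = (\<Sum>n\<in>F \<inter> S. \<bar>b n\<bar> powr r)"
      using F zero by (intro sum.mono_neutral_right) auto
    also have "\<dots> \<le> (\<Sum>n\<in>F \<inter> S. \<bar>a (h n)\<bar> powr r)"
      using le 2 by (intro sum_mono powr_mono2) auto
    also have "\<dots> = (\<Sum>n\<in>h ` (F \<inter> S). \<bar>a n\<bar> powr r)"
      using inj by (subst sum.reindex) (auto intro: inj_on_subset)
    also have "\<dots> \<le> B powr r" using a F 2 by (auto simp: lp_le_def)
    finally show ?thesis .
  qed
  then show ?thesis using 2 a by (simp add: lp_le_def)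
qed

lemma lp_le_dominated:
  assumes "1 < p" "lp_le p a B" "\<And>n. \<bar>b n\<bar> \<le> \<bar>a n\<bar>" shows "lp_le p b B"
  using lp_le_reindex[OF assms(1,2), of id UNIV b] assms(3) by simp

lemma lp_le_mono:
  assumes "1 < p" "lp_le p a B" "B \<le> B'" shows "lp_le p a B'"
  using assms(1)
proof (cases rule: exponent_cases)
  case (2 r)
  then have "B powr r \<le> B' powr r" using assms lp_le_nonneg by (intro powr_mono2) auto
  then show ?thesis using assms 2 by (auto simp: lp_le_def intro: order_trans)
qed (use assms in \<open>auto simp: lp_le_def intro: order_trans\<close>)

lemma lp_le_scale:
  assumes p: "1 < p" and a: "lp_le p a B" and c: "0 \<le> c"
  shows "lp_le p (\<lambda>n. c * a n) (c * B)"
  using p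
proof (cases rule: exponent_cases)
  case 1
  then show ?thesis using a c by (auto simp: lp_le_def abs_mult intro: mult_left_mono)
next
  case (2 r)
  have "(\<Sum>n\<in>F. \<bar>c * a n\<bar> powr r) \<le> (c * B) powr r" if F: "finite F" for F
  proof -
    have "(\<Sum>n\<in>F. \<bar>c * a n\<bar> powr r) = c powr r * (\<Sum>n\<in>F. \<bar>a n\<bar> powr r)"
      using c by (simp add: abs_mult powr_mult sum_distrib_left)
    also have "\<dots> \<le> c powr r * B powr r"
      using a F 2 by (intro mult_left_mono) (auto simp: lp_le_def)
    finally show ?thesis using c lp_le_nonneg[OF a] by (simp add: powr_mult)
  qed
  then show ?thesis using 2 a c by (simp add: lp_le_def)
qed

lemma lp_le_single:
  assumes "1 < p" shows "lp_le p (\<lambda>n. if n = j then c else 0) \<bar>c\<bar>"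
  using assms
proof (cases rule: exponent_cases)
  case (2 r)
  have "(\<Sum>n\<in>F. \<bar>if n = j then c else 0\<bar> powr r) \<le> \<bar>c\<bar> powr r" if "finite F" for F
  proof -
    have "(\<Sum>n\<in>F. \<bar>if n = j then c else 0\<bar> powr r) = (\<Sum>n\<in>F. if n = j then \<bar>c\<bar> powr r else 0)"
      by (intro sum.cong) auto
    then show ?thesis using that by (simp add: sum.delta)
  qed
  then show ?thesis using 2 by (simp add: lp_le_def)
qed (auto simp: lp_le_def)

lemma powr_convex_ge0:
  fixes x y u v r :: real
  assumes "1 < r" "0 \<le> x" "0 \<le> y" "0 \<le> u" "0 \<le> v" "u + v = 1"
  shows "(u * x + v * y) powr r \<le> u * x powr r + v * y powr r"
proof -
  have small: "w powr r \<le> w" if "0 \<le> w" "w \<le> 1" for w :: real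
    using powr_mono'[of 1 r w] that assms(1) by simp
  consider "x = 0" | "y = 0" | "0 < x" "0 < y" using assms by linarith
  then show ?thesis
  proof cases
    case 1
    then show ?thesis using assms small[of v] by (auto simp: powr_mult intro!: mult_right_mono)
  next
    case 2
    then show ?thesis using assms small[of u] by (auto simp: powr_mult intro!: mult_right_mono)
  next
    case 3
    have u: "u = 1 - v" using assms by simp
    show ?thesis
      using convex_onD[OF powr_convex[of r], of v x y] 3 assms unfolding u by simp
  qed
qed

text \<open>Minkowski's inequality: normalise both sequences and use convexity of the power.\<close>

lemma lp_le_add:
  assumes p: "1 < p" and a: "lp_le p a A" and b: "lp_le p b B"
    and le: "\<And>n. \<bar>c n\<bar> \<le> \<bar>a n\<bar> + \<bar>b n\<bar>"
  shows "lp_le p c (A + B)"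
proof -
  have A: "0 \<le> A" and B: "0 \<le> B" using a b by (auto dest: lp_le_nonneg)
  show ?thesis
    using p
  proof (cases rule: exponent_cases)
    case 1
    have "\<bar>c n\<bar> \<le> A + B" for n
      using le[of n] lp_le_coord[OF p a, of n] lp_le_coord[OF p b, of n] by linarith
    then show ?thesis using 1 A B by (simp add: lp_le_def)
  next
    case (2 r)
    consider "A = 0" | "B = 0" | "0 < A" "0 < B" using A B by linarith
    then show ?thesis
    proof cases
      case 1
      then show ?thesis
        using lp_le_dominated[OF p b, of c] le lp_le_coord[OF p a] by auto
    next
      case 2
      then show ?thesis
        using lp_le_dominated[OF p a, of c] le lp_le_coord[OF p b] by auto
    next
      case 3
      define u v where "u = A / (A + B)" and "v = B / (A + B)"
      have uv: "0 \<le> u" "0 \<le> v" "u + v = 1"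
        using 3 by (auto simp: u_def v_def add_divide_distrib[symmetric])
      have "(\<Sum>n\<in>F. \<bar>c n\<bar> powr r) \<le> (A + B) powr r" if F: "finite F" for F
      proof -
        have pt: "\<bar>c n\<bar> powr r \<le> (A + B) powr r * (u / A powr r * \<bar>a n\<bar> powr r + v / B powr r * \<bar>b n\<bar> powr r)" for n
        proof -
          have "\<bar>c n\<bar> powr r \<le> ((A + B) * (u * (\<bar>a n\<bar> / A) + v * (\<bar>b n\<bar> / B))) powr r"
          proof (rule powr_mono2)
            have "(A + B) * (u * (\<bar>a n\<bar> / A) + v * (\<bar>b n\<bar> / B)) = ((A + B) * u / A) * \<bar>a n\<bar> + ((A + B) * v / B) * \<bar>b n\<bar>"
              by (simp add: algebra_simps)
            also have "(A + B) * u / A = 1" using 3 by (simp add: u_def)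
            also have "(A + B) * v / B = 1" using 3 by (simp add: v_def)
            finally show "\<bar>c n\<bar> \<le> (A + B) * (u * (\<bar>a n\<bar> / A) + v * (\<bar>b n\<bar> / B))"
              using le[of n] by simp
          qed (use 2 in auto)
          also have "\<dots> = (A + B) powr r * (u * (\<bar>a n\<bar> / A) + v * (\<bar>b n\<bar> / B)) powr r"
            using 3 uv by (intro powr_mult)
          also have "\<dots> \<le> (A + B) powr r * (u * (\<bar>a n\<bar> / A) powr r + v * (\<bar>b n\<bar> / B) powr r)"
            using 2 3 uv by (intro mult_left_mono powr_convex_ge0) auto
          also have "\<dots> = (A + B) powr r * (u / A powr r * \<bar>a n\<bar> powr r + v / B powr r * \<bar>b n\<bar> powr r)"
            using 3 by (simp add: powr_divide)
          finally show ?thesis .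
        qed
        have "(\<Sum>n\<in>F. \<bar>c n\<bar> powr r)
            \<le> (\<Sum>n\<in>F. (A + B) powr r * (u / A powr r * \<bar>a n\<bar> powr r + v / B powr r * \<bar>b n\<bar> powr r))"
          by (intro sum_mono pt)
        also have "\<dots> = (A + B) powr r * (u / A powr r * (\<Sum>n\<in>F. \<bar>a n\<bar> powr r) + v / B powr r * (\<Sum>n\<in>F. \<bar>b n\<bar> powr r))"
          by (simp add: sum_distrib_left sum.distrib distrib_left)
        also have "\<dots> \<le> (A + B) powr r * (u / A powr r * A powr r + v / B powr r * B powr r)"
          using a b F 2 uv by (intro mult_left_mono add_mono) (auto simp: lp_le_def)
        also have "\<dots> = (A + B) powr r" using 3 uv by simp
        finally show ?thesis .
      qed
      then show ?thesis using 2 A B by (simp add: lp_le_def)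
    qed
  qed
qed

lemma lp_le_sum:
  assumes p: "1 < p" and b: "\<And>n. lp_le p (b n) (\<beta> n)"
  shows "lp_le p (\<lambda>i. \<Sum>n<N::nat. \<bar>b n i\<bar>) (\<Sum>n<N. \<beta> n)"
proof (induction N)
  case 0
  show ?case using lp_le_single[OF p, of 0 0] by simp
next
  case (Suc N)
  have "lp_le p (\<lambda>i. \<Sum>n<Suc N. \<bar>b n i\<bar>) ((\<Sum>n<N. \<beta> n) + \<beta> N)"
    by (rule lp_le_add[OF p Suc.IH b[of N]]) (auto simp: abs_of_nonneg sum_nonneg)
  then show ?case by simp
qed

text \<open>Minkowski's inequality for series, by passing to the limit in the finite sections. It serves to
  sum up the columns of a matrix and the terms of a Neumann series.\<close>

lemma lp_le_suminf:
  assumes p: "1 < p" and b: "\<And>n::nat. lp_le p (b n) (\<beta> n)" and \<beta>: "summable \<beta>"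
    and le: "\<And>i. \<bar>a i\<bar> \<le> (\<Sum>n. \<bar>b n i\<bar>)"
  shows "lp_le p a (suminf \<beta>)"
proof -
  have sb: "summable (\<lambda>n. \<bar>b n i\<bar>)" for i
    by (rule summable_comparison_test'[OF \<beta>, of 0]) (use lp_le_coord[OF p b] in auto)
  have \<beta>0: "0 \<le> \<beta> n" for n using b lp_le_nonneg by blast
  have S: "0 \<le> suminf \<beta>" using \<beta> \<beta>0 by (rule suminf_nonneg)
  have part: "lp_le p (\<lambda>i. \<Sum>n<N. \<bar>b n i\<bar>) (suminf \<beta>)" for N
    by (rule lp_le_mono[OF p lp_le_sum[OF p b]]) (intro sum_le_suminf \<beta> \<beta>0, auto)
  show ?thesis
    using p
  proof (cases rule: exponent_cases)
    case 1
    have "\<bar>a i\<bar> \<le> suminf \<beta>" for i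
    proof -
      have "(\<Sum>n. \<bar>b n i\<bar>) \<le> suminf \<beta>"
        by (intro suminf_le_const sb) (use lp_le_coord[OF p part] in \<open>auto intro: order_trans[OF abs_ge_self]\<close>)
      with le[of i] show ?thesis by linarith
    qed
    then show ?thesis using 1 S by (simp add: lp_le_def)
  next
    case (2 r)
    have "(\<Sum>i\<in>F. \<bar>a i\<bar> powr r) \<le> suminf \<beta> powr r" if F: "finite F" for F
    proof -
      have "(\<Sum>i\<in>F. \<bar>a i\<bar> powr r) \<le> (\<Sum>i\<in>F. (\<Sum>n. \<bar>b n i\<bar>) powr r)"
        using le 2 by (intro sum_mono powr_mono2) auto
      also have "\<dots> \<le> suminf \<beta> powr r"
      proof (rule LIMSEQ_le_const2)
        show "(\<lambda>N. \<Sum>i\<in>F. (\<Sum>n<N. \<bar>b n i\<bar>) powr r) \<longlonglongrightarrow> (\<Sum>i\<in>F. (\<Sum>n. \<bar>b n i\<bar>) powr r)"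
          using 2 by (intro tendsto_sum tendsto_powr2 summable_LIMSEQ sb tendsto_const) (auto intro!: always_eventually sum_nonneg)
        have "(\<Sum>i\<in>F. (\<Sum>n<N. \<bar>b n i\<bar>) powr r) \<le> suminf \<beta> powr r" for N
          using part[of N] F 2 by (auto simp: lp_le_def abs_of_nonneg[OF sum_nonneg])
        then show "\<exists>N0. \<forall>N\<ge>N0. (\<Sum>i\<in>F. (\<Sum>n<N. \<bar>b n i\<bar>) powr r) \<le> suminf \<beta> powr r"
          by blast
      qed
      finally show ?thesis .
    qed
    then show ?thesis using 2 S by (simp add: lp_le_def)
  qed
qed

lemma lp_le_l1:
  assumes p: "1 < p" and \<beta>: "summable \<beta>" and le: "\<And>n. \<bar>a n\<bar> \<le> \<beta> n"
  shows "lp_le p a (suminf \<beta>)"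
proof (rule lp_le_suminf[OF p _ \<beta>])
  have \<beta>0: "0 \<le> \<beta> n" for n using le[of n] by linarith
  show "lp_le p (\<lambda>i. if i = n then \<beta> n else 0) (\<beta> n)" for n
    using lp_le_single[OF p, of n "\<beta> n"] \<beta>0[of n] by simp
  show "\<bar>a i\<bar> \<le> (\<Sum>n. \<bar>if i = n then \<beta> n else 0\<bar>)" for i
  proof -
    have "(\<lambda>n. \<bar>if i = n then \<beta> n else 0\<bar>) = (\<lambda>n. if n = i then \<beta> i else 0)"
      using \<beta>0 by auto
    then have "(\<Sum>n. \<bar>if i = n then \<beta> n else 0\<bar>) = \<beta> i" using sums_single[of i "\<lambda>_. \<beta> i"] by (simp add: sums_unique[symmetric])
    then show ?thesis using le[of i] by simp
  qed
qed

text \<open>The upper \<open>p\<close>-estimate for disjointly supported sequences: the bound for \<open>k\<close> of them grows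
  more slowly than \<open>k\<close>, which is where \<open>p > 1\<close> is essential.\<close>

definition disjoint_growth :: "ereal \<Rightarrow> nat \<Rightarrow> real" where
  "disjoint_growth p k = (if p = \<infinity> then 1 else real k powr (1 / real_of_ereal p))"

lemma lp_le_disjoint:
  assumes p: "1 < p" and a: "lp_le p a 1" and b: "lp_le p b (disjoint_growth p k)"
    and dis: "\<And>n. a n = 0 \<or> b n = 0" and le: "\<And>n. \<bar>c n\<bar> \<le> \<bar>a n\<bar> + \<bar>b n\<bar>"
  shows "lp_le p c (disjoint_growth p (Suc k))"
  using p
proof (cases rule: exponent_cases)
  case 1
  have "\<bar>c n\<bar> \<le> 1" for n
    using le[of n] dis[of n] lp_le_coord[OF p a, of n] lp_le_coord[OF p b, of n] 1
    by (auto simp: disjoint_growth_def)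
  then show ?thesis using 1 by (simp add: lp_le_def disjoint_growth_def)
next
  case (2 r)
  have g: "disjoint_growth p j powr r = real j" for j
    using 2 by (simp add: disjoint_growth_def powr_powr)
  have "(\<Sum>n\<in>F. \<bar>c n\<bar> powr r) \<le> real (Suc k)" if F: "finite F" for F
  proof -
    have "(\<Sum>n\<in>F. \<bar>c n\<bar> powr r) \<le> (\<Sum>n\<in>F. \<bar>a n\<bar> powr r + \<bar>b n\<bar> powr r)"
    proof (rule sum_mono)
      fix n
      have "\<bar>c n\<bar> powr r \<le> (\<bar>a n\<bar> + \<bar>b n\<bar>) powr r" using le 2 by (intro powr_mono2) auto
      then show "\<bar>c n\<bar> powr r \<le> \<bar>a n\<bar> powr r + \<bar>b n\<bar> powr r" using dis[of n] 2 by auto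
    qed
    also have "\<dots> = (\<Sum>n\<in>F. \<bar>a n\<bar> powr r) + (\<Sum>n\<in>F. \<bar>b n\<bar> powr r)" by (rule sum.distrib)
    also have "\<dots> \<le> 1 + real k"
      using a b F 2 g[of k] by (intro add_mono) (auto simp: lp_le_def)
    finally show ?thesis by simp
  qed
  then show ?thesis using 2 g[of "Suc k"] by (simp add: lp_le_def disjoint_growth_def)
qed

lemma disjoint_growth_sublinear:
  assumes p: "1 < p" and \<epsilon>: "0 < \<epsilon>"
  obtains k where "M * disjoint_growth p k < real k * \<epsilon>"
proof -
  have "(\<lambda>k. disjoint_growth p k / real k) \<longlonglongrightarrow> 0"
    using p
  proof (cases rule: exponent_cases)
    case 1
    then show ?thesis using lim_inverse_n by (simp add: disjoint_growth_def inverse_eq_divide)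
  next
    case (2 r)
    have "(\<lambda>k. real k powr (1/r - 1)) \<longlonglongrightarrow> 0"
      using 2 by (intro tendsto_neg_powr filterlim_real_sequentially) auto
    moreover have "\<forall>\<^sub>F k in sequentially. real k powr (1/r - 1) = disjoint_growth p k / real k"
      using eventually_gt_at_top[of 0] by eventually_elim (use 2 in \<open>simp add: disjoint_growth_def powr_diff\<close>)
    ultimately show ?thesis by (rule Lim_transform_eventually)
  qed
  then have "(\<lambda>k. M * (disjoint_growth p k / real k)) \<longlonglongrightarrow> 0"
    using tendsto_mult_right_zero by blast
  then have "\<forall>\<^sub>F k in sequentially. M * (disjoint_growth p k / real k) < \<epsilon>"
    using \<epsilon> by (rule order_tendstoD)
  with eventually_gt_at_top[of 0]
  have "\<forall>\<^sub>F k in sequentially. M * disjoint_growth p k < real k * \<epsilon>"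
    by eventually_elim (auto simp: field_simps)
  then show thesis using that by (meson eventually_sequentially order_refl)
qed

section \<open>Spaces given by a set of elements and a norm\<close>

locale normed_nspace =
  fixes X :: "('k::real_normed_field, 'a::ab_group_add) nspace"
  assumes zero_mem: "0 \<in> elems X"
    and add_mem: "\<lbrakk>x \<in> elems X; y \<in> elems X\<rbrakk> \<Longrightarrow> x + y \<in> elems X"
    and smul_mem: "x \<in> elems X \<Longrightarrow> smul X c x \<in> elems X"
    and smul_minus_one: "x \<in> elems X \<Longrightarrow> smul X (-1) x = - x"
    and smul_add: "\<lbrakk>x \<in> elems X; y \<in> elems X\<rbrakk> \<Longrightarrow> smul X c (x + y) = smul X c x + smul X c y"
    and smul_add_left: "x \<in> elems X \<Longrightarrow> smul X (c + d) x = smul X c x + smul X d x"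
    and smul_smul: "x \<in> elems X \<Longrightarrow> smul X c (smul X d x) = smul X (c * d) x"
    and smul_one: "x \<in> elems X \<Longrightarrow> smul X 1 x = x"
    and nrm_triangle: "\<lbrakk>x \<in> elems X; y \<in> elems X\<rbrakk> \<Longrightarrow> nrm X (x + y) \<le> nrm X x + nrm X y"
    and nrm_smul: "x \<in> elems X \<Longrightarrow> nrm X (smul X c x) = norm c * nrm X x"
    and nrm_zeroD: "\<lbrakk>x \<in> elems X; nrm X x = 0\<rbrakk> \<Longrightarrow> x = 0"
begin

lemma minus_mem: "x \<in> elems X \<Longrightarrow> - x \<in> elems X"
  using smul_mem[of x "-1"] smul_minus_one by simp

lemma diff_mem: "\<lbrakk>x \<in> elems X; y \<in> elems X\<rbrakk> \<Longrightarrow> x - y \<in> elems X"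
  using add_mem[of x "- y"] minus_mem by simp

lemma nrm_minus: "x \<in> elems X \<Longrightarrow> nrm X (- x) = nrm X x"
  using nrm_smul[of x "-1"] smul_minus_one by simp

lemma smul_zero: "smul X c 0 = 0"
  using smul_add[OF zero_mem zero_mem, of c] by simp

lemma nrm_double: "x \<in> elems X \<Longrightarrow> nrm X (x + x) = 2 * nrm X x"
  using smul_add_left[of x 1 1] nrm_smul[of x 2] smul_one[of x] by simp

lemma nrm_zero: "nrm X 0 = 0"
  using nrm_smul[OF zero_mem, of 0] smul_zero by simp

lemma nrm_nonneg: "x \<in> elems X \<Longrightarrow> 0 \<le> nrm X x"
  using nrm_triangle[of x "- x"] minus_mem nrm_minus nrm_zero by simp

lemma nrm_diff_le: "\<lbrakk>x \<in> elems X; y \<in> elems X\<rbrakk> \<Longrightarrow> nrm X (x - y) \<le> nrm X x + nrm X y"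
  using nrm_triangle[of x "- y"] minus_mem nrm_minus by simp

lemma smul_diff: "\<lbrakk>x \<in> elems X; y \<in> elems X\<rbrakk> \<Longrightarrow> smul X c (x - y) = smul X c x - smul X c y"
  using smul_add[of "x - y" y c] diff_mem by (simp add: algebra_simps)

lemma sum_mem: "(\<And>n. n \<in> F \<Longrightarrow> z n \<in> elems X) \<Longrightarrow> sum z F \<in> elems X"
  by (induction F rule: infinite_finite_induct) (auto intro: zero_mem add_mem)

lemma bounded_opE:
  assumes "bounded_op X Y T"
  obtains M where "0 < M" "\<And>x. x \<in> elems X \<Longrightarrow> nrm Y (T x) \<le> M * nrm X x"
proof -
  obtain B where B: "\<And>x. x \<in> elems X \<Longrightarrow> nrm Y (T x) \<le> B * nrm X x"
    using assms unfolding bounded_op_def by blast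
  show thesis
  proof (rule that[of "max B 1"])
    fix x assume x: "x \<in> elems X"
    have "B * nrm X x \<le> max B 1 * nrm X x" using nrm_nonneg[OF x] by (intro mult_right_mono) auto
    with B[OF x] show "nrm Y (T x) \<le> max B 1 * nrm X x" by linarith
  qed simp
qed

lemma op_norm_le:
  assumes "0 \<le> B" "\<And>x. x \<in> elems X \<Longrightarrow> nrm Y (T x) \<le> B * nrm X x"
  shows "op_norm X Y T \<le> B"
  unfolding op_norm_def
proof (rule cSUP_least)
  fix x assume x: "x \<in> elems X"
  show "nrm Y (T x) / nrm X x \<le> B"
    using nrm_nonneg[OF x] assms(1) assms(2)[OF x] by (cases "nrm X x = 0") (auto simp: divide_le_eq)
qed (use zero_mem in auto)

lemma op_norm_nonneg:
  assumes "bounded_op X Y T" shows "0 \<le> op_norm X Y T"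
proof -
  obtain M where M: "0 < M" "\<And>x. x \<in> elems X \<Longrightarrow> nrm Y (T x) \<le> M * nrm X x"
    using bounded_opE[OF assms] by blast
  have "nrm Y (T x) / nrm X x \<le> M" if x: "x \<in> elems X" for x
    using nrm_nonneg[OF x] M(1) M(2)[OF x] by (cases "nrm X x = 0") (auto simp: divide_le_eq)
  then have "bdd_above ((\<lambda>x. nrm Y (T x) / nrm X x) ` elems X)" by (intro bdd_aboveI2) blast
  from cSUP_upper[OF zero_mem this] show ?thesis by (simp add: op_norm_def nrm_zero)
qed

end

lemma bounded_op_mem: "bounded_op X Y T \<Longrightarrow> x \<in> elems X \<Longrightarrow> T x \<in> elems Y"
  and bounded_op_add: "bounded_op X Y T \<Longrightarrow> x \<in> elems X \<Longrightarrow> y \<in> elems X \<Longrightarrow> T (x + y) = T x + T y"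
  and bounded_op_smul: "bounded_op X Y T \<Longrightarrow> x \<in> elems X \<Longrightarrow> T (smul X c x) = smul Y c (T x)"
  by (auto simp: bounded_op_def)

lemma bounded_op_diff:
  assumes "normed_nspace X" "bounded_op X Y T" "x \<in> elems X" "y \<in> elems X"
  shows "T (x - y) = T x - T y"
  using bounded_op_add[OF assms(2) normed_nspace.diff_mem[OF assms(1,3,4)] assms(4)]
  by (simp add: algebra_simps)

lemma bounded_opI:
  assumes "\<And>x. x \<in> elems X \<Longrightarrow> T x \<in> elems Y"
    and "\<And>x y. \<lbrakk>x \<in> elems X; y \<in> elems X\<rbrakk> \<Longrightarrow> T (x + y) = T x + T y"
    and "\<And>c x. x \<in> elems X \<Longrightarrow> T (smul X c x) = smul Y c (T x)"
    and "\<And>x. x \<in> elems X \<Longrightarrow> nrm Y (T x) \<le> B * nrm X x"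
  shows "bounded_op X Y T"
  using assms unfolding bounded_op_def by blast

lemma bounded_op_comp:
  assumes "normed_nspace X" "normed_nspace Y" "bounded_op X Y T" "bounded_op Y Z S"
  shows "bounded_op X Z (\<lambda>x. S (T x))"
proof -
  obtain M where M: "0 < M" "\<And>x. x \<in> elems X \<Longrightarrow> nrm Y (T x) \<le> M * nrm X x"
    using normed_nspace.bounded_opE[OF assms(1,3)] by blast
  obtain N where N: "0 < N" "\<And>x. x \<in> elems Y \<Longrightarrow> nrm Z (S x) \<le> N * nrm Y x"
    using normed_nspace.bounded_opE[OF assms(2,4)] by blast
  have "nrm Z (S (T x)) \<le> (N * M) * nrm X x" if x: "x \<in> elems X" for x
  proof -
    have "nrm Z (S (T x)) \<le> N * nrm Y (T x)" using N bounded_op_mem[OF assms(3) x] by blast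
    also have "\<dots> \<le> N * (M * nrm X x)" using M(2)[OF x] N(1) by (intro mult_left_mono) auto
    finally show ?thesis by simp
  qed
  then show ?thesis
    using assms(3,4) by (intro bounded_opI[where B = "N * M"]) (auto simp: bounded_op_def)
qed

lemma bounded_op_id: "bounded_op X X (\<lambda>x. x)"
  by (rule bounded_opI[where B = 1]) auto

lemma bounded_op_minus:
  assumes "normed_nspace X" "normed_nspace Y" "bounded_op X Y T" "bounded_op X Y S"
  shows "bounded_op X Y (\<lambda>x. T x - S x)"
proof -
  interpret X: normed_nspace X by fact
  interpret Y: normed_nspace Y by fact
  obtain M where M: "0 < M" "\<And>x. x \<in> elems X \<Longrightarrow> nrm Y (T x) \<le> M * nrm X x"
    using X.bounded_opE[OF assms(3)] by blast
  obtain N where N: "0 < N" "\<And>x. x \<in> elems X \<Longrightarrow> nrm Y (S x) \<le> N * nrm X x"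
    using X.bounded_opE[OF assms(4)] by blast
  note mem = bounded_op_mem[OF assms(3)] bounded_op_mem[OF assms(4)]
  show ?thesis
  proof (rule bounded_opI[where B = "M + N"])
    fix x assume x: "x \<in> elems X"
    show "T x - S x \<in> elems Y" using mem x by (intro Y.diff_mem)
    show "nrm Y (T x - S x) \<le> (M + N) * nrm X x"
      using Y.nrm_diff_le[OF mem(1)[OF x] mem(2)[OF x]] M(2)[OF x] N(2)[OF x] by (simp add: distrib_right)
    show "T (smul X c x) - S (smul X c x) = smul Y c (T x - S x)" for c
      using assms(3,4) x mem by (simp add: bounded_op_smul Y.smul_diff)
  next
    fix x y assume "x \<in> elems X" "y \<in> elems X"
    then show "T (x + y) - S (x + y) = T x - S x + (T y - S y)"
      using assms(3,4) by (simp add: bounded_op_add)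
  qed
qed

text \<open>Completeness in the form in which the Neumann series consumes it.\<close>

locale banach_nspace = normed_nspace +
  assumes geometric_series: "(\<And>n. z n \<in> elems X \<and> nrm X (z n) \<le> c * (1/2)^n) \<Longrightarrow>
    \<exists>s\<in>elems X. \<forall>m. nrm X (s - (\<Sum>n<m. z n)) \<le> 2 * c * (1/2)^m"
begin

lemma near_identity_surj:
  assumes F: "bounded_op X X F"
    and near: "\<And>x. x \<in> elems X \<Longrightarrow> nrm X (F x - x) \<le> nrm X x / 2"
    and y: "y \<in> elems X"
  shows "\<exists>x\<in>elems X. F x = y"
proof -
  have Dmem: "x - F x \<in> elems X" if "x \<in> elems X" for x
    using that bounded_op_mem[OF F that] by (rule diff_mem)
  define z where "z n = ((\<lambda>x. x - F x) ^^ n) y" for n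
  have z: "z n \<in> elems X \<and> nrm X (z n) \<le> nrm X y * (1/2)^n" for n
  proof (induction n)
    case (Suc n)
    have "nrm X (z n - F (z n)) = nrm X (F (z n) - z n)"
      using nrm_minus[of "F (z n) - z n"] Suc bounded_op_mem[OF F] by (simp add: diff_mem)
    with Suc near[of "z n"] Dmem[of "z n"] show ?case by (auto simp: z_def)
  qed (simp add: z_def y)
  then obtain s where s: "s \<in> elems X" "\<And>m. nrm X (s - (\<Sum>n<m. z n)) \<le> 2 * nrm X y * (1/2)^m"
    using geometric_series[of z "nrm X y"] by blast
  have sm: "(\<Sum>n<m. z n) \<in> elems X" for m using z by (intro sum_mem) auto
  have Fs: "F (\<Sum>n<m. z n) = y - z m" for m
  proof (induction m)
    case 0
    show ?case using bounded_op_diff[OF normed_nspace_axioms F zero_mem zero_mem] by (simp add: z_def)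
  next
    case (Suc m)
    have "F (\<Sum>n<Suc m. z n) = F (\<Sum>n<m. z n) + F (z m)"
      using bounded_op_add[OF F sm[of m]] z by simp
    also have "\<dots> = y - z (Suc m)" using Suc by (simp add: z_def)
    finally show ?case .
  qed
  obtain M where M: "0 < M" "\<And>x. x \<in> elems X \<Longrightarrow> nrm X (F x) \<le> M * nrm X x"
    using bounded_opE[OF F] by blast
  have Fsy: "F s - y \<in> elems X" using s y bounded_op_mem[OF F] by (intro diff_mem) auto
  have bd: "nrm X (F s - y) \<le> (2 * M + 1) * nrm X y * (1/2)^m" for m
  proof -
    have "F s - y = F (s - (\<Sum>n<m. z n)) - z m"
      using bounded_op_diff[OF normed_nspace_axioms F s(1) sm[of m]] Fs[of m] by simp
    also have "nrm X \<dots> \<le> nrm X (F (s - (\<Sum>n<m. z n))) + nrm X (z m)"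
        using z bounded_op_mem[OF F diff_mem[OF s(1) sm[of m]]] by (intro nrm_diff_le) auto
    also have "\<dots> \<le> M * (2 * nrm X y * (1/2)^m) + nrm X y * (1/2)^m"
    proof (rule add_mono)
      have "nrm X (F (s - (\<Sum>n<m. z n))) \<le> M * nrm X (s - (\<Sum>n<m. z n))"
        using s sm by (intro M diff_mem)
      also have "\<dots> \<le> M * (2 * nrm X y * (1/2)^m)" using s(2) M(1) by (intro mult_left_mono) auto
      finally show "nrm X (F (s - (\<Sum>n<m. z n))) \<le> M * (2 * nrm X y * (1/2)^m)" .
    qed (use z in blast)
    finally show ?thesis by (simp add: algebra_simps)
  qed
  have "(\<lambda>m. (2 * M + 1) * nrm X y * (1/2)^m) \<longlonglongrightarrow> (2 * M + 1) * nrm X y * 0"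
    by (intro tendsto_mult_left LIMSEQ_power_zero) simp
  then have "nrm X (F s - y) \<le> 0" using bd by (intro LIMSEQ_le_const) auto
  then have "F s - y = 0" using nrm_nonneg[OF Fsy] nrm_zeroD[OF Fsy] by simp
  then show ?thesis using s(1) by (intro bexI[of _ s]) auto
qed

text \<open>The Neumann series: an operator within distance \<open>1/2\<close> of the identity is inverted by an
  operator of norm at most \<open>2\<close>.\<close>

lemma near_identity_inverse:
  assumes F: "bounded_op X X F"
    and near: "\<And>x. x \<in> elems X \<Longrightarrow> nrm X (F x - x) \<le> nrm X x / 2"
  obtains G where "bounded_op X X G" "\<And>x. x \<in> elems X \<Longrightarrow> G (F x) = x"
    "\<And>x. x \<in> elems X \<Longrightarrow> nrm X (G x) \<le> 2 * nrm X x"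
proof -
  have lower: "nrm X x \<le> 2 * nrm X (F x)" if x: "x \<in> elems X" for x
  proof -
    have "nrm X x = nrm X (F x - (F x - x))" by simp
    also have "\<dots> \<le> nrm X (F x) + nrm X (F x - x)"
      using x bounded_op_mem[OF F x] by (intro nrm_diff_le diff_mem)
    finally show ?thesis using near[OF x] by linarith
  qed
  have inj: "x = y" if xy: "x \<in> elems X" "y \<in> elems X" and eq: "F x = F y" for x y
  proof -
    have "nrm X (x - y) \<le> 0"
      using lower[OF diff_mem[OF xy]] bounded_op_diff[OF normed_nspace_axioms F xy] eq nrm_zero by simp
    then have "x - y = 0" using diff_mem[OF xy] nrm_nonneg[OF diff_mem[OF xy]] by (intro nrm_zeroD) auto
    then show ?thesis by simp
  qed
  define G where "G = inv_into (elems X) F"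
  have im: "F ` elems X = elems X"
    using near_identity_surj[OF F near] bounded_op_mem[OF F] by blast
  have G: "G y \<in> elems X" "F (G y) = y" if "y \<in> elems X" for y
    using that im unfolding G_def by (auto intro: inv_into_into f_inv_into_f)
  show thesis
  proof (rule that[of G])
    show "G (F x) = x" if "x \<in> elems X" for x
      using that G[OF bounded_op_mem[OF F that]] inj by blast
    show bd: "nrm X (G x) \<le> 2 * nrm X x" if "x \<in> elems X" for x
      using lower[OF G(1)[OF that]] G(2)[OF that] by simp
    show "bounded_op X X G"
    proof (rule bounded_opI[OF _ _ _ bd])
      fix x y assume xy: "x \<in> elems X" "y \<in> elems X"
      show "G (x + y) = G x + G y"
        using xy G F by - (rule inj, auto simp: bounded_op_add add_mem)
    next
      fix c x assume x: "x \<in> elems X"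
      show "G (smul X c x) = smul X c (G x)"
        using x G F by - (rule inj, auto simp: bounded_op_smul smul_mem)
    qed (use G in auto)
  qed
qed

lemma identity_factors_if_near:
  assumes T: "bounded_op X X T" and V: "bounded_op X X V" and U: "bounded_op X X U"
    and Vn: "\<And>x. x \<in> elems X \<Longrightarrow> nrm X (V x) \<le> nrm X x"
    and Un: "\<And>x. x \<in> elems X \<Longrightarrow> nrm X (U x) \<le> 2 * nrm X x"
    and near: "\<And>x. x \<in> elems X \<Longrightarrow> nrm X (U (T (V x)) - x) \<le> nrm X x / 2"
  shows "factors_through 4 X X (\<lambda>x. x) X X T"
proof -
  note nX = normed_nspace_axioms
  have "bounded_op X X (\<lambda>x. U (T (V x)))"
    by (rule bounded_op_comp[OF nX nX _ U]) (rule bounded_op_comp[OF nX nX V T])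
  then obtain G where G: "bounded_op X X G" "\<And>x. x \<in> elems X \<Longrightarrow> G (U (T (V x))) = x"
    "\<And>x. x \<in> elems X \<Longrightarrow> nrm X (G x) \<le> 2 * nrm X x"
    using near_identity_inverse[OF _ near] by blast
  have GU: "bounded_op X X (\<lambda>x. G (U x))" by (rule bounded_op_comp[OF nX nX U G(1)])
  have "nrm X (G (U x)) \<le> 4 * nrm X x" if "x \<in> elems X" for x
    using G(3)[OF bounded_op_mem[OF U that]] Un[OF that] by linarith
  then have "op_norm X X (\<lambda>x. G (U x)) \<le> 4" by (intro op_norm_le) auto
  moreover have "op_norm X X V \<le> 1" using Vn by (intro op_norm_le) auto
  ultimately have "op_norm X X (\<lambda>x. G (U x)) * op_norm X X V \<le> 4 * 1"
    using op_norm_nonneg[OF V] by (intro mult_mono) auto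
  then show ?thesis
    unfolding factors_through_def using V GU G(2) by (intro exI[of _ V] exI[of _ "\<lambda>x. G (U x)"]) auto
qed

end

section \<open>Sequence spaces over a normed space\<close>

lemma lp_space_simps [simp]:
  "smul (lp_space p Y) = (\<lambda>c x n. smul Y c (x n))"
  "nrm (lp_space p Y) = (\<lambda>x. lp_norm p (\<lambda>n. nrm Y (x n)))"
  by (auto simp: lp_space_def)

lemma lp_space_memI:
  assumes p: "1 < p" and "\<And>n. x n \<in> elems Y" "lp_le p (\<lambda>n. nrm Y (x n)) B"
  shows "x \<in> elems (lp_space p Y)" "nrm (lp_space p Y) x \<le> B"
  using lp_le_iff[OF p lp_le_nonneg[OF assms(3)]] assms by (auto simp: lp_space_def)

lemma lp_space_memD:
  assumes p: "1 < p" and "x \<in> elems (lp_space p Y)"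
  shows "x n \<in> elems Y" "lp_le p (\<lambda>n. nrm Y (x n)) (nrm (lp_space p Y) x)"
    "0 \<le> nrm (lp_space p Y) x"
  using assms lp_le_norm[OF p] by (auto simp: lp_space_def)

lemma sum_fun_apply: "(\<Sum>n\<in>F. z n) i = (\<Sum>n\<in>F. z n i)"
  for z :: "'b \<Rightarrow> 'c \<Rightarrow> 'a::comm_monoid_add"
  by (induction F rule: infinite_finite_induct) auto

lemma normed_nspace_lp_space:
  assumes p: "1 < p" and Y: "normed_nspace Y"
  shows "normed_nspace (lp_space p Y)"
proof -
  interpret Y: normed_nspace Y by fact
  note D = lp_space_memD[OF p] and I = lp_space_memI[OF p]
  show ?thesis
  proof
    show "0 \<in> elems (lp_space p Y)"
      using I(1)[of 0 Y 0] lp_le_single[OF p, of 0 0] Y.zero_mem Y.nrm_zero by simp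
  next
    fix x y assume x: "x \<in> elems (lp_space p Y)" and y: "y \<in> elems (lp_space p Y)"
    have mem: "(x + y) n \<in> elems Y" for n using D(1)[OF x] D(1)[OF y] by (simp add: Y.add_mem)
    have "lp_le p (\<lambda>n. nrm Y ((x + y) n)) (nrm (lp_space p Y) x + nrm (lp_space p Y) y)"
      by (rule lp_le_add[OF p D(2)[OF x] D(2)[OF y]])
         (use Y.nrm_triangle[OF D(1)[OF x] D(1)[OF y]] Y.nrm_nonneg[OF mem]
            Y.nrm_nonneg[OF D(1)[OF x]] Y.nrm_nonneg[OF D(1)[OF y]] in simp)
    from I[OF mem this]
    show "x + y \<in> elems (lp_space p Y)"
      "nrm (lp_space p Y) (x + y) \<le> nrm (lp_space p Y) x + nrm (lp_space p Y) y" .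
    show "smul (lp_space p Y) c (x + y) = smul (lp_space p Y) c x + smul (lp_space p Y) c y" for c
      using D(1)[OF x] D(1)[OF y] by (auto simp: fun_eq_iff Y.smul_add)
  next
    fix x and c d :: 'a assume x: "x \<in> elems (lp_space p Y)"
    have mem: "smul Y c (x n) \<in> elems Y" for n c using D(1)[OF x] by (rule Y.smul_mem)
    have le: "lp_le p (\<lambda>n. nrm Y (smul Y c (x n))) (norm c * nrm (lp_space p Y) x)" for c
      using lp_le_scale[OF p D(2)[OF x], of "norm c"] D(1)[OF x] by (simp add: Y.nrm_smul)
    show cx: "smul (lp_space p Y) c x \<in> elems (lp_space p Y)" for c
      using I(1)[OF mem le] by simp
    show "smul (lp_space p Y) (-1) x = - x"
      using D(1)[OF x] by (auto simp: fun_eq_iff Y.smul_minus_one)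
    show "smul (lp_space p Y) 1 x = x"
      using D(1)[OF x] by (auto simp: fun_eq_iff Y.smul_one)
    show "smul (lp_space p Y) c (smul (lp_space p Y) d x) = smul (lp_space p Y) (c * d) x"
      using D(1)[OF x] by (auto simp: fun_eq_iff Y.smul_smul)
    show "smul (lp_space p Y) (c + d) x = smul (lp_space p Y) c x + smul (lp_space p Y) d x"
      using D(1)[OF x] by (auto simp: fun_eq_iff Y.smul_add_left)
    show "nrm (lp_space p Y) (smul (lp_space p Y) c x) = norm c * nrm (lp_space p Y) x"
    proof (cases "c = 0")
      case True
      then show ?thesis using I(2)[OF mem le, of 0] D(3)[OF cx[of 0]] by simp
    next
      case False
      have "lp_le p (\<lambda>n. nrm Y (x n)) (inverse (norm c) * nrm (lp_space p Y) (smul (lp_space p Y) c x))"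
        using lp_le_scale[OF p D(2)[OF cx[of c]], of "inverse (norm c)"] False D(1)[OF x]
        by (simp add: Y.nrm_smul mult.assoc[symmetric])
      then have "nrm (lp_space p Y) x \<le> inverse (norm c) * nrm (lp_space p Y) (smul (lp_space p Y) c x)"
        using I(2) D(1)[OF x] by blast
      then have "norm c * nrm (lp_space p Y) x \<le> nrm (lp_space p Y) (smul (lp_space p Y) c x)"
        using False by (simp add: field_simps)
      with I(2)[OF mem le, of c] show ?thesis by simp
    qed
  next
    fix x assume x: "x \<in> elems (lp_space p Y)" "nrm (lp_space p Y) x = 0"
    have "nrm Y (x n) = 0" for n
      using lp_le_coord[OF p D(2)[OF x(1)], of n] x(2) Y.nrm_nonneg[OF D(1)[OF x(1)]] by (simp add: antisym)
    then show "x = 0" using Y.nrm_zeroD[OF D(1)[OF x(1)]] by (auto simp: fun_eq_iff)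
  qed
qed

lemma banach_nspace_lp_space:
  assumes p: "1 < p" and Y: "banach_nspace Y"
  shows "banach_nspace (lp_space p Y)"
proof -
  interpret Y: banach_nspace Y by fact
  interpret X: normed_nspace "lp_space p Y" using p Y.normed_nspace_axioms by (rule normed_nspace_lp_space)
  note D = lp_space_memD[OF p] and I = lp_space_memI[OF p]
  show ?thesis
  proof
    fix z and c :: real
    assume z: "\<And>n. z n \<in> elems (lp_space p Y) \<and> nrm (lp_space p Y) (z n) \<le> c * (1/2)^n"
    have zle: "lp_le p (\<lambda>i. nrm Y (z n i)) (c * (1/2)^n)" for n
      using z[of n] D(2) lp_le_mono[OF p] by blast
    have zi: "z n i \<in> elems Y \<and> nrm Y (z n i) \<le> c * (1/2)^n" for n i
      using lp_le_coord[OF p zle[of n], of i] D(1) z by auto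
    have "\<exists>s\<in>elems Y. \<forall>m. nrm Y (s - (\<Sum>n<m. z n i)) \<le> 2 * c * (1/2)^m" for i
      using zi by (intro Y.geometric_series)
    then obtain s where s: "\<And>i. s i \<in> elems Y" "\<And>i m. nrm Y (s i - (\<Sum>n<m. z n i)) \<le> 2 * c * (1/2)^m"
      by metis
    have sm: "(\<Sum>n\<in>F. z n i) \<in> elems Y" for i F using zi by (intro Y.sum_mem) auto
    have zn: "0 \<le> nrm Y (z n i)" for n i using zi Y.nrm_nonneg by blast
    have geo: "(\<lambda>n. c * (1/2)^(n + m)) sums (2 * c * (1/2)^m)" for m
      using sums_mult[OF geometric_sums[of "1/2::real"], of "c * (1/2)^m"] by (simp add: power_add mult_ac)
    have sz: "summable (\<lambda>n. nrm Y (z (n + m) i))" for i m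
      by (rule summable_comparison_test'[OF sums_summable[OF geo[of m]], of 0]) (use zi zn in auto)
    \<comment> \<open>The coordinatewise limits alone do not control the \<open>l\<^sub>p\<close> norm of the remainder; this bound
      does, through Minkowski's inequality for series.\<close>
    have tail: "nrm Y (s i - (\<Sum>n<m. z n i)) \<le> (\<Sum>n. nrm Y (z (n + m) i))" for i m
    proof (rule LIMSEQ_le_const)
      show "(\<lambda>M. 2 * c * (1/2)^(M + m) + (\<Sum>n. nrm Y (z (n + m) i))) \<longlonglongrightarrow> (\<Sum>n. nrm Y (z (n + m) i))"
        using tendsto_add[OF tendsto_mult_left[OF LIMSEQ_ignore_initial_segment[OF LIMSEQ_power_zero[of "1/2::real"]], of "2 * c" m]
          tendsto_const[of "\<Sum>n. nrm Y (z (n + m) i)"]] by simp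
      have "nrm Y (s i - (\<Sum>n<m. z n i)) \<le> 2 * c * (1/2)^(M + m) + (\<Sum>n. nrm Y (z (n + m) i))" for M
      proof -
        have split: "(\<Sum>n<M + m. z n i) = (\<Sum>n<m. z n i) + (\<Sum>n<M. z (n + m) i)"
          by (induction M) (auto simp: algebra_simps)
        have nsum: "nrm Y (\<Sum>n<M. z (n + m) i) \<le> (\<Sum>n<M. nrm Y (z (n + m) i))"
        proof (induction M)
          case (Suc M)
          have "(\<Sum>n<M. z (n + m) i) \<in> elems Y" using zi by (intro Y.sum_mem) auto
          then show ?case using Suc Y.nrm_triangle[of "\<Sum>n<M. z (n + m) i" "z (M + m) i"] zi by simp
        qed (simp add: Y.nrm_zero)
        have "s i - (\<Sum>n<m. z n i) = (s i - (\<Sum>n<M + m. z n i)) + (\<Sum>n<M. z (n + m) i)"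
          unfolding split by (simp add: algebra_simps)
        also have "nrm Y \<dots> \<le> nrm Y (s i - (\<Sum>n<M + m. z n i)) + nrm Y (\<Sum>n<M. z (n + m) i)"
          using s sm zi by (intro Y.nrm_triangle Y.diff_mem Y.sum_mem) auto
        also have "\<dots> \<le> 2 * c * (1/2)^(M + m) + (\<Sum>n. nrm Y (z (n + m) i))"
          using nsum sum_le_suminf[OF sz, of "{..<M}" m i] zn by (intro add_mono s) auto
        finally show ?thesis .
      qed
      then show "\<exists>N. \<forall>M\<ge>N. nrm Y (s i - (\<Sum>n<m. z n i)) \<le> 2 * c * (1/2)^(M + m) + (\<Sum>n. nrm Y (z (n + m) i))"
        by blast
    qed
    have rem: "lp_le p (\<lambda>i. nrm Y ((s - (\<Sum>n<m. z n)) i)) (2 * c * (1/2)^m)" for m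
    proof -
      have "lp_le p (\<lambda>i. nrm Y (s i - (\<Sum>n<m. z n i))) (\<Sum>n. c * (1/2)^(n + m))"
        by (rule lp_le_suminf[OF p zle sums_summable[OF geo]])
           (use tail Y.nrm_nonneg[OF Y.diff_mem[OF s(1) sm]] zn in simp)
      then show ?thesis using sums_unique[OF geo[of m]] by (simp add: sum_fun_apply)
    qed
    have mem: "(s - (\<Sum>n<m. z n)) i \<in> elems Y" for i m
      using s sm by (auto simp: sum_fun_apply intro: Y.diff_mem)
    have "s \<in> elems (lp_space p Y)" using I(1)[OF mem[of 0] rem[of 0]] by simp
    moreover have "nrm (lp_space p Y) (s - (\<Sum>n<m. z n)) \<le> 2 * c * (1/2)^m" for m
      using I(2)[OF mem rem] .
    ultimately show "\<exists>s\<in>elems (lp_space p Y). \<forall>m. nrm (lp_space p Y) (s - (\<Sum>n<m. z n)) \<le> 2 * c * (1/2)^m"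
      by blast
  qed
qed

section \<open>Continuous functions on the unit interval\<close>

lemma C01_simps [simp]:
  "smul C01 = (\<lambda>c f t. c * f t)"
  "nrm C01 = (\<lambda>f. SUP t\<in>{0..1}. norm (f t))"
  by (auto simp: C01_def)

lemma C01_mem_iff: "f \<in> elems C01 \<longleftrightarrow> continuous_on {0..1} f \<and> (\<forall>t. t \<notin> {0..1} \<longrightarrow> f t = 0)"
  by (auto simp: C01_def)

lemma C01_nrm_attained:
  fixes f :: "real \<Rightarrow> 'k::real_normed_field"
  assumes "f \<in> elems C01"
  obtains t where "t \<in> {0..1}" "nrm C01 f = norm (f t)" "\<And>s. norm (f s) \<le> norm (f t)"
proof -
  have "continuous_on {0..1} (\<lambda>t. norm (f t))"
    using assms by (auto simp: C01_mem_iff intro: continuous_on_norm)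
  then obtain t where t: "t \<in> {0..1}" "\<And>s. s \<in> {0..1} \<Longrightarrow> norm (f s) \<le> norm (f t)"
    using continuous_attains_sup[of "{0..1::real}" "\<lambda>t. norm (f t)"] by auto
  have "nrm C01 f = norm (f t)"
    using t by (auto intro!: cSup_eq_maximum)
  moreover have "norm (f s) \<le> norm (f t)" for s
    using t(2)[of s] assms by (cases "s \<in> {0..1}") (auto simp: C01_mem_iff)
  ultimately show thesis using that t by blast
qed

lemma C01_norm_le: "f \<in> elems C01 \<Longrightarrow> norm (f t) \<le> nrm C01 f"
  using C01_nrm_attained[of f] by metis

lemma C01_nrm_leI:
  assumes "f \<in> elems C01" "\<And>t. t \<in> {0..1} \<Longrightarrow> norm (f t) \<le> B"
  shows "nrm C01 f \<le> B"
  using C01_nrm_attained[OF assms(1)] assms(2) by metis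

lemma normed_nspace_C01: "normed_nspace (C01 :: ('k::real_normed_field, real \<Rightarrow> 'k) nspace)"
proof
  fix f g :: "real \<Rightarrow> 'k" and c d :: 'k
  show z: "0 \<in> elems (C01 :: ('k, real \<Rightarrow> 'k) nspace)"
    by (auto simp: C01_mem_iff zero_fun_def)
  assume f: "f \<in> elems C01"
  show m: "smul C01 c f \<in> elems C01" for c
    using f by (auto simp: C01_mem_iff intro: continuous_intros)
  show "smul C01 (-1) f = - f" "smul C01 c (smul C01 d f) = smul C01 (c * d) f" "smul C01 1 f = f"
    "smul C01 (c + d) f = smul C01 c f + smul C01 d f"
    by (auto simp: fun_eq_iff algebra_simps)
  show "nrm C01 (smul C01 c f) = norm c * nrm C01 f"
  proof (rule C01_nrm_attained[OF f])
    fix t assume t: "t \<in> {0..1}" "nrm C01 f = norm (f t)" "\<And>s. norm (f s) \<le> norm (f t)"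
    have "nrm C01 (smul C01 c f) = norm (c * f t)"
      unfolding C01_simps
      by (rule cSup_eq_maximum) (use t in \<open>auto simp: norm_mult intro: mult_left_mono\<close>)
    then show ?thesis using t(2) by (simp add: norm_mult)
  qed
  show "f = 0" if "nrm C01 f = 0"
    using C01_norm_le[OF f] that by (auto simp: fun_eq_iff)
  assume g: "g \<in> elems C01"
  show s: "f + g \<in> elems C01"
    using f g by (auto simp: C01_mem_iff plus_fun_def intro: continuous_intros)
  show "smul C01 c (f + g) = smul C01 c f + smul C01 c g"
    by (auto simp: fun_eq_iff algebra_simps)
  show "nrm C01 (f + g) \<le> nrm C01 f + nrm C01 g"
    by (rule C01_nrm_leI[OF s])
       (use norm_triangle_ineq C01_norm_le[OF f] C01_norm_le[OF g] in \<open>fastforce intro: order_trans add_mono\<close>)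
qed

interpretation C01: normed_nspace "C01 :: ('k::real_normed_field, real \<Rightarrow> 'k) nspace"
  by (rule normed_nspace_C01)

lemma banach_nspace_C01:
  "banach_nspace (C01 :: ('k::{real_normed_field,banach}, real \<Rightarrow> 'k) nspace)"
proof
  fix z :: "nat \<Rightarrow> real \<Rightarrow> 'k" and c :: real
  assume z: "\<And>n. z n \<in> elems C01 \<and> nrm C01 (z n) \<le> c * (1/2)^n"
  have zt: "norm (z n t) \<le> c * (1/2)^n" for n t
    using z[of n] C01_norm_le[of "z n" t] by linarith
  have geo: "(\<lambda>n. c * (1/2)^(n + m)) sums (2 * c * (1/2)^m)" for m
    using sums_mult[OF geometric_sums[of "1/2::real"], of "c * (1/2)^m"] by (simp add: power_add mult_ac)
  have nz: "summable (\<lambda>n. norm (z (n + m) t))" for m t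
    by (rule summable_comparison_test'[OF sums_summable[OF geo[of m]], of 0]) (use zt in auto)
  have sz: "summable (\<lambda>n. z n t)" for t using summable_norm_cancel[OF nz[of 0]] by simp
  define s where "s t = (\<Sum>n. z n t)" for t
  have rem: "norm (s t - (\<Sum>n<m. z n t)) \<le> 2 * c * (1/2)^m" for m t
  proof -
    have "s t - (\<Sum>n<m. z n t) = (\<Sum>n. z (n + m) t)"
      unfolding s_def by (subst suminf_split_initial_segment[OF sz, of _ m]) simp
    also have "norm \<dots> \<le> (\<Sum>n. norm (z (n + m) t))" by (rule summable_norm[OF nz])
    also have "\<dots> \<le> (\<Sum>n. c * (1/2)^(n + m))"
      by (intro suminf_le nz sums_summable[OF geo]) (use zt in auto)
    also have "\<dots> = 2 * c * (1/2)^m" using geo by (rule sums_unique[symmetric])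
    finally show ?thesis .
  qed
  have "uniform_limit {0..1} (\<lambda>m t. \<Sum>n<m. z n t) (\<lambda>t. \<Sum>n. z n t) sequentially"
    by (rule Weierstrass_m_test[where M = "\<lambda>n. c * (1/2)^n"]) (use zt geo[of 0] in \<open>auto simp: sums_iff\<close>)
  then have "continuous_on {0..1} s"
    unfolding s_def using z
    by (intro uniform_limit_theorem[where F = sequentially and f = "\<lambda>m t. \<Sum>n<m. z n t"])
       (auto simp: C01_mem_iff intro!: always_eventually continuous_on_sum)
  moreover have "s t = 0" if "t \<notin> {0..1}" for t
  proof -
    have "z n t = 0" for n using that z[of n] C01_mem_iff[of "z n"] by blast
    then show ?thesis by (simp add: s_def)
  qed
  ultimately have s: "s \<in> elems C01" by (auto simp: C01_mem_iff)
  have "nrm C01 (s - (\<Sum>n<m. z n)) \<le> 2 * c * (1/2)^m" for m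
    using rem[of _ m] s z
    by (intro C01_nrm_leI C01.diff_mem C01.sum_mem) (auto simp: sum_fun_apply)
  then show "\<exists>s\<in>elems C01. \<forall>m. nrm C01 (s - (\<Sum>n<m. z n)) \<le> 2 * c * (1/2)^m"
    using s by blast
qed

text \<open>From here on the norm is handled through the three facts above, so its supremum stays folded.\<close>

declare C01_simps(2) [simp del]

definition C01_on :: "real set \<Rightarrow> (real \<Rightarrow> 'k::real_normed_field) set" where
  "C01_on J = {f \<in> elems C01. \<forall>t. t \<notin> J \<longrightarrow> f t = 0}"

definition open_piece :: "real set \<Rightarrow> bool" where
  "open_piece J \<longleftrightarrow> open J \<and> J \<noteq> {} \<and> J \<subseteq> {0..1}"

lemma open_piece_split:
  assumes "open_piece U"
  obtains U1 U2 where "open_piece U1" "open_piece U2" "U1 \<subseteq> U" "U2 \<subseteq> U" "U1 \<inter> U2 = {}"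
proof -
  obtain u d where u: "0 < d" "ball u d \<subseteq> U"
    using assms unfolding open_piece_def open_contains_ball by blast
  have ball: "ball u d = {u - d <..< u + d}" by (auto simp: dist_real_def)
  have ne: "{u - d <..< u} \<noteq> {}" "{u <..< u + d} \<noteq> {}"
    using u(1) by (auto simp: greaterThanLessThan_empty_iff)
  have "U \<subseteq> {0..1}" using assms by (simp add: open_piece_def)
  moreover have "{u - d <..< u} \<subseteq> U" "{u <..< u + d} \<subseteq> U"
    using u unfolding ball by fastforce+
  ultimately show thesis using ne
    by (intro that[of "{u - d <..< u}" "{u <..< u + d}"]) (auto simp: open_piece_def simp del: greaterThanLessThan_empty_iff)
qed

lemma open_piece_preimage:
  fixes f :: "real \<Rightarrow> 'k::real_normed_field"
  assumes J: "open_piece J" and f: "f \<in> elems C01" and V: "open V" and t: "t \<in> J" "f t \<in> V"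
  shows "open_piece {s \<in> J. f s \<in> V}"
proof -
  have "continuous_on J f"
    using J f by (auto simp: open_piece_def C01_mem_iff intro: continuous_on_subset)
  then have "open (J \<inter> f -` V)"
    using J V by (intro continuous_open_preimage) (auto simp: open_piece_def)
  moreover have "J \<inter> f -` V = {s \<in> J. f s \<in> V}" by auto
  ultimately show ?thesis using J t by (auto simp: open_piece_def)
qed

lemma open_piece_where_large:
  fixes f :: "real \<Rightarrow> 'k::real_normed_field"
  assumes "open_piece J" "f \<in> elems C01" "t \<in> J" "\<epsilon> < norm (f t)"
  shows "open_piece {s \<in> J. \<epsilon> < norm (f s)}"
  using open_piece_preimage[OF assms(1,2), of "{z. \<epsilon> < norm z}" t] assms(3,4)
  by (simp add: open_Collect_less continuous_on_norm)

lemma norm_aligned_sum: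
  fixes z w :: "'k::real_normed_field"
  obtains c where "norm c = 1" "norm (c * z + w) = norm z + norm w"
proof (cases "z = 0 \<or> w = 0")
  case True
  then show thesis using that[of 1] by auto
next
  case False
  define c where "c = w * of_real (norm z) / (z * of_real (norm w))"
  have "c * z + w = w * of_real (norm z / norm w + 1)"
    using False by (simp add: c_def field_simps)
  then have "norm (c * z + w) = norm w * \<bar>norm z / norm w + 1\<bar>" by (simp only: norm_mult norm_of_real)
  also have "\<dots> = norm z + norm w" using False by (simp add: abs_of_nonneg algebra_simps)
  finally show thesis using False by (intro that[of c]) (auto simp: c_def norm_mult norm_divide)
qed

lemma C01_disjoint_combination:
  assumes f: "f \<in> elems C01" "nrm C01 f \<le> 1" and g: "g \<in> elems C01" "nrm C01 g \<le> 1"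
    and c: "norm c \<le> 1" and dis: "\<And>t. f t = 0 \<or> g t = 0"
  shows "smul C01 c f + g \<in> elems C01" "nrm C01 (smul C01 c f + g) \<le> 1"
proof -
  show *: "smul C01 c f + g \<in> elems C01" using f g by (intro C01.add_mem C01.smul_mem)
  have "norm (c * f t + g t) \<le> 1" for t
    using dis[of t] C01_norm_le[OF f(1), of t] C01_norm_le[OF g(1), of t] f(2) g(2)
      mult_mono[OF c, of "norm (f t)" 1] by (auto simp: norm_mult)
  then show "nrm C01 (smul C01 c f + g) \<le> 1" using * by (intro C01_nrm_leI) auto
qed

lemma bump_exists:
  assumes J: "open_piece J" and t: "t \<in> J"
  obtains d and h :: "real \<Rightarrow> 'k::real_normed_field"
  where "0 < d" "ball t d \<subseteq> J" "h \<in> C01_on J" "nrm C01 h \<le> 1" "\<And>s. s \<in> ball t d \<Longrightarrow> h s = 1"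
    "\<And>s. norm (1 - h s) \<le> 1"
proof -
  obtain e where e: "0 < e" "ball t e \<subseteq> J"
    using J t unfolding open_piece_def open_contains_ball by blast
  define d where "d = e / 2"
  define h :: "real \<Rightarrow> 'k" where "h s = of_real (max 0 (min 1 (2 - \<bar>s - t\<bar> / d)))" for s
  have d: "0 < d" using e by (simp add: d_def)
  have supp: "h s = 0" if "s \<notin> J" for s
  proof -
    have "s \<notin> ball t e" using e that by auto
    then have "2 \<le> \<bar>s - t\<bar> / d" using d by (simp add: d_def dist_real_def field_simps)
    then show ?thesis by (simp add: h_def)
  qed
  have cont: "continuous_on {0..1} h"
    unfolding h_def using d by (intro continuous_intros) auto
  have h: "h \<in> C01_on J" using supp cont J unfolding C01_on_def C01_mem_iff open_piece_def by blast
  have "nrm C01 h \<le> 1" using h by (intro C01_nrm_leI) (auto simp: C01_on_def h_def)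
  moreover have "h s = 1" if "s \<in> ball t d" for s
  proof -
    have "\<bar>s - t\<bar> / d < 1" using that d by (simp add: dist_real_def)
    then show ?thesis by (simp add: h_def)
  qed
  moreover have "norm (1 - h s) \<le> 1" for s
  proof -
    have "norm (1 - h s) = norm (of_real (1 - max 0 (min 1 (2 - \<bar>s - t\<bar> / d))) :: 'k)" by (simp add: h_def)
    then show ?thesis unfolding norm_of_real by simp
  qed
  ultimately show thesis using d h e by (intro that[of d h]) (auto simp: d_def)
qed

section \<open>Operators on continuous functions are locally close to scalars\<close>

text \<open>If some function of norm one with support in \<open>J\<close> and away from \<open>t \<in> J\<close> has a
  large image at \<open>t\<close>, its image is large on a smaller piece around \<open>t\<close> on which the function
  itself vanishes. Repeating this on the smaller piece stacks up disjointly supported functions, and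
  their aligned sum, which still has norm one, gets an image larger than the norm of the operator.\<close>

lemma local_off_diagonal_small:
  fixes S :: "(real \<Rightarrow> 'k::real_normed_field) \<Rightarrow> real \<Rightarrow> 'k"
  assumes S: "bounded_op C01 C01 S" and \<epsilon>: "0 < \<epsilon>" and J0: "open_piece J0"
  shows "\<exists>J\<subseteq>J0. open_piece J \<and> (\<forall>t\<in>J. \<forall>f\<in>C01_on J. nrm C01 f \<le> 1 \<longrightarrow>
    (\<exists>d>0. \<forall>s\<in>ball t d. f s = 0) \<longrightarrow> norm (S f t) \<le> \<epsilon>)"
proof (rule ccontr)
  assume neg: "\<not> ?thesis"
  have large: "\<exists>t f d. t \<in> J \<and> f \<in> C01_on J \<and> nrm C01 f \<le> 1 \<and> 0 < d \<and>
      (\<forall>s\<in>ball t d. f s = 0) \<and> \<epsilon> < norm (S f t)" if "J \<subseteq> J0" "open_piece J" for J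
    using neg that by (meson not_le)
  have stack: "\<exists>t f. t \<in> J \<and> f \<in> C01_on J \<and> nrm C01 f \<le> 1 \<and> real k * \<epsilon> \<le> norm (S f t)"
    if "J \<subseteq> J0" "open_piece J" for J and k :: nat
    using that
  proof (induction k arbitrary: J)
    case 0
    have "(0 :: real \<Rightarrow> 'k) \<in> C01_on J" by (auto simp: C01_on_def C01.zero_mem)
    then show ?case
      using 0 by (auto simp: C01.nrm_zero open_piece_def intro!: exI[of _ "0 :: real \<Rightarrow> 'k"])
  next
    case (Suc k)
    obtain t1 f1 d where 1: "t1 \<in> J" "f1 \<in> C01_on J" "nrm C01 f1 \<le> 1" "0 < d"
      "\<And>s. s \<in> ball t1 d \<Longrightarrow> f1 s = 0" "\<epsilon> < norm (S f1 t1)"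
      using large[OF Suc.prems] by blast
    have f1: "f1 \<in> elems C01" using 1 by (simp add: C01_on_def)
    define J1 where "J1 = {s \<in> J \<inter> ball t1 d. \<epsilon> < norm (S f1 s)}"
    have "open_piece (J \<inter> ball t1 d)" using Suc.prems 1 by (auto simp: open_piece_def)
    then have J1: "open_piece J1" unfolding J1_def
      by (rule open_piece_where_large[OF _ bounded_op_mem[OF S f1], of _ t1]) (use 1 in auto)
    have "J1 \<subseteq> J0" "J1 \<subseteq> J" using Suc.prems by (auto simp: J1_def)
    with Suc.IH[of J1] J1 obtain t f2 where 2: "t \<in> J1" "f2 \<in> C01_on J1" "nrm C01 f2 \<le> 1"
      "real k * \<epsilon> \<le> norm (S f2 t)" by blast
    have f2: "f2 \<in> elems C01" using 2 by (simp add: C01_on_def)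
    obtain c where c: "norm c = 1" "norm (c * S f1 t + S f2 t) = norm (S f1 t) + norm (S f2 t)"
      by (rule norm_aligned_sum)
    have dis: "f1 s = 0 \<or> f2 s = 0" for s
      using 1(5)[of s] 2(2) by (auto simp: C01_on_def J1_def)
    define f where "f = smul C01 c f1 + f2"
    have "f \<in> C01_on J" "nrm C01 f \<le> 1"
      using C01_disjoint_combination[OF f1 1(3) f2 2(3) _ dis, of c] c(1) 1(2) 2(2) \<open>J1 \<subseteq> J\<close>
      unfolding f_def by (auto simp: C01_on_def)
    moreover have "S f = smul C01 c (S f1) + S f2"
      unfolding f_def by (simp only: bounded_op_add[OF S C01.smul_mem[OF f1] f2] bounded_op_smul[OF S f1])
    then have "norm (S f t) = norm (S f1 t) + norm (S f2 t)" using c by simp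
    then have "real (Suc k) * \<epsilon> \<le> norm (S f t)"
      using 2(1,4) by (auto simp: J1_def algebra_simps)
    ultimately show ?case using 2(1) \<open>J1 \<subseteq> J\<close> by blast
  qed
  obtain M where M: "0 < M" "\<And>f. f \<in> elems C01 \<Longrightarrow> nrm C01 (S f) \<le> M * nrm C01 f"
    using C01.bounded_opE[OF S] by blast
  obtain k :: nat where k: "M / \<epsilon> < real k" using reals_Archimedean2 by blast
  obtain t f where f: "f \<in> C01_on J0" "nrm C01 f \<le> 1" "real k * \<epsilon> \<le> norm (S f t)"
    using stack[of J0 k] J0 by blast
  have f': "f \<in> elems C01" using f by (simp add: C01_on_def)
  have "norm (S f t) \<le> M * nrm C01 f"
    using C01_norm_le[OF bounded_op_mem[OF S f'], of t] M(2)[OF f'] by linarith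
  also have "\<dots> \<le> M" using M(1) f(2) by simp
  finally show False using k f(3) \<epsilon> by (simp add: field_simps)
qed

text \<open>Subtracting \<open>f t\<close> times a bump reduces the general function to one that vanishes at \<open>t\<close>, and
  such a function is a uniform limit of functions vanishing near \<open>t\<close>. The scalar is the value of the
  image of the bump.\<close>

lemma locally_scalar:
  fixes S :: "(real \<Rightarrow> 'k::real_normed_field) \<Rightarrow> real \<Rightarrow> 'k"
  assumes S: "bounded_op C01 C01 S" and \<epsilon>: "0 < \<epsilon>" and J0: "open_piece J0"
  obtains J a where "J \<subseteq> J0" "open_piece J"
    "\<And>t f. \<lbrakk>t \<in> J; f \<in> C01_on J\<rbrakk> \<Longrightarrow> norm (S f t - a * f t) \<le> \<epsilon> * nrm C01 f"
proof -
  \<comment> \<open>Four parts for a function of norm two vanishing at \<open>t\<close>, one for the variation of the scalar.\<close>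
  define \<eta> where "\<eta> = \<epsilon> / 5"
  have \<eta>: "0 < \<eta>" using \<epsilon> by (simp add: \<eta>_def)
  obtain M where M: "0 < M" "\<And>f. f \<in> elems C01 \<Longrightarrow> nrm C01 (S f) \<le> M * nrm C01 f"
    using C01.bounded_opE[OF S] by blast
  obtain J1 where J1: "J1 \<subseteq> J0" "open_piece J1" and
    near: "\<forall>t\<in>J1. \<forall>f\<in>C01_on J1. nrm C01 f \<le> 1 \<longrightarrow>
      (\<exists>d>0. \<forall>s\<in>ball t d. f s = 0) \<longrightarrow> norm (S f t) \<le> \<eta>"
    using local_off_diagonal_small[OF S \<eta> J0] by blast
  have S_diff: "S (f - g) t = S f t - S g t" and S_scale: "S (smul C01 c f) t = c * S f t"
    if "f \<in> elems C01" "g \<in> elems C01" for f g c t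
    using bounded_op_diff[OF normed_nspace_C01 S that] bounded_op_smul[OF S that(1), of c] by auto
  have S_le: "norm (S f t) \<le> M * nrm C01 f" if "f \<in> elems C01" for f t
    using C01_norm_le[OF bounded_op_mem[OF S that], of t] M(2)[OF that] by linarith
  have vanishing: "norm (S f t) \<le> 2 * \<eta>"
    if t: "t \<in> J1" and f: "f \<in> C01_on J1" "nrm C01 f \<le> 1" and ft: "f t = 0" for t f
  proof -
    have fC: "f \<in> elems C01" using f by (simp add: C01_on_def)
    define U where "U = {s \<in> J1. f s \<in> ball 0 (\<eta> / M)}"
    have U: "open_piece U" "t \<in> U" unfolding U_def
      using open_piece_preimage[OF J1(2) fC open_ball t, of 0 "\<eta> / M"] t ft \<eta> M(1) by auto
    obtain d and h :: "real \<Rightarrow> 'k" where h: "0 < d" "ball t d \<subseteq> U" "h \<in> C01_on U" "nrm C01 h \<le> 1"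
      "\<And>s. s \<in> ball t d \<Longrightarrow> h s = 1" "\<And>s. norm (1 - h s) \<le> 1"
      using bump_exists[OF U] by blast
    have hC: "h \<in> elems C01" using h by (simp add: C01_on_def)
    define g where "g = (\<lambda>s. f s * h s)"
    have gC: "g \<in> elems C01"
      using fC hC by (auto simp: C01_mem_iff g_def intro: continuous_intros)
    have "nrm C01 g \<le> \<eta> / M"
    proof (rule C01_nrm_leI[OF gC])
      fix s
      show "norm (g s) \<le> \<eta> / M"
      proof (cases "s \<in> U")
        case True
        have "norm (f s) * norm (h s) \<le> \<eta> / M * 1"
          using True C01_norm_le[OF hC, of s] h(4) \<eta> M(1) by (intro mult_mono) (auto simp: U_def)
        then show ?thesis by (simp add: g_def norm_mult)
      next
        case False
        then show ?thesis using h(3) \<eta> M(1) by (auto simp: g_def C01_on_def)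
      qed
    qed
    then have Sg: "norm (S g t) \<le> \<eta>"
      using S_le[OF gC, of t] mult_left_mono[of "nrm C01 g" "\<eta> / M" M] M(1) by simp
    have fg: "f - g \<in> C01_on J1"
      using C01.diff_mem[OF fC gC] f by (auto simp: C01_on_def g_def)
    have "nrm C01 (f - g) \<le> 1"
    proof (rule C01_nrm_leI[OF C01.diff_mem[OF fC gC]])
      fix s
      have "norm (f s) * norm (1 - h s) \<le> 1 * 1"
        using C01_norm_le[OF fC, of s] f(2) h(6) by (intro mult_mono) auto
      then show "norm ((f - g) s) \<le> 1" by (simp add: g_def norm_mult[symmetric] right_diff_distrib)
    qed
    moreover have "\<forall>s\<in>ball t d. (f - g) s = 0" using h(5) by (simp add: g_def)
    ultimately have "norm (S (f - g) t) \<le> \<eta>" using near t fg h(1) by blast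
    then show ?thesis using Sg S_diff[OF fC gC] norm_triangle_sub[of "S f t" "S g t"] by simp
  qed
  obtain t0 where t0: "t0 \<in> J1" using J1 by (auto simp: open_piece_def)
  obtain d and h :: "real \<Rightarrow> 'k" where h: "0 < d" "ball t0 d \<subseteq> J1" "h \<in> C01_on J1" "nrm C01 h \<le> 1"
    "\<And>s. s \<in> ball t0 d \<Longrightarrow> h s = 1"
    using bump_exists[OF J1(2) t0] by metis
  have hC: "h \<in> elems C01" using h by (simp add: C01_on_def)
  define a where "a = S h t0"
  define J where "J = {s \<in> ball t0 d. S h s \<in> ball a \<eta>}"
  have "open_piece (ball t0 d)" using h J1 by (auto simp: open_piece_def)
  then have J: "open_piece J" unfolding J_def
    by (rule open_piece_preimage[OF _ bounded_op_mem[OF S hC] open_ball, of _ t0]) (use h \<eta> in \<open>auto simp: a_def\<close>)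
  have unit: "norm (S f t - a * f t) \<le> \<epsilon>" if t: "t \<in> J" and f: "f \<in> C01_on J" "nrm C01 f \<le> 1" for t f
  proof -
    have fC: "f \<in> elems C01" using f by (simp add: C01_on_def)
    have ft: "norm (f t) \<le> 1" using C01_norm_le[OF fC, of t] f by simp
    have ht: "h t = 1" "t \<in> J1" using t h by (auto simp: J_def)
    define g where "g = smul C01 (1/2) (f - smul C01 (f t) h)"
    have fhC: "f - smul C01 (f t) h \<in> elems C01" using fC hC by (intro C01.diff_mem C01.smul_mem)
    have gC: "g \<in> elems C01" unfolding g_def using fhC by (rule C01.smul_mem)
    have JJ1: "J \<subseteq> J1" using h(2) by (auto simp: J_def)
    have gJ: "g \<in> C01_on J1" using gC f(1) h(3) JJ1 by (auto simp: C01_on_def g_def)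
    have "nrm C01 g = norm (1/2::'k) * nrm C01 (f - smul C01 (f t) h)"
      unfolding g_def using fhC by (rule C01.nrm_smul)
    also have "\<dots> \<le> 1/2 * (nrm C01 f + norm (f t) * nrm C01 h)"
      using C01.nrm_diff_le[OF fC C01.smul_mem[OF hC], of "f t"] C01.nrm_smul[OF hC, of "f t"]
      by (simp add: norm_divide)
    also have "\<dots> \<le> 1" using f(2) ft mult_mono[OF ft h(4)] C01.nrm_nonneg[OF hC] by simp
    finally have "norm (S g t) \<le> 2 * \<eta>" using ht gJ by (intro vanishing) (auto simp: g_def)
    moreover have "S f t - f t * S h t = 2 * S g t"
      unfolding g_def using S_diff[OF fC C01.smul_mem[OF hC]] S_scale[OF fhC fhC, of "1/2"] S_scale[OF hC hC]
        by (simp add: mult.commute)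
    ultimately have 1: "norm (S f t - f t * S h t) \<le> 4 * \<eta>" by (simp add: norm_mult)
    have "norm (f t * (S h t - a)) \<le> 1 * \<eta>"
      unfolding norm_mult using ft t by (intro mult_mono) (auto simp: J_def dist_norm norm_minus_commute)
    moreover have eq: "S f t - a * f t = (S f t - f t * S h t) + f t * (S h t - a)" by (simp add: algebra_simps)
    ultimately have "norm (S f t - a * f t) \<le> 4 * \<eta> + \<eta>"
      unfolding eq by (intro norm_triangle_mono 1) simp
    then show ?thesis by (simp add: \<eta>_def)
  qed
  show thesis
  proof (rule that[of J a])
    show "J \<subseteq> J0" using J1 h by (auto simp: J_def)
    fix t and f :: "real \<Rightarrow> 'k" assume t: "t \<in> J" and f: "f \<in> C01_on J"
    have fC: "f \<in> elems C01" using f by (simp add: C01_on_def)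
    show "norm (S f t - a * f t) \<le> \<epsilon> * nrm C01 f"
    proof (cases "nrm C01 f = 0")
      case True
      then have "norm (S f t) \<le> 0" "norm (f t) \<le> 0"
        using S_le[OF fC, of t] C01_norm_le[OF fC, of t] by simp_all
      then show ?thesis using True by simp
    next
      case False
      define r where "r = nrm C01 f"
      have r: "0 < r" using False C01.nrm_nonneg[OF fC] by (simp add: r_def)
      define g where "g = smul C01 (of_real (1/r)) f"
      have "g \<in> elems C01" unfolding g_def using fC by (rule C01.smul_mem)
      then have "g \<in> C01_on J" using f by (auto simp: C01_on_def g_def)
      moreover have "nrm C01 g \<le> 1"
        unfolding g_def using C01.nrm_smul[OF fC, of "of_real (1/r)"] r
        by (simp only: norm_of_real) (simp add: r_def)
      ultimately have "norm (S g t - a * g t) \<le> \<epsilon>" using t by (intro unit)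
      also have "S g t - a * g t = of_real (1/r) * (S f t - a * f t)"
        unfolding g_def using S_scale[OF fC fC, of "of_real (1/r)"] by (simp add: algebra_simps)
      finally have "1/r * norm (S f t - a * f t) \<le> \<epsilon>"
        using r by (simp only: norm_mult norm_of_real) simp
      then show ?thesis using r by (simp add: field_simps r_def)
    qed
  qed (rule J)
qed

section \<open>Small rows and columns\<close>

lemma C01_on_combination:
  assumes f: "f \<in> C01_on U1" and g: "g \<in> C01_on U2" and sub: "U1 \<subseteq> U" "U2 \<subseteq> U"
  shows "smul C01 c f + g \<in> C01_on U"
proof -
  have "smul C01 c f + g \<in> elems C01"
    using f g by (intro C01.add_mem C01.smul_mem) (auto simp: C01_on_def)
  moreover have "f t = 0" "g t = 0" if "t \<notin> U" for t
    using that sub f g unfolding C01_on_def by blast+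
  ultimately show ?thesis by (simp add: C01_on_def)
qed

lemma infinite_nat_split:
  fixes N :: "nat set"
  assumes "infinite N"
  obtains N1 N2 where "infinite N1" "infinite N2" "N1 \<subseteq> N" "N2 \<subseteq> N" "N1 \<inter> N2 = {}"
proof -
  define e where "e = enumerate N"
  have inj: "inj e" unfolding e_def using assms by (rule inj_enumerate)
  have rng: "range e \<subseteq> N" unfolding e_def using assms by (auto intro: enumerate_in_set)
  have ev: "infinite (range (\<lambda>n::nat. 2 * n))" "infinite (range (\<lambda>n::nat. 2 * n + 1))"
    by (auto intro!: range_inj_infinite injI)
  show thesis
  proof (rule that[of "e ` range (\<lambda>n. 2 * n)" "e ` range (\<lambda>n. 2 * n + 1)"])
    show "e ` range (\<lambda>n. 2 * n) \<inter> e ` range (\<lambda>n. 2 * n + 1) = {}"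
      by (auto dest!: injD[OF inj]) presburger
  qed (use ev inj rng in \<open>auto dest: finite_imageD intro: inj_on_subset\<close>)
qed

text \<open>A row of the operator is small on sequences supported in a suitable infinite set of indices:
  otherwise \<open>k\<close> disjointly supported sequences, aligned at a common point, have an image of size
  proportional to \<open>k\<close>, whereas the norm of their sum grows more slowly. Splitting the
  index set into infinite parts, rather than cutting off initial segments, also covers \<open>p = \<infinity>\<close>,
  where finitely supported sequences are not dense.\<close>

lemma row_small_on_infinite_set:
  fixes R :: "(nat \<Rightarrow> 'a::ab_group_add) \<Rightarrow> real \<Rightarrow> 'k::real_normed_field"
  assumes p: "1 < p" and Y: "normed_nspace Y" and R: "bounded_op (lp_space p Y) C01 R"
    and \<epsilon>: "0 < \<epsilon>" and N0: "infinite N0" and J0: "open_piece J0"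
  shows "\<exists>N\<subseteq>N0. infinite N \<and> (\<exists>J\<subseteq>J0. open_piece J \<and>
    (\<forall>t\<in>J. \<forall>x\<in>elems (lp_space p Y). nrm (lp_space p Y) x \<le> 1 \<longrightarrow> (\<forall>n. n \<notin> N \<longrightarrow> x n = 0) \<longrightarrow>
      norm (R x t) \<le> \<epsilon>))"
proof (rule ccontr)
  let ?X = "lp_space p Y"
  interpret Y: normed_nspace Y by fact
  interpret X: normed_nspace ?X using p Y by (rule normed_nspace_lp_space)
  assume neg: "\<not> ?thesis"
  have large: "\<exists>t\<in>J. \<exists>x\<in>elems ?X. nrm ?X x \<le> 1 \<and> (\<forall>n. n \<notin> N \<longrightarrow> x n = 0) \<and> \<epsilon> < norm (R x t)"
    if "N \<subseteq> N0" "infinite N" "J \<subseteq> J0" "open_piece J" for N J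
    using neg that by (meson not_le)
  have stack: "\<exists>t\<in>J. \<exists>x\<in>elems ?X. lp_le p (\<lambda>n. nrm Y (x n)) (disjoint_growth p k) \<and>
      (\<forall>n. n \<notin> N \<longrightarrow> x n = 0) \<and> real k * \<epsilon> \<le> norm (R x t)"
    if "N \<subseteq> N0" "infinite N" "J \<subseteq> J0" "open_piece J" for N J and k :: nat
    using that
  proof (induction k arbitrary: N J)
    case 0
    have "lp_le p (\<lambda>n. nrm Y ((0 :: nat \<Rightarrow> 'a) n)) (disjoint_growth p 0)"
      using lp_le_mono[OF p lp_le_single[OF p, of 0 0], of "disjoint_growth p 0"]
      by (simp add: Y.nrm_zero disjoint_growth_def)
    then show ?case using 0 X.zero_mem by (auto simp: open_piece_def intro!: bexI[of _ "0 :: nat \<Rightarrow> 'a"])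
  next
    case (Suc k)
    obtain N1 N2 where N: "infinite N1" "infinite N2" "N1 \<subseteq> N" "N2 \<subseteq> N" "N1 \<inter> N2 = {}"
      using infinite_nat_split[OF Suc.prems(2)] by blast
    obtain t1 x1 where 1: "t1 \<in> J" "x1 \<in> elems ?X" "nrm ?X x1 \<le> 1" "\<And>n. n \<notin> N1 \<Longrightarrow> x1 n = 0"
      "\<epsilon> < norm (R x1 t1)"
      using large[OF order_trans[OF N(3) Suc.prems(1)] N(1) Suc.prems(3,4)] by blast
    define J1 where "J1 = {s \<in> J. \<epsilon> < norm (R x1 s)}"
    have J1: "open_piece J1" unfolding J1_def
      by (rule open_piece_where_large[OF Suc.prems(4) bounded_op_mem[OF R 1(2)] 1(1,5)])
    have sub: "J1 \<subseteq> J" "J1 \<subseteq> J0" "N2 \<subseteq> N0" using Suc.prems N by (auto simp: J1_def)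
    obtain t x2 where 2: "t \<in> J1" "x2 \<in> elems ?X"
      "lp_le p (\<lambda>n. nrm Y (x2 n)) (disjoint_growth p k)" "\<And>n. n \<notin> N2 \<Longrightarrow> x2 n = 0"
      "real k * \<epsilon> \<le> norm (R x2 t)"
      using Suc.IH[OF sub(3) N(2) sub(2) J1] by blast
    obtain c where c: "norm c = 1" "norm (c * R x1 t + R x2 t) = norm (R x1 t) + norm (R x2 t)"
      by (rule norm_aligned_sum)
    define x where "x = smul ?X c x1 + x2"
    have xX: "x \<in> elems ?X" unfolding x_def using 1 2 by (intro X.add_mem X.smul_mem)
    note mem = lp_space_memD(1)[OF p 1(2)] lp_space_memD(1)[OF p 2(2)]
    have "lp_le p (\<lambda>n. nrm Y (x n)) (disjoint_growth p (Suc k))"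
    proof (rule lp_le_disjoint[OF p _ 2(3)])
      show "lp_le p (\<lambda>n. nrm Y (x1 n)) 1"
        using lp_le_mono[OF p lp_space_memD(2)[OF p 1(2)] 1(3)] .
      show "nrm Y (x1 n) = 0 \<or> nrm Y (x2 n) = 0" for n
        using 1(4)[of n] 2(4)[of n] N(5) Y.nrm_zero by (cases "n \<in> N1"; cases "n \<in> N2") auto
      show "\<bar>nrm Y (x n)\<bar> \<le> \<bar>nrm Y (x1 n)\<bar> + \<bar>nrm Y (x2 n)\<bar>" for n
        using Y.nrm_triangle[OF Y.smul_mem[OF mem(1)] mem(2), of c n n] Y.nrm_smul[OF mem(1), of c n]
          Y.nrm_nonneg[OF mem(1)[of n]] Y.nrm_nonneg[OF mem(2)[of n]]
          Y.nrm_nonneg[OF lp_space_memD(1)[OF p xX, of n]] c(1) by (simp add: x_def)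
    qed
    moreover have "x n = 0" if "n \<notin> N" for n
    proof -
      have "n \<notin> N1" "n \<notin> N2" using that N(3,4) by auto
      then show ?thesis using 1(4) 2(4) by (simp add: x_def Y.smul_zero)
    qed
    moreover have "real (Suc k) * \<epsilon> \<le> norm (R x t)"
    proof -
      have "R x = smul C01 c (R x1) + R x2"
        unfolding x_def by (simp only: bounded_op_add[OF R X.smul_mem[OF 1(2)] 2(2)] bounded_op_smul[OF R 1(2)])
      then have "norm (R x t) = norm (R x1 t) + norm (R x2 t)" using c by simp
      then show ?thesis using 2(1,5) by (auto simp: J1_def algebra_simps)
    qed
    ultimately show ?case using 2(1) \<open>J1 \<subseteq> J\<close> xX by blast
  qed
  obtain M where M: "0 < M" "\<And>x. x \<in> elems ?X \<Longrightarrow> nrm C01 (R x) \<le> M * nrm ?X x"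
    using X.bounded_opE[OF R] by blast
  obtain k where k: "M * disjoint_growth p k < real k * \<epsilon>"
    using disjoint_growth_sublinear[OF p \<epsilon>] by blast
  obtain t x where x: "x \<in> elems ?X" "lp_le p (\<lambda>n. nrm Y (x n)) (disjoint_growth p k)"
    "real k * \<epsilon> \<le> norm (R x t)"
    using stack[OF order_refl N0 order_refl J0, of k] by blast
  have "norm (R x t) \<le> M * nrm ?X x"
    using C01_norm_le[OF bounded_op_mem[OF R x(1)], of t] M(2)[OF x(1)] by linarith
  also have "\<dots> \<le> M * disjoint_growth p k"
    using M(1) lp_space_memI(2)[OF p lp_space_memD(1)[OF p x(1)] x(2)] by (intro mult_left_mono) auto
  finally show False using k x(3) by linarith
qed

text \<open>For \<open>p < \<infinity>\<close>, if a column were large on every piece and every tail, one could find functions with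
  disjoint supports and disjoint finite sets of coordinates witnessing this; for a suitable choice
  of signs the image of their sum is large on all these sets at once (average over
  the two signs and use convexity), which contradicts the boundedness.\<close>

lemma column_small_on_tail:
  fixes S :: "(real \<Rightarrow> 'k::real_normed_field) \<Rightarrow> nat \<Rightarrow> 'a::ab_group_add"
  assumes r: "1 < r" and Y: "normed_nspace Y" and S: "bounded_op C01 (lp_space (ereal r) Y) S"
    and \<epsilon>: "0 < \<epsilon>" and U0: "open_piece U0"
  shows "\<exists>U\<subseteq>U0. open_piece U \<and> (\<exists>m. \<forall>f\<in>C01_on U. nrm C01 f \<le> 1 \<longrightarrow>
    lp_le (ereal r) (\<lambda>i. if m \<le> i then nrm Y (S f i) else 0) \<epsilon>)" (is ?small)
proof (rule ccontr)
  let ?X = "lp_space (ereal r) Y"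
  have p: "1 < ereal r" using r by simp
  interpret Y: normed_nspace Y by fact
  interpret X: normed_nspace ?X using p Y by (rule normed_nspace_lp_space)
  assume neg: "\<not> ?thesis"
  have SY: "S f i \<in> elems Y" if "f \<in> elems C01" for f i
    using lp_space_memD(1)[OF p bounded_op_mem[OF S that]] .
  have large: "\<exists>f\<in>C01_on U. nrm C01 f \<le> 1 \<and>
      (\<exists>F\<subseteq>{m..}. finite F \<and> \<epsilon> powr r < (\<Sum>i\<in>F. nrm Y (S f i) powr r))"
    if "U \<subseteq> U0" "open_piece U" for U and m :: nat
  proof -
    have "\<not> (\<forall>f\<in>C01_on U. nrm C01 f \<le> 1 \<longrightarrow>
      lp_le (ereal r) (\<lambda>i. if m \<le> i then nrm Y (S f i) else 0) \<epsilon>)"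
    proof
      assume "\<forall>f\<in>C01_on U. nrm C01 f \<le> 1 \<longrightarrow>
        lp_le (ereal r) (\<lambda>i. if m \<le> i then nrm Y (S f i) else 0) \<epsilon>"
      with that have ?small by (intro exI[of _ U] conjI exI[of _ m])
      with neg show False ..
    qed
    then obtain f where f: "f \<in> C01_on U" "nrm C01 f \<le> 1"
      "\<not> lp_le (ereal r) (\<lambda>i. if m \<le> i then nrm Y (S f i) else 0) \<epsilon>"
      by blast
    have fC: "f \<in> elems C01" using f by (simp add: C01_on_def)
    obtain F where F: "finite F" "\<epsilon> powr r < (\<Sum>i\<in>F. \<bar>if m \<le> i then nrm Y (S f i) else 0\<bar> powr r)"
      using f(3) \<epsilon> by (auto simp: lp_le_def not_le)
    have "(\<Sum>i\<in>F. \<bar>if m \<le> i then nrm Y (S f i) else 0\<bar> powr r) = (\<Sum>i\<in>F \<inter> {m..}. nrm Y (S f i) powr r)"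
      using F(1) Y.nrm_nonneg[OF SY[OF fC]] by (intro sum.mono_neutral_cong_right) auto
    with F f show ?thesis by (intro bexI[of _ f] conjI exI[of _ "F \<inter> {m..}"]) auto
  qed
  have stack: "\<exists>f\<in>C01_on U. nrm C01 f \<le> 1 \<and>
      (\<exists>F\<subseteq>{m..}. finite F \<and> real k * \<epsilon> powr r \<le> (\<Sum>i\<in>F. nrm Y (S f i) powr r))"
    if "U \<subseteq> U0" "open_piece U" for U and k m :: nat
    using that
  proof (induction k arbitrary: U m)
    case 0
    have "(0 :: real \<Rightarrow> 'k) \<in> C01_on U" by (auto simp: C01_on_def C01.zero_mem)
    then show ?case
      by (intro bexI[of _ "0 :: real \<Rightarrow> 'k"] conjI exI[of _ "{}"])
         (simp_all only: C01.nrm_zero zero_le_one empty_subsetI finite.emptyI sum.empty of_nat_0 mult_zero_left order_refl)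
  next
    case (Suc k)
    obtain U1 U2 where U: "open_piece U1" "open_piece U2" "U1 \<subseteq> U" "U2 \<subseteq> U" "U1 \<inter> U2 = {}"
      using open_piece_split[OF Suc.prems(2)] by blast
    obtain f1 F1 where 1: "f1 \<in> C01_on U1" "nrm C01 f1 \<le> 1" "F1 \<subseteq> {m..}" "finite F1"
      "\<epsilon> powr r < (\<Sum>i\<in>F1. nrm Y (S f1 i) powr r)"
      using large[OF order_trans[OF U(3) Suc.prems(1)] U(1), of m] by blast
    obtain m2 where m2: "m \<le> m2" "\<And>i. i \<in> F1 \<Longrightarrow> i < m2"
      using 1(4) by (meson finite_nat_set_iff_bounded le_cases less_le_trans)
    obtain f2 F2 where 2: "f2 \<in> C01_on U2" "nrm C01 f2 \<le> 1" "F2 \<subseteq> {m2..}" "finite F2"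
      "real k * \<epsilon> powr r \<le> (\<Sum>i\<in>F2. nrm Y (S f2 i) powr r)"
      using Suc.IH[OF order_trans[OF U(4) Suc.prems(1)] U(2), of m2] by blast
    have C: "f1 \<in> elems C01" "f2 \<in> elems C01" using 1 2 by (auto simp: C01_on_def)
    define g where "g c = smul C01 c f1 + f2" for c :: 'k
    have g: "g c \<in> C01_on U" "nrm C01 (g c) \<le> 1" if "norm c = 1" for c
    proof -
      have "f1 t = 0 \<or> f2 t = 0" for t using 1(1) 2(1) U(5) by (auto simp: C01_on_def)
      then show "g c \<in> C01_on U" "nrm C01 (g c) \<le> 1"
        using C01_disjoint_combination(2)[OF C(1) 1(2) C(2) 2(2), of c] that
          C01_on_combination[OF 1(1) 2(1) U(3,4)] unfolding g_def by auto
    qed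
    have Sg: "S (g 1) i = S f1 i + S f2 i" "S (g (-1)) i = S f2 i - S f1 i" for i
    proof -
      have "S (g c) = smul ?X c (S f1) + S f2" for c
        unfolding g_def
        by (simp only: bounded_op_add[OF S C01.smul_mem[OF C(1)] C(2)] bounded_op_smul[OF S C(1)])
      then show "S (g 1) i = S f1 i + S f2 i" "S (g (-1)) i = S f2 i - S f1 i"
        using SY[OF C(1)] by (auto simp: Y.smul_one Y.smul_minus_one)
    qed
    have gC: "g 1 \<in> elems C01" "g (-1) \<in> elems C01" using g[of 1] g[of "-1"] by (auto simp: C01_on_def)
    define u v where "u i = nrm Y (S (g 1) i)" and "v i = nrm Y (S (g (-1)) i)" for i
    have uv: "0 \<le> u i" "0 \<le> v i" for i
      unfolding u_def v_def using Y.nrm_nonneg SY gC by auto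
    \<comment> \<open>\<open>S f2\<close> and \<open>S f1\<close> are half the sum and half the difference of the images of \<open>f1 + f2\<close> and
      \<open>f2 - f1\<close>, so each is controlled by the average over the two signs.\<close>
    have avg: "w powr r \<le> (u i powr r + v i powr r) / 2" if "0 \<le> w" "2 * w \<le> u i + v i" for w i
    proof -
      have "w powr r \<le> (1/2 * u i + 1/2 * v i) powr r"
        using that r by (intro powr_mono2) auto
      also have "\<dots> \<le> 1/2 * u i powr r + 1/2 * v i powr r"
        using r uv by (intro powr_convex_ge0) auto
      finally show ?thesis by simp
    qed
    have half: "nrm Y (S f1 i) powr r \<le> (u i powr r + v i powr r) / 2"
      "nrm Y (S f2 i) powr r \<le> (u i powr r + v i powr r) / 2" for i
    proof -
      show "nrm Y (S f1 i) powr r \<le> (u i powr r + v i powr r) / 2"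
      proof (rule avg)
        have "S f1 i + S f1 i = S (g 1) i - S (g (-1)) i" by (simp add: Sg)
        then show "2 * nrm Y (S f1 i) \<le> u i + v i"
          using Y.nrm_double[OF SY[OF C(1)], of i] Y.nrm_diff_le[OF SY[OF gC(1)] SY[OF gC(2)], of i i] by (simp add: u_def v_def)
      qed (use Y.nrm_nonneg SY C in auto)
      show "nrm Y (S f2 i) powr r \<le> (u i powr r + v i powr r) / 2"
      proof (rule avg)
        have "S f2 i + S f2 i = S (g 1) i + S (g (-1)) i" by (simp add: Sg)
        then show "2 * nrm Y (S f2 i) \<le> u i + v i"
          using Y.nrm_double[OF SY[OF C(2)], of i] Y.nrm_triangle[OF SY[OF gC(1)] SY[OF gC(2)], of i i] by (simp add: u_def v_def)
      qed (use Y.nrm_nonneg SY C in auto)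
    qed
    define F where "F = F1 \<union> F2"
    have F: "F \<subseteq> {m..}" "finite F" "F1 \<inter> F2 = {}"
      using 1 2 m2 by (fastforce simp: F_def)+
    have "real (Suc k) * \<epsilon> powr r \<le> (\<Sum>i\<in>F1. nrm Y (S f1 i) powr r) + (\<Sum>i\<in>F2. nrm Y (S f2 i) powr r)"
      using 1(5) 2(5) by (simp add: algebra_simps)
    also have "\<dots> \<le> (\<Sum>i\<in>F1. (u i powr r + v i powr r) / 2) + (\<Sum>i\<in>F2. (u i powr r + v i powr r) / 2)"
      by (intro add_mono sum_mono half)
    also have "\<dots> = (\<Sum>i\<in>F. (u i powr r + v i powr r) / 2)"
      unfolding F_def using 1(4) 2(4) F(3) by (intro sum.union_disjoint[symmetric])
    also have "\<dots> = ((\<Sum>i\<in>F. u i powr r) + (\<Sum>i\<in>F. v i powr r)) / 2"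
      by (simp add: sum.distrib sum_divide_distrib[symmetric])
    finally have "real (Suc k) * \<epsilon> powr r \<le> (\<Sum>i\<in>F. u i powr r) \<or>
        real (Suc k) * \<epsilon> powr r \<le> (\<Sum>i\<in>F. v i powr r)"
      by argo
    then show ?case
      using g[of 1] g[of "-1"] F unfolding u_def v_def by fastforce
  qed
  obtain M where M: "0 < M" "\<And>f. f \<in> elems C01 \<Longrightarrow> nrm ?X (S f) \<le> M * nrm C01 f"
    using C01.bounded_opE[OF S] by blast
  obtain k :: nat where k: "M powr r / \<epsilon> powr r < real k" using reals_Archimedean2 by blast
  obtain f F where f: "f \<in> C01_on U0" "nrm C01 f \<le> 1" "finite F"
    "real k * \<epsilon> powr r \<le> (\<Sum>i\<in>F. nrm Y (S f i) powr r)"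
    using stack[OF order_refl U0, of 0 k] by blast
  have fC: "f \<in> elems C01" using f by (simp add: C01_on_def)
  have "nrm ?X (S f) \<le> M" using M(2)[OF fC] mult_left_mono[OF f(2), of M] M(1) by linarith
  with lp_space_memD(2)[OF p bounded_op_mem[OF S fC]]
  have "lp_le (ereal r) (\<lambda>i. nrm Y (S f i)) M" by (rule lp_le_mono[OF p])
  then have "(\<Sum>i\<in>F. nrm Y (S f i) powr r) \<le> M powr r"
    using f(3) Y.nrm_nonneg[OF SY[OF fC]] by (simp add: lp_le_def)
  with f(4) k \<epsilon> show False by (simp add: field_simps)
qed

text \<open>For \<open>p = \<infinity>\<close> the target pieces have to shrink as well: if infinitely many coordinates are
  small after shrinking, these coordinates are kept; otherwise all but finitely many coordinates
  are large on all smaller pieces, for any piece of the domain, and one such coordinate already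
  contradicts the boundedness.\<close>

lemma column_small_sup:
  fixes S :: "nat \<Rightarrow> (real \<Rightarrow> 'k::real_normed_field) \<Rightarrow> real \<Rightarrow> 'k"
  assumes S: "\<And>i. bounded_op C01 C01 (S i)"
    and M: "\<And>i f. f \<in> elems C01 \<Longrightarrow> nrm C01 (S i f) \<le> M * nrm C01 f"
    and \<epsilon>: "0 < \<epsilon>" and N0: "infinite (N0 :: nat set)" and I0: "\<forall>i\<in>N0. open_piece (I0 i)"
    and U0: "open_piece U0"
  shows "\<exists>U\<subseteq>U0. open_piece U \<and> (\<exists>N\<subseteq>N0. infinite N \<and> (\<forall>i\<in>N. \<exists>I\<subseteq>I0 i. open_piece I \<and>
    (\<forall>t\<in>I. \<forall>f\<in>C01_on U. nrm C01 f \<le> 1 \<longrightarrow> norm (S i f t) \<le> \<epsilon>)))"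
proof (rule ccontr)
  assume neg: "\<not> ?thesis"
  have large: "\<exists>m. \<forall>i\<in>N0. m \<le> i \<longrightarrow> (\<forall>I\<subseteq>I0 i. open_piece I \<longrightarrow>
      (\<exists>t\<in>I. \<exists>f\<in>C01_on U. nrm C01 f \<le> 1 \<and> \<epsilon> < norm (S i f t)))"
    if "U \<subseteq> U0" "open_piece U" for U
  proof -
    define N where "N = {i \<in> N0. \<exists>I\<subseteq>I0 i. open_piece I \<and>
      (\<forall>t\<in>I. \<forall>f\<in>C01_on U. nrm C01 f \<le> 1 \<longrightarrow> norm (S i f t) \<le> \<epsilon>)}"
    have "finite N"
    proof (rule ccontr)
      assume "infinite N"
      then have "\<exists>N\<subseteq>N0. infinite N \<and> (\<forall>i\<in>N. \<exists>I\<subseteq>I0 i. open_piece I \<and>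
        (\<forall>t\<in>I. \<forall>f\<in>C01_on U. nrm C01 f \<le> 1 \<longrightarrow> norm (S i f t) \<le> \<epsilon>))"
        by (intro exI[of _ N]) (auto simp: N_def)
      with neg that show False by blast
    qed
    then obtain m where m: "\<And>i. i \<in> N \<Longrightarrow> i < m" by (meson finite_nat_set_iff_bounded)
    have "i \<notin> N" if "m \<le> i" for i using m[of i] that by auto
    then show ?thesis unfolding N_def by (intro exI[of _ m]) (auto simp: not_le)
  qed
  have stack: "\<exists>m. \<forall>i\<in>N0. m \<le> i \<longrightarrow> (\<forall>I\<subseteq>I0 i. open_piece I \<longrightarrow>
      (\<exists>t\<in>I. \<exists>f\<in>C01_on U. nrm C01 f \<le> 1 \<and> real k * \<epsilon> \<le> norm (S i f t)))"
    if "U \<subseteq> U0" "open_piece U" for U and k :: nat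
    using that
  proof (induction k arbitrary: U)
    case 0
    have "(0 :: real \<Rightarrow> 'k) \<in> C01_on U" by (auto simp: C01_on_def C01.zero_mem)
    then show ?case
      by (auto simp: C01.nrm_zero open_piece_def intro!: bexI[of _ "0 :: real \<Rightarrow> 'k"])
  next
    case (Suc k)
    obtain U1 U2 where U: "open_piece U1" "open_piece U2" "U1 \<subseteq> U" "U2 \<subseteq> U" "U1 \<inter> U2 = {}"
      using open_piece_split[OF Suc.prems(2)] by blast
    obtain m1 where m1: "\<And>i I. \<lbrakk>i \<in> N0; m1 \<le> i; I \<subseteq> I0 i; open_piece I\<rbrakk> \<Longrightarrow>
      \<exists>t\<in>I. \<exists>f\<in>C01_on U1. nrm C01 f \<le> 1 \<and> \<epsilon> < norm (S i f t)"
      using large[OF order_trans[OF U(3) Suc.prems(1)] U(1)] by blast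
    obtain m2 where m2: "\<And>i I. \<lbrakk>i \<in> N0; m2 \<le> i; I \<subseteq> I0 i; open_piece I\<rbrakk> \<Longrightarrow>
      \<exists>t\<in>I. \<exists>f\<in>C01_on U2. nrm C01 f \<le> 1 \<and> real k * \<epsilon> \<le> norm (S i f t)"
      using Suc.IH[OF order_trans[OF U(4) Suc.prems(1)] U(2)] by blast
    show ?case
    proof (intro exI[of _ "max m1 m2"] ballI allI impI)
      fix i I assume i: "i \<in> N0" "max m1 m2 \<le> i" and I: "I \<subseteq> I0 i" "open_piece I"
      obtain t1 f1 where 1: "t1 \<in> I" "f1 \<in> C01_on U1" "nrm C01 f1 \<le> 1" "\<epsilon> < norm (S i f1 t1)"
        using m1[of i I] i I by auto
      define J where "J = {s \<in> I. \<epsilon> < norm (S i f1 s)}"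
      have C1: "f1 \<in> elems C01" using 1 by (simp add: C01_on_def)
      have J: "open_piece J" unfolding J_def
        by (rule open_piece_where_large[OF I(2) bounded_op_mem[OF S C1] 1(1,4)])
      have JI: "J \<subseteq> I" by (auto simp: J_def)
      obtain t f2 where 2: "t \<in> J" "f2 \<in> C01_on U2" "nrm C01 f2 \<le> 1" "real k * \<epsilon> \<le> norm (S i f2 t)"
        using m2[of i J] i I J JI by auto
      have C2: "f2 \<in> elems C01" using 2 by (simp add: C01_on_def)
      obtain c where c: "norm c = 1" "norm (c * S i f1 t + S i f2 t) = norm (S i f1 t) + norm (S i f2 t)"
        by (rule norm_aligned_sum)
      define f where "f = smul C01 c f1 + f2"
      have "f1 t = 0 \<or> f2 t = 0" for t using 1(2) 2(2) U(5) by (auto simp: C01_on_def)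
      then have "f \<in> C01_on U" "nrm C01 f \<le> 1"
        using C01_disjoint_combination(2)[OF C1 1(3) C2 2(3), of c] c(1)
          C01_on_combination[OF 1(2) 2(2) U(3,4)] unfolding f_def by auto
      moreover have "S i f = smul C01 c (S i f1) + S i f2"
        unfolding f_def
        by (simp only: bounded_op_add[OF S C01.smul_mem[OF C1] C2] bounded_op_smul[OF S C1])
      then have "norm (S i f t) = norm (S i f1 t) + norm (S i f2 t)" using c by simp
      then have "real (Suc k) * \<epsilon> \<le> norm (S i f t)"
        using 2(1,4) by (auto simp: J_def algebra_simps)
      ultimately show "\<exists>t\<in>I. \<exists>f\<in>C01_on U. nrm C01 f \<le> 1 \<and> real (Suc k) * \<epsilon> \<le> norm (S i f t)"
        using 2(1) JI by blast
    qed
  qed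
  obtain k :: nat where k: "\<bar>M\<bar> / \<epsilon> < real k" using reals_Archimedean2 by blast
  obtain m where m: "\<And>i I. \<lbrakk>i \<in> N0; m \<le> i; I \<subseteq> I0 i; open_piece I\<rbrakk> \<Longrightarrow>
      \<exists>t\<in>I. \<exists>f\<in>C01_on U0. nrm C01 f \<le> 1 \<and> real k * \<epsilon> \<le> norm (S i f t)"
    using stack[OF order_refl U0, of k] by blast
  obtain i where i: "i \<in> N0" "m \<le> i" using N0 by (meson infinite_nat_iff_unbounded_le)
  obtain t f where f: "f \<in> C01_on U0" "nrm C01 f \<le> 1" "real k * \<epsilon> \<le> norm (S i f t)"
    using m[OF i order_refl bspec[OF I0 i(1)]] by blast
  have fC: "f \<in> elems C01" using f by (simp add: C01_on_def)
  have "norm (S i f t) \<le> M * nrm C01 f"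
    using C01_norm_le[OF bounded_op_mem[OF S fC], of i t] M[OF fC, of i] by linarith
  also have "\<dots> \<le> \<bar>M\<bar> * 1" using f(2) C01.nrm_nonneg[OF fC] by (intro mult_mono) auto
  finally show False using k f(3) \<epsilon> by (simp add: field_simps)
qed

text \<open>Evaluating at points \<open>\<tau> i\<close> of the target pieces, instead of taking norms over them, gives
  the two cases a common form.\<close>

lemma column_small:
  fixes S :: "(real \<Rightarrow> 'k::real_normed_field) \<Rightarrow> nat \<Rightarrow> real \<Rightarrow> 'k"
  assumes p: "1 < p" and S: "bounded_op C01 (lp_space p C01) S"
    and \<epsilon>: "0 < \<epsilon>" and N0: "infinite N0" and I0: "\<forall>i\<in>N0. open_piece (I0 i)"
    and U0: "open_piece U0"
  shows "\<exists>U N I. U \<subseteq> U0 \<and> open_piece U \<and> N \<subseteq> N0 \<and> infinite N \<and>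
    (\<forall>i\<in>N. I i \<subseteq> I0 i \<and> open_piece (I i)) \<and>
    (\<forall>f\<in>C01_on U. nrm C01 f \<le> 1 \<longrightarrow> (\<forall>\<tau>. (\<forall>i\<in>N. \<tau> i \<in> I i) \<longrightarrow>
      lp_le p (\<lambda>i. if i \<in> N then norm (S f i (\<tau> i)) else 0) \<epsilon>))"
  using p
proof (cases rule: exponent_cases)
  case 1
  obtain M where M: "0 < M" "\<And>f. f \<in> elems C01 \<Longrightarrow> nrm (lp_space p C01) (S f) \<le> M * nrm C01 f"
    using C01.bounded_opE[OF S] by blast
  have mem: "S f \<in> elems (lp_space p C01)" if "f \<in> elems C01" for f using S that by (rule bounded_op_mem)
  have bd: "nrm C01 (S f i) \<le> M * nrm C01 f" if "f \<in> elems C01" for f i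
    using lp_le_coord[OF p lp_space_memD(2)[OF p mem[OF that]], of i] M(2)[OF that] by linarith
  have Si: "bounded_op C01 C01 (\<lambda>f. S f i)" for i
    by (rule bounded_opI[OF _ _ _ bd])
       (use S lp_space_memD(1)[OF p mem] in \<open>auto simp: bounded_op_add bounded_op_smul[OF S, simplified]\<close>)
  define Q where "Q U i I \<longleftrightarrow> (\<forall>t\<in>I. \<forall>f\<in>C01_on U. nrm C01 f \<le> 1 \<longrightarrow> norm (S f i t) \<le> \<epsilon>)" for U i I
  have "\<exists>U\<subseteq>U0. open_piece U \<and> (\<exists>N\<subseteq>N0. infinite N \<and>
      (\<forall>i\<in>N. \<exists>I\<subseteq>I0 i. open_piece I \<and> Q U i I))"
    unfolding Q_def by (rule column_small_sup[of "\<lambda>i f. S f i", OF Si bd \<epsilon> N0 I0 U0])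
  then obtain U N where U: "U \<subseteq> U0" "open_piece U" and N: "N \<subseteq> N0" "infinite N"
    and "\<forall>i\<in>N. \<exists>I\<subseteq>I0 i. open_piece I \<and> Q U i I"
    by blast
  then obtain I where I: "\<And>i. i \<in> N \<Longrightarrow> I i \<subseteq> I0 i \<and> open_piece (I i) \<and> Q U i (I i)"
    by metis
  show ?thesis
    using U N I \<epsilon> 1 by (intro exI[of _ U] exI[of _ N] exI[of _ I]) (auto simp: lp_le_def Q_def)
next
  case (2 r)
  obtain U m where U: "U \<subseteq> U0" "open_piece U" and
    le: "\<And>f. f \<in> C01_on U \<Longrightarrow> nrm C01 f \<le> 1 \<Longrightarrow> lp_le p (\<lambda>i. if m \<le> i then nrm C01 (S f i) else 0) \<epsilon>"
    using column_small_on_tail[OF 2(2) normed_nspace_C01 _ \<epsilon> U0, of S] S unfolding 2(1) by blast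
  define N where "N = {i \<in> N0. m \<le> i}"
  have N: "N \<subseteq> N0" "infinite N"
  proof -
    have "N0 \<subseteq> N \<union> {..<m}" by (auto simp: N_def)
    then show "infinite N" using N0 finite_subset by blast
  qed (auto simp: N_def)
  have "lp_le p (\<lambda>i. if i \<in> N then norm (S f i (\<tau> i)) else 0) \<epsilon>"
    if f: "f \<in> C01_on U" "nrm C01 f \<le> 1" for f \<tau>
  proof (rule lp_le_dominated[OF p le[OF f]])
    fix i
    have "f \<in> elems C01" using f by (simp add: C01_on_def)
    then have "S f i \<in> elems C01" by (rule lp_space_memD(1)[OF p bounded_op_mem[OF S]])
    then show "\<bar>if i \<in> N then norm (S f i (\<tau> i)) else 0\<bar> \<le> \<bar>if m \<le> i then nrm C01 (S f i) else 0\<bar>"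
      using C01_norm_le[of "S f i" "\<tau> i"] by (auto simp: N_def intro: order_trans)
  qed
  then show ?thesis using U N I0 by (intro exI[of _ U] exI[of _ N] exI[of _ I0]) auto
qed

section \<open>Passing to a nearly diagonal compression\<close>

definition single :: "nat \<Rightarrow> 'a::zero \<Rightarrow> nat \<Rightarrow> 'a" where
  "single j y = (\<lambda>i. if i = j then y else 0)"

lemma bounded_op_single:
  assumes p: "1 < p" and Y: "normed_nspace Y"
  shows "bounded_op Y (lp_space p Y) (single j)"
    and "y \<in> elems Y \<Longrightarrow> nrm (lp_space p Y) (single j y) \<le> nrm Y y"
proof -
  interpret Y: normed_nspace Y by fact
  have mem: "single j y \<in> elems (lp_space p Y)" "nrm (lp_space p Y) (single j y) \<le> nrm Y y"
    if y: "y \<in> elems Y" for y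
  proof -
    have eq: "(\<lambda>n. nrm Y (single j y n)) = (\<lambda>n. if n = j then nrm Y y else 0)"
      by (auto simp: single_def Y.nrm_zero)
    have "lp_le p (\<lambda>n. nrm Y (single j y n)) (nrm Y y)"
      unfolding eq using lp_le_single[OF p, of j "nrm Y y"] Y.nrm_nonneg[OF y] by simp
    then show "single j y \<in> elems (lp_space p Y)" "nrm (lp_space p Y) (single j y) \<le> nrm Y y"
      using lp_space_memI[OF p, of "single j y" Y] y Y.zero_mem by (auto simp: single_def)
  qed
  show "y \<in> elems Y \<Longrightarrow> nrm (lp_space p Y) (single j y) \<le> nrm Y y" by (rule mem)
  show "bounded_op Y (lp_space p Y) (single j)"
    by (rule bounded_opI[where B = 1]) (use mem in \<open>auto simp: single_def fun_eq_iff Y.smul_zero\<close>)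
qed

lemma bounded_op_coordinate:
  assumes p: "1 < p" and Y: "normed_nspace Y"
  shows "bounded_op (lp_space p Y) Y (\<lambda>x. x i)"
proof (rule bounded_opI[where B = 1])
  fix x assume x: "x \<in> elems (lp_space p Y)"
  show "x i \<in> elems Y" using lp_space_memD(1)[OF p x] .
  show "nrm Y (x i) \<le> 1 * nrm (lp_space p Y) x"
    using lp_le_coord[OF p lp_space_memD(2)[OF p x], of i] by simp
qed auto

lemma bounded_op_sum:
  assumes "normed_nspace X" "bounded_op X Y T" "\<And>l. l \<in> F \<Longrightarrow> z l \<in> elems X" "finite F"
  shows "T (\<Sum>l\<in>F. z l) = (\<Sum>l\<in>F. T (z l))"
  using assms(4,3)
proof (induction F rule: finite_induct)
  case empty
  show ?case
    using bounded_op_diff[OF assms(1,2), of 0 0] normed_nspace.zero_mem[OF assms(1)] by simp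
next
  case (insert l F)
  then show ?case
    using bounded_op_add[OF assms(2), of "z l" "sum z F"] normed_nspace.sum_mem[OF assms(1), of F z]
    by simp
qed

text \<open>One round: fix a coordinate \<open>j\<close>, make its row small by thinning out the remaining coordinates
  and its column small by thinning them out again and shrinking all pieces. Later rounds only
  shrink further and thus preserve both estimates.\<close>

lemma fusion_step:
  fixes T :: "(nat \<Rightarrow> real \<Rightarrow> 'k::real_normed_field) \<Rightarrow> nat \<Rightarrow> real \<Rightarrow> 'k"
  assumes p: "1 < p" and T: "bounded_op (lp_space p C01) (lp_space p C01) T"
    and \<epsilon>: "0 < \<epsilon>" and N: "infinite N" and I: "\<forall>i\<in>N. open_piece (I i)"
  shows "\<exists>j\<in>N. \<exists>K N' I'. K \<subseteq> I j \<and> open_piece K \<and> N' \<subseteq> N \<and> infinite N' \<and>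
    (\<forall>i\<in>N'. j < i \<and> I' i \<subseteq> I i \<and> open_piece (I' i)) \<and>
    (\<forall>t\<in>K. \<forall>x\<in>elems (lp_space p C01). nrm (lp_space p C01) x \<le> 1 \<longrightarrow>
      (\<forall>n. n \<notin> N' \<longrightarrow> x n = 0) \<longrightarrow> norm (T x j t) \<le> \<epsilon>) \<and>
    (\<forall>f\<in>C01_on K. nrm C01 f \<le> 1 \<longrightarrow> (\<forall>\<tau>. (\<forall>i\<in>N'. \<tau> i \<in> I' i) \<longrightarrow>
      lp_le p (\<lambda>i. if i \<in> N' then norm (T (single j f) i (\<tau> i)) else 0) \<epsilon>))"
proof -
  let ?X = "lp_space p (C01 :: ('k, real \<Rightarrow> 'k) nspace)"
  have nX: "normed_nspace ?X" using p normed_nspace_C01 by (rule normed_nspace_lp_space)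
  obtain j where j: "j \<in> N" using infinite_imp_nonempty[OF N] by blast
  define N1 where "N1 = N - {..j}"
  have N1: "infinite N1" unfolding N1_def using N by (intro Diff_infinite_finite) auto
  have R: "bounded_op ?X C01 (\<lambda>x. T x j)"
    using bounded_op_comp[OF nX nX T bounded_op_coordinate[OF p normed_nspace_C01]] .
  obtain N2 J where N2: "N2 \<subseteq> N1" "infinite N2" and J: "J \<subseteq> I j" "open_piece J" and
    row: "\<forall>t\<in>J. \<forall>x\<in>elems ?X. nrm ?X x \<le> 1 \<longrightarrow> (\<forall>n. n \<notin> N2 \<longrightarrow> x n = 0) \<longrightarrow> norm (T x j t) \<le> \<epsilon>"
    using row_small_on_infinite_set[OF p normed_nspace_C01 R \<epsilon> N1 bspec[OF I j]] by (elim exE conjE)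
  have S: "bounded_op C01 ?X (\<lambda>f. T (single j f))"
    using bounded_op_comp[OF normed_nspace_C01 nX bounded_op_single(1)[OF p normed_nspace_C01] T] .
  have I2: "\<forall>i\<in>N2. open_piece (I i)" using N2 I by (auto simp: N1_def)
  obtain K N' I' where K: "K \<subseteq> J" "open_piece K" and N': "N' \<subseteq> N2" "infinite N'"
    and I': "\<forall>i\<in>N'. I' i \<subseteq> I i \<and> open_piece (I' i)"
    and col: "\<forall>f\<in>C01_on K. nrm C01 f \<le> 1 \<longrightarrow> (\<forall>\<tau>. (\<forall>i\<in>N'. \<tau> i \<in> I' i) \<longrightarrow>
      lp_le p (\<lambda>i. if i \<in> N' then norm (T (single j f) i (\<tau> i)) else 0) \<epsilon>)"
    using column_small[of p _ \<epsilon> N2 I J, OF p S \<epsilon> N2(2) I2 J(2)] by (elim exE conjE)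
  have "\<forall>i\<in>N'. j < i \<and> I' i \<subseteq> I i \<and> open_piece (I' i)"
    using N' N2 I' by (auto simp: N1_def)
  moreover have "\<forall>t\<in>K. \<forall>x\<in>elems ?X. nrm ?X x \<le> 1 \<longrightarrow> (\<forall>n. n \<notin> N' \<longrightarrow> x n = 0) \<longrightarrow> norm (T x j t) \<le> \<epsilon>"
    using row K(1) N'(1) by (meson subsetD)
  moreover have "K \<subseteq> I j" "N' \<subseteq> N" using K J N' N2 by (auto simp: N1_def)
  ultimately show ?thesis using j K(2) N'(2) col by blast
qed

text \<open>All rounds together. The remaining coordinates and pieces change in each round, so the choice is
  a dependent one, whose states are an infinite set of coordinates with a piece for each of
  them.\<close>

lemma fusion:
  fixes T :: "(nat \<Rightarrow> real \<Rightarrow> 'k::real_normed_field) \<Rightarrow> nat \<Rightarrow> real \<Rightarrow> 'k"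
  assumes p: "1 < p" and T: "bounded_op (lp_space p C01) (lp_space p C01) T"
    and \<epsilon>: "\<And>n. 0 < \<epsilon> n" and N0: "infinite N0" and I0: "\<forall>i\<in>N0. open_piece (I0 i)"
  obtains \<sigma> K where "strict_mono \<sigma>" "\<And>k. \<sigma> k \<in> N0" "\<And>k. K k \<subseteq> I0 (\<sigma> k)" "\<And>k. open_piece (K k)"
    "\<And>k t x. \<lbrakk>t \<in> K k; x \<in> elems (lp_space p C01); nrm (lp_space p C01) x \<le> 1;
      \<And>n. n \<notin> \<sigma> ` {k<..} \<Longrightarrow> x n = 0\<rbrakk> \<Longrightarrow> norm (T x (\<sigma> k) t) \<le> \<epsilon> k"
    "\<And>k f t. \<lbrakk>f \<in> C01_on (K k); nrm C01 f \<le> 1; \<And>l. k < l \<Longrightarrow> t l \<in> K l\<rbrakk> \<Longrightarrow>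
      lp_le p (\<lambda>l. if k < l then norm (T (single (\<sigma> k) f) (\<sigma> l) (t l)) else 0) (\<epsilon> k)"
proof -
  define row where "row e j K N \<longleftrightarrow> (\<forall>t\<in>K. \<forall>x\<in>elems (lp_space p (C01 :: ('k, real \<Rightarrow> 'k) nspace)). nrm (lp_space p C01) x \<le> 1 \<longrightarrow>
      (\<forall>n. n \<notin> N \<longrightarrow> x n = 0) \<longrightarrow> norm (T x j t) \<le> e)" for e j K N
  define col where "col e j K N I \<longleftrightarrow> (\<forall>f\<in>C01_on K. nrm C01 f \<le> 1 \<longrightarrow> (\<forall>\<tau>. (\<forall>i\<in>N. \<tau> i \<in> I i) \<longrightarrow>
      lp_le p (\<lambda>i. if i \<in> N then norm (T (single j f) i (\<tau> i)) else 0) e))" for e j K N I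
  define good where "good s \<longleftrightarrow> infinite (fst s) \<and> fst s \<subseteq> N0 \<and>
    (\<forall>i\<in>fst s. snd s i \<subseteq> I0 i \<and> open_piece (snd s i))" for s
  define link where "link e s s' j K \<longleftrightarrow> j \<in> fst s \<and> K \<subseteq> snd s j \<and> open_piece K \<and> fst s' \<subseteq> fst s \<and>
    (\<forall>i\<in>fst s'. j < i \<and> snd s' i \<subseteq> snd s i) \<and> row e j K (fst s') \<and> col e j K (fst s') (snd s')"
    for e s s' j K
  have "\<exists>f. \<forall>n. good (f n) \<and> (\<exists>j K. link (\<epsilon> n) (f n) (f (Suc n)) j K)"
  proof (rule dependent_nat_choice)
    show "\<exists>s. good s" using N0 I0 by (intro exI[of _ "(N0, I0)"]) (auto simp: good_def)
  next
    fix s n assume s: "good s"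
    have inf: "infinite (fst s)" and piece: "\<forall>i\<in>fst s. open_piece (snd s i)"
      using s by (auto simp: good_def)
    obtain j K N' I' where j: "j \<in> fst s" "K \<subseteq> snd s j" "open_piece K" "N' \<subseteq> fst s" "infinite N'"
      "\<forall>i\<in>N'. j < i \<and> I' i \<subseteq> snd s i \<and> open_piece (I' i)" "row (\<epsilon> n) j K N'" "col (\<epsilon> n) j K N' I'"
      using fusion_step[OF p T \<epsilon>[of n] inf, of "snd s", OF piece, folded row_def col_def] by blast
    have "N' \<subseteq> N0" "\<forall>i\<in>N'. I' i \<subseteq> I0 i \<and> open_piece (I' i)"
      using s j(4,6) unfolding good_def by blast+
    then have "good (N', I')" using j(5) by (simp add: good_def)
    moreover have "link (\<epsilon> n) s (N', I') j K" using j by (simp add: link_def)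
    ultimately show "\<exists>s'. good s' \<and> (\<exists>j K. link (\<epsilon> n) s s' j K)" by blast
  qed
  then obtain f where good: "\<And>n. good (f n)" and "\<And>n. \<exists>j K. link (\<epsilon> n) (f n) (f (Suc n)) j K" by blast
  then obtain \<sigma> K where link: "\<And>n. link (\<epsilon> n) (f n) (f (Suc n)) (\<sigma> n) (K n)" by metis
  have mono: "fst (f l) \<subseteq> fst (f k) \<and> (\<forall>i\<in>fst (f l). snd (f l) i \<subseteq> snd (f k) i)" if "k \<le> l" for k l
    using that
  proof (induction l rule: dec_induct)
    case (step l)
    have "fst (f (Suc l)) \<subseteq> fst (f l)" "\<And>i. i \<in> fst (f (Suc l)) \<Longrightarrow> snd (f (Suc l)) i \<subseteq> snd (f l) i"
      using link[of l] unfolding link_def by blast+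
    with step.IH show ?case by (meson order_trans subsetD)
  qed simp
  have later: "\<sigma> l \<in> fst (f (Suc k))" "K l \<subseteq> snd (f (Suc k)) (\<sigma> l)" if "k < l" for k l
    using mono[of "Suc k" l] that link[of l] by (auto simp: link_def)
  have less: "\<sigma> k < \<sigma> l" if "k < l" for k l
    using link[of k] later(1)[OF that] by (auto simp: link_def)
  have sm: "strict_mono \<sigma>" using less by (rule strict_monoI)
  then have inj: "inj \<sigma>" by (rule strict_mono_imp_inj_on)
  show thesis
  proof (rule that[OF sm])
    fix k
    show "\<sigma> k \<in> N0" "K k \<subseteq> I0 (\<sigma> k)" "open_piece (K k)"
      using link[of k] good[of k] by (auto simp: link_def good_def)
  next
    fix k t and x :: "nat \<Rightarrow> real \<Rightarrow> 'k"
    assume "t \<in> K k" "x \<in> elems (lp_space p C01)" "nrm (lp_space p C01) x \<le> 1"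
      and supp: "\<And>n. n \<notin> \<sigma> ` {k<..} \<Longrightarrow> x n = 0"
    moreover have "x n = 0" if "n \<notin> fst (f (Suc k))" for n
      using that later(1) by (intro supp) auto
    ultimately show "norm (T x (\<sigma> k) t) \<le> \<epsilon> k"
      using link[of k] by (auto simp: link_def row_def)
  next
    fix k and g :: "real \<Rightarrow> 'k" and t
    assume g: "g \<in> C01_on (K k)" "nrm C01 g \<le> 1" and t: "\<And>l. k < l \<Longrightarrow> t l \<in> K l"
    let ?N = "fst (f (Suc k))" and ?I = "snd (f (Suc k))"
    define \<tau> where "\<tau> i = (if i \<in> \<sigma> ` {k<..} then t (inv \<sigma> i) else SOME s. s \<in> ?I i)" for i
    have \<tau>\<sigma>: "\<tau> (\<sigma> l) = t l" if "k < l" for l using that inj by (auto simp: \<tau>_def)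
    have "\<tau> i \<in> ?I i" if "i \<in> ?N" for i
    proof (cases "i \<in> \<sigma> ` {k<..}")
      case True
      then obtain l where l: "i = \<sigma> l" "k < l" by auto
      then show ?thesis using \<tau>\<sigma>[OF l(2)] t[OF l(2)] later(2)[OF l(2)] by auto
    next
      case False
      have "?I i \<noteq> {}" using good[of "Suc k"] that by (auto simp: good_def open_piece_def)
      then show ?thesis using False by (simp add: \<tau>_def some_in_eq)
    qed
    with g link[of k]
    have "lp_le p (\<lambda>i. if i \<in> ?N then norm (T (single (\<sigma> k) g) i (\<tau> i)) else 0) (\<epsilon> k)"
      by (auto simp: link_def col_def)
    then show "lp_le p (\<lambda>l. if k < l then norm (T (single (\<sigma> k) g) (\<sigma> l) (t l)) else 0) (\<epsilon> k)"
      by (rule lp_le_reindex[OF p, where h = \<sigma> and S = "{k<..}"])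
         (use inj \<tau>\<sigma> later(1) in \<open>auto intro: inj_on_subset\<close>)
  qed
qed

section \<open>Factoring the identity\<close>

text \<open>A copy of the space of continuous functions inside the functions supported in a piece: squeeze
  the unit interval into the piece, extend constantly and multiply by a bump.\<close>

lemma transplant:
  assumes K: "open_piece K"
  obtains E :: "(real \<Rightarrow> 'k::real_normed_field) \<Rightarrow> real \<Rightarrow> 'k" and \<kappa> :: "real \<Rightarrow> real"
  where "bounded_op C01 C01 E" "\<And>g. g \<in> elems C01 \<Longrightarrow> E g \<in> C01_on K"
    "\<And>g. g \<in> elems C01 \<Longrightarrow> nrm C01 (E g) \<le> nrm C01 g"
    "continuous_on {0..1} \<kappa>" "\<And>s. s \<in> {0..1} \<Longrightarrow> \<kappa> s \<in> K"
    "\<And>g s. s \<in> {0..1} \<Longrightarrow> E g (\<kappa> s) = g s"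
proof -
  obtain t where t: "t \<in> K" using K by (auto simp: open_piece_def)
  obtain d and h :: "real \<Rightarrow> 'k" where h: "0 < d" "ball t d \<subseteq> K" "h \<in> C01_on K" "nrm C01 h \<le> 1"
    "\<And>s. s \<in> ball t d \<Longrightarrow> h s = 1"
    using bump_exists[OF K t] by metis
  have hC: "h \<in> elems C01" using h by (simp add: C01_on_def)
  define \<kappa> where "\<kappa> s = t - d / 2 + d * s" for s
  define \<rho> where "\<rho> s = max 0 (min 1 ((s - (t - d / 2)) / d))" for s
  define E where "E g s = h s * g (\<rho> s)" for g :: "real \<Rightarrow> 'k" and s
  have \<rho>: "\<rho> s \<in> {0..1}" for s by (auto simp: \<rho>_def)
  have \<rho>c: "continuous_on A \<rho>" for A
    unfolding \<rho>_def using h(1) by (intro continuous_intros) auto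
  have \<kappa>: "\<kappa> s \<in> ball t d" if "s \<in> {0..1}" for s
  proof -
    have "d * s \<le> d" "0 \<le> d * s" using that h(1) mult_left_mono[of s 1 d] by auto
    then have "\<bar>t - \<kappa> s\<bar> < d" using h(1) unfolding \<kappa>_def by arith
    then show ?thesis by (simp add: dist_real_def)
  qed
  have mem: "E g \<in> C01_on K" if "g \<in> elems C01" for g
  proof -
    have "continuous_on {0..1} (\<lambda>s. g (\<rho> s))"
      using that \<rho> by (intro continuous_on_compose2[OF _ \<rho>c]) (auto simp: C01_mem_iff)
    then have "continuous_on {0..1} (E g)"
      unfolding E_def using hC by (intro continuous_on_mult) (auto simp: C01_mem_iff)
    then show ?thesis using h(3) by (auto simp: C01_on_def C01_mem_iff E_def)
  qed
  have nE: "nrm C01 (E g) \<le> nrm C01 g" if g: "g \<in> elems C01" for g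
  proof (rule C01_nrm_leI)
    show "E g \<in> elems C01" using mem[OF g] by (simp add: C01_on_def)
    fix s
    have "norm (h s) * norm (g (\<rho> s)) \<le> 1 * nrm C01 g"
      using C01_norm_le[OF hC, of s] h(4) C01_norm_le[OF g] by (intro mult_mono) auto
    then show "norm (E g s) \<le> nrm C01 g" by (simp add: E_def norm_mult)
  qed
  show thesis
  proof (rule that[OF _ mem nE])
    show "bounded_op C01 C01 E"
      by (rule bounded_opI[where B = 1])
         (use mem nE in \<open>auto simp: C01_on_def E_def fun_eq_iff algebra_simps\<close>)
    show "continuous_on {0..1} \<kappa>" unfolding \<kappa>_def by (intro continuous_intros)
    fix s :: real assume s: "s \<in> {0..1}"
    show "\<kappa> s \<in> K" using \<kappa>[OF s] h(2) by blast
    have "(\<kappa> s - (t - d / 2)) / d = s" using h(1) by (simp add: \<kappa>_def)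
    then have "\<rho> (\<kappa> s) = s" using s by (simp add: \<rho>_def)
    then show "E g (\<kappa> s) = g s" for g using h(5)[OF \<kappa>[OF s]] by (simp add: E_def)
  qed
qed

lemma bound_from_unit_ball:
  assumes X: "normed_nspace X" and Y: "normed_nspace Y" and D: "bounded_op X Y D"
    and le: "\<And>x. x \<in> elems X \<Longrightarrow> nrm X x \<le> 1 \<Longrightarrow> nrm Y (D x) \<le> B" and x: "x \<in> elems X"
  shows "nrm Y (D x) \<le> B * nrm X x"
proof -
  interpret X: normed_nspace X by fact
  interpret Y: normed_nspace Y by fact
  show ?thesis
  proof (cases "nrm X x = 0")
    case True
    then have "x = 0" using x by (intro X.nrm_zeroD)
    then show ?thesis using bounded_op_diff[OF X D X.zero_mem X.zero_mem] by (simp add: X.nrm_zero Y.nrm_zero)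
  next
    case False
    define r where "r = nrm X x"
    have r: "0 < r" using False X.nrm_nonneg[OF x] by (simp add: r_def)
    define z where "z = smul X (of_real (1/r)) x"
    have z: "z \<in> elems X" unfolding z_def using x by (rule X.smul_mem)
    have "nrm X z \<le> 1"
      unfolding z_def X.nrm_smul[OF x] norm_of_real using r by (simp add: r_def)
    with z have "nrm Y (D z) \<le> B" by (rule le)
    moreover have "nrm Y (D z) = 1/r * nrm Y (D x)"
      unfolding z_def bounded_op_smul[OF D x] Y.nrm_smul[OF bounded_op_mem[OF D x]] norm_of_real
      using r by simp
    ultimately show ?thesis using r by (simp add: field_simps r_def)
  qed
qed

text \<open>The compression of the operator to the chosen pieces and coordinates, divided by its diagonal
  scalars, is a perturbation of the identity: below the diagonal the columns are summable
  in norm, above it the rows are.\<close>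

lemma identity_factors_if_diagonal_large:
  fixes T :: "(nat \<Rightarrow> real \<Rightarrow> 'k::{real_normed_field,banach}) \<Rightarrow> nat \<Rightarrow> real \<Rightarrow> 'k"
  assumes p: "1 < p" and T: "bounded_op (lp_space p C01) (lp_space p C01) T"
    and N0: "infinite N0" and I0: "\<forall>i\<in>N0. open_piece (I0 i)"
    and a: "\<And>i. i \<in> N0 \<Longrightarrow> 1/2 \<le> norm (a i)"
    and diag: "\<And>i t f. \<lbrakk>i \<in> N0; t \<in> I0 i; f \<in> C01_on (I0 i)\<rbrakk> \<Longrightarrow>
      norm (T (single i f) i t - a i * f t) \<le> 1/8 * nrm C01 f"
  shows "factors_through 4 (lp_space p C01) (lp_space p C01) (\<lambda>x. x) (lp_space p C01) (lp_space p C01) T"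
proof -
  let ?C = "C01 :: ('k, real \<Rightarrow> 'k) nspace"
  let ?X = "lp_space p ?C"
  interpret X: banach_nspace ?X using p banach_nspace_C01 by (rule banach_nspace_lp_space)
  note nX = X.normed_nspace_axioms and D = lp_space_memD[OF p] and I = lp_space_memI[OF p]
  \<comment> \<open>Rows and columns contribute \<open>1/16\<close> each and the diagonal \<open>1/8\<close>; dividing by the diagonal scalars at
    most doubles their sum \<open>1/4\<close>.\<close>
  define \<epsilon> :: "nat \<Rightarrow> real" where "\<epsilon> n = 1/32 * (1/2)^n" for n
  have \<epsilon>: "0 < \<epsilon> n" for n by (simp add: \<epsilon>_def)
  have \<epsilon>s: "\<epsilon> sums (1/16)"
    unfolding \<epsilon>_def using sums_mult[OF geometric_sums[of "1/2::real"], of "1/32"] by simp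
  obtain \<sigma> K where \<sigma>: "strict_mono \<sigma>" "\<And>k. \<sigma> k \<in> N0" and K: "\<And>k. K k \<subseteq> I0 (\<sigma> k)" "\<And>k. open_piece (K k)"
    and row: "\<And>k t x. \<lbrakk>t \<in> K k; x \<in> elems ?X; nrm ?X x \<le> 1;
      \<And>n. n \<notin> \<sigma> ` {k<..} \<Longrightarrow> x n = 0\<rbrakk> \<Longrightarrow> norm (T x (\<sigma> k) t) \<le> \<epsilon> k"
    and col: "\<And>k f t. \<lbrakk>f \<in> C01_on (K k); nrm C01 f \<le> 1; \<And>l. k < l \<Longrightarrow> t l \<in> K l\<rbrakk> \<Longrightarrow>
      lp_le p (\<lambda>l. if k < l then norm (T (single (\<sigma> k) f) (\<sigma> l) (t l)) else 0) (\<epsilon> k)"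
    using fusion[of p T \<epsilon> N0 I0, OF p T \<epsilon> N0 I0] by blast
  have inj: "inj \<sigma>" using \<sigma>(1) by (rule strict_mono_imp_inj_on)
  have "\<exists>E \<kappa>. bounded_op ?C ?C E \<and> (\<forall>g\<in>elems ?C. E g \<in> C01_on (K k) \<and> nrm C01 (E g) \<le> nrm C01 g) \<and>
      continuous_on {0..1} \<kappa> \<and> (\<forall>s\<in>{0..1}. \<kappa> s \<in> K k \<and> (\<forall>g. E g (\<kappa> s) = g s))" for k
    by (rule transplant[OF K(2)[of k]]) blast
  then obtain E \<kappa> where E: "\<And>k. bounded_op ?C ?C (E k)" "\<And>k g. g \<in> elems ?C \<Longrightarrow> E k g \<in> C01_on (K k)"
    "\<And>k g. g \<in> elems ?C \<Longrightarrow> nrm C01 (E k g) \<le> nrm C01 g"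
    and \<kappa>: "\<And>k. continuous_on {0..1} (\<kappa> k)" "\<And>k s. s \<in> {0..1} \<Longrightarrow> \<kappa> k s \<in> K k"
    "\<And>k s g. s \<in> {0..1} \<Longrightarrow> E k g (\<kappa> k s) = g s"
    by metis
  have EC: "E k g \<in> elems ?C" if "g \<in> elems ?C" for k g using E(2)[OF that] by (simp add: C01_on_def)
  have \<kappa>01: "\<kappa> k s \<in> {0..1}" if "s \<in> {0..1}" for k s
    using \<kappa>(2)[OF that, of k] K(2)[of k] by (auto simp: open_piece_def)
  define V where "V x i = (if i \<in> range \<sigma> then E (inv \<sigma> i) (x (inv \<sigma> i)) else 0)" for x i
  have V\<sigma>: "V x (\<sigma> k) = E k (x k)" for x k using inj by (simp add: V_def)
  have Vmem: "V x \<in> elems ?X" "nrm ?X (V x) \<le> nrm ?X x" if x: "x \<in> elems ?X" for x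
  proof -
    have mem: "V x i \<in> elems ?C" for i using EC D(1)[OF x] by (simp add: V_def C01.zero_mem)
    have le: "lp_le p (\<lambda>i. nrm C01 (V x i)) (nrm ?X x)"
    proof (rule lp_le_reindex[OF p D(2)[OF x], where h = "inv \<sigma>" and S = "range \<sigma>"])
      show "inj_on (inv \<sigma>) (range \<sigma>)" by (rule inj_on_inv_into) simp
    qed (use inj E(3)[OF D(1)[OF x]] C01.nrm_nonneg[OF D(1)[OF x]] C01.nrm_nonneg[OF EC[OF D(1)[OF x]]]
         in \<open>auto simp: V_def C01.nrm_zero\<close>)
    show "V x \<in> elems ?X" "nrm ?X (V x) \<le> nrm ?X x" using I[OF mem le] .
  qed
  have V: "bounded_op ?X ?X V"
  proof (rule bounded_opI[where B = 1])
    fix x y assume xy: "x \<in> elems ?X" "y \<in> elems ?X"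
    show "V (x + y) = V x + V y"
      using bounded_op_add[OF E(1) D(1)[OF xy(1)] D(1)[OF xy(2)]] by (auto simp: V_def fun_eq_iff)
  next
    fix c x assume x: "x \<in> elems ?X"
    show "V (smul ?X c x) = smul ?X c (V x)"
      using bounded_op_smul[OF E(1) D(1)[OF x], simplified] by (auto simp: V_def fun_eq_iff)
  qed (use Vmem in auto)
  define U where "U y k s = (if s \<in> {0..1} then inverse (a (\<sigma> k)) * y (\<sigma> k) (\<kappa> k s) else 0)"
    for y :: "nat \<Rightarrow> real \<Rightarrow> 'k" and k s
  have inva: "norm (inverse (a (\<sigma> k))) \<le> 2" "a (\<sigma> k) \<noteq> 0" for k
  proof -
    have "1/2 \<le> norm (a (\<sigma> k))" using a[OF \<sigma>(2)] .
    then show "norm (inverse (a (\<sigma> k))) \<le> 2" "a (\<sigma> k) \<noteq> 0"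
      using le_imp_inverse_le[of "1/2" "norm (a (\<sigma> k))"] by (auto simp: norm_inverse)
  qed
  have Umem: "U y \<in> elems ?X" "nrm ?X (U y) \<le> 2 * nrm ?X y" if y: "y \<in> elems ?X" for y
  proof -
    have mem: "U y k \<in> elems ?C" for k
    proof -
      have "continuous_on {0..1} (\<lambda>s. y (\<sigma> k) (\<kappa> k s))"
        using D(1)[OF y, of "\<sigma> k"] \<kappa>01 by (intro continuous_on_compose2[OF _ \<kappa>(1)]) (auto simp: C01_mem_iff)
      then have "continuous_on {0..1} (\<lambda>s. inverse (a (\<sigma> k)) * y (\<sigma> k) (\<kappa> k s))"
        by (intro continuous_on_mult continuous_on_const)
      then have "continuous_on {0..1} (U y k)"
        by (rule continuous_on_eq) (simp add: U_def)
      then show ?thesis by (simp add: C01_mem_iff U_def)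
    qed
    have le: "nrm C01 (U y k) \<le> 2 * nrm C01 (y (\<sigma> k))" for k
    proof (rule C01_nrm_leI[OF mem])
      fix s
      have "norm (inverse (a (\<sigma> k))) * norm (y (\<sigma> k) (\<kappa> k s)) \<le> 2 * nrm C01 (y (\<sigma> k))"
        using inva C01_norm_le[OF D(1)[OF y]] by (intro mult_mono) auto
      then show "norm (U y k s) \<le> 2 * nrm C01 (y (\<sigma> k))"
        using C01.nrm_nonneg[OF D(1)[OF y], of "\<sigma> k"] by (auto simp: U_def norm_mult)
    qed
    have "lp_le p (\<lambda>k. nrm C01 (U y k)) (2 * nrm ?X y)"
    proof (rule lp_le_reindex[OF p lp_le_scale[OF p D(2)[OF y], of 2] inj])
      show "\<bar>nrm C01 (U y k)\<bar> \<le> \<bar>2 * nrm C01 (y (\<sigma> k))\<bar>" for k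
        using le[of k] C01.nrm_nonneg[OF mem, of k] by simp
    qed auto
    from I[OF mem this] show "U y \<in> elems ?X" "nrm ?X (U y) \<le> 2 * nrm ?X y" .
  qed
  have U: "bounded_op ?X ?X U"
    by (rule bounded_opI[where B = 2]) (use Umem in \<open>auto simp: U_def fun_eq_iff algebra_simps\<close>)
  define W where "W x = U (T (V x)) - x" for x
  have W: "bounded_op ?X ?X W"
    unfolding W_def
    by (rule bounded_op_minus[OF nX nX _ bounded_op_id])
       (rule bounded_op_comp[OF nX nX bounded_op_comp[OF nX nX V T] U])
  have "nrm ?X (W x) \<le> 1/2" if x: "x \<in> elems ?X" "nrm ?X x \<le> 1" for x
  proof -
    define y where "y = V x"
    have y: "y \<in> elems ?X" "nrm ?X y \<le> 1" unfolding y_def using Vmem[OF x(1)] x(2) by auto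
    have y\<sigma>: "y (\<sigma> k) = E k (x k)" for k unfolding y_def by (rule V\<sigma>)
    have xk: "x k \<in> elems ?C" "nrm C01 (x k) \<le> 1" for k
      using D(1)[OF x(1)] lp_le_coord[OF p D(2)[OF x(1)], of k] x(2) by auto
    have yk: "y (\<sigma> k) \<in> C01_on (K k)" "nrm C01 (y (\<sigma> k)) \<le> 1" for k
      unfolding y\<sigma> using E(2)[OF xk(1)] order_trans[OF E(3)[OF xk(1)] xk(2)] by auto
    have Wx: "W x k \<in> elems ?C" for k using D(1)[OF bounded_op_mem[OF W x(1)]] .
    \<comment> \<open>The points at which the coordinates of the error attain their norms.\<close>
    have "\<exists>s. s \<in> {0..1} \<and> nrm C01 (W x k) = norm (W x k s)" for k
      by (rule C01_nrm_attained[OF Wx]) blast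
    then obtain s where s: "\<And>k. s k \<in> {0..1}" "\<And>k. nrm C01 (W x k) = norm (W x k (s k))" by metis
    define t where "t k = \<kappa> k (s k)" for k
    have t: "t k \<in> K k" for k unfolding t_def using \<kappa>(2)[OF s(1)] .
    define z where "z l = T (single (\<sigma> l) (y (\<sigma> l)))" for l
    have sing: "single (\<sigma> l) (y (\<sigma> l)) \<in> elems ?X" for l
      using bounded_op_mem[OF bounded_op_single(1)[OF p normed_nspace_C01] D(1)[OF y(1)]] .
    define b where "b l k = (if l < k then norm (z l (\<sigma> k) (t k)) else 0)" for l k
    have b: "lp_le p (b l) (\<epsilon> l)" for l
      unfolding b_def z_def using yk t by (intro col)
    have bsum: "(\<Sum>l. \<bar>b l k\<bar>) = (\<Sum>l<k. norm (z l (\<sigma> k) (t k)))" for k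
      by (subst suminf_finite[of "{..<k}"]) (auto simp: b_def)
    have err: "norm (W x k (s k)) \<le> 2 * ((\<Sum>l<k. norm (z l (\<sigma> k) (t k))) + 1/8 * nrm C01 (x k) + \<epsilon> k)" for k
    proof -
      \<comment> \<open>\<open>tl\<close> need not be a series of its coordinates when \<open>p = \<infinity>\<close>; it is treated as one vector.\<close>
      define tl where "tl i = (if i \<in> \<sigma> ` {k<..} then y i else 0)" for i
      have tlmem: "tl \<in> elems ?X" "nrm ?X tl \<le> 1"
      proof -
        have mem: "tl i \<in> elems ?C" for i using D(1)[OF y(1)] by (simp add: tl_def C01.zero_mem)
        have le: "lp_le p (\<lambda>i. nrm C01 (tl i)) 1"
          by (rule lp_le_dominated[OF p lp_le_mono[OF p D(2)[OF y(1)] y(2)]]) (simp add: tl_def C01.nrm_zero)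
        show "tl \<in> elems ?X" "nrm ?X tl \<le> 1" using I[OF mem le] .
      qed
      have "y = (\<Sum>l\<in>{..k}. single (\<sigma> l) (y (\<sigma> l))) + tl"
      proof (rule ext)
        fix i
        show "y i = ((\<Sum>l\<in>{..k}. single (\<sigma> l) (y (\<sigma> l))) + tl) i"
        proof (cases "i \<in> range \<sigma>")
          case True
          then obtain j where j: "i = \<sigma> j" by blast
          have "(\<Sum>l\<in>{..k}. single (\<sigma> l) (y (\<sigma> l)) i) = (\<Sum>l\<in>{..k}. if l = j then y i else 0)"
            using inj by (intro sum.cong) (auto simp: single_def j inj_eq)
          then show ?thesis using inj by (auto simp: sum_fun_apply tl_def j inj_image_mem_iff)
        next
          case False
          then have "single (\<sigma> l) (y (\<sigma> l)) i = 0" for l by (auto simp: single_def)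
          moreover have "y i = 0" using False by (simp add: y_def V_def)
          ultimately show ?thesis by (simp add: sum_fun_apply tl_def)
        qed
      qed
      then have "T y = T ((\<Sum>l\<in>{..k}. single (\<sigma> l) (y (\<sigma> l))) + tl)" by simp
      also have "\<dots> = (\<Sum>l\<in>{..k}. z l) + T tl"
        unfolding z_def using sing tlmem
        by (simp add: bounded_op_add[OF T] X.sum_mem bounded_op_sum[OF nX T])
      also have "\<dots> = (\<Sum>l<k. z l) + z k + T tl"
        by (simp add: lessThan_Suc_atMost[symmetric])
      finally have Ty: "T y (\<sigma> k) (t k) = (\<Sum>l<k. z l (\<sigma> k) (t k)) + z k (\<sigma> k) (t k) + T tl (\<sigma> k) (t k)"
        by (simp add: sum_fun_apply)
      have xs: "x k (s k) = y (\<sigma> k) (t k)" unfolding y\<sigma> t_def using \<kappa>(3)[OF s(1)] by simp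
      have "W x k (s k) = inverse (a (\<sigma> k)) * (T y (\<sigma> k) (t k) - a (\<sigma> k) * y (\<sigma> k) (t k))"
        using s(1)[of k] inva(2)[of k] xs
        by (simp add: W_def U_def y_def[symmetric] t_def[symmetric] right_diff_distrib)
      also have "T y (\<sigma> k) (t k) - a (\<sigma> k) * y (\<sigma> k) (t k) =
          (\<Sum>l<k. z l (\<sigma> k) (t k)) + (z k (\<sigma> k) (t k) - a (\<sigma> k) * y (\<sigma> k) (t k)) + T tl (\<sigma> k) (t k)"
        unfolding Ty by (simp add: algebra_simps)
      finally have eq: "W x k (s k) = inverse (a (\<sigma> k)) * \<dots>" .
      have "norm (z k (\<sigma> k) (t k) - a (\<sigma> k) * y (\<sigma> k) (t k)) \<le> 1/8 * nrm C01 (y (\<sigma> k))"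
        unfolding z_def
      proof (rule diag[OF \<sigma>(2)])
        show "t k \<in> I0 (\<sigma> k)" using t K(1) by blast
        show "y (\<sigma> k) \<in> C01_on (I0 (\<sigma> k))" using yk(1)[of k] K(1)[of k] by (auto simp: C01_on_def)
      qed
      also have "\<dots> \<le> 1/8 * nrm C01 (x k)" unfolding y\<sigma> using E(3)[OF xk(1)] by simp
      finally have 1: "norm (z k (\<sigma> k) (t k) - a (\<sigma> k) * y (\<sigma> k) (t k)) \<le> 1/8 * nrm C01 (x k)" .
      have 2: "norm (T tl (\<sigma> k) (t k)) \<le> \<epsilon> k"
        using t tlmem by (intro row) (auto simp: tl_def)
      have "norm ((\<Sum>l<k. z l (\<sigma> k) (t k)) + (z k (\<sigma> k) (t k) - a (\<sigma> k) * y (\<sigma> k) (t k)) + T tl (\<sigma> k) (t k))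
          \<le> (\<Sum>l<k. norm (z l (\<sigma> k) (t k))) + 1/8 * nrm C01 (x k) + \<epsilon> k"
        by (intro norm_triangle_mono 1 2 norm_sum)
      then show ?thesis
        unfolding eq norm_mult using inva(1)[of k] by (intro mult_mono) auto
    qed
    have \<epsilon>S: "suminf \<epsilon> = 1/16" using sums_unique[OF \<epsilon>s] by simp
    have lower: "lp_le p (\<lambda>k. \<Sum>l. \<bar>b l k\<bar>) (1/16)"
      unfolding \<epsilon>S[symmetric]
      by (rule lp_le_suminf[OF p b sums_summable[OF \<epsilon>s]]) (simp add: bsum sum_nonneg)
    have upper: "lp_le p \<epsilon> (1/16)"
      unfolding \<epsilon>S[symmetric]
      by (rule lp_le_l1[OF p sums_summable[OF \<epsilon>s]]) (simp add: \<epsilon> abs_of_pos)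
    have middle: "lp_le p (\<lambda>k. 1/8 * nrm C01 (x k)) (1/8)"
      using lp_le_mono[OF p lp_le_scale[OF p D(2)[OF x(1)], of "1/8"]] x(2) by simp
    define c where "c k = ((\<Sum>l. \<bar>b l k\<bar>) + 1/8 * nrm C01 (x k)) + \<epsilon> k" for k
    have "lp_le p c ((1/16 + 1/8) + 1/16)"
      unfolding c_def
      by (rule lp_le_add[OF p lp_le_add[OF p lower middle] upper]) (auto intro: order_trans[OF abs_triangle_ineq])
    then have c: "lp_le p (\<lambda>k. 2 * c k) (1/2)" using lp_le_scale[OF p, of c "1/4" 2] by simp
    have "lp_le p (\<lambda>k. nrm C01 (W x k)) (1/2)"
    proof (rule lp_le_dominated[OF p c])
      fix k
      have "nrm C01 (W x k) \<le> 2 * c k" using err[of k] unfolding s(2) c_def bsum by simp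
      then show "\<bar>nrm C01 (W x k)\<bar> \<le> \<bar>2 * c k\<bar>" using C01.nrm_nonneg[OF Wx, of k] by simp
    qed
    with Wx show ?thesis by (rule I(2))
  qed
  from bound_from_unit_ball[OF nX nX W this]
  have "nrm ?X (U (T (V x)) - x) \<le> nrm ?X x / 2" if "x \<in> elems ?X" for x
    using that by (simp add: W_def)
  from X.identity_factors_if_near[OF T V U Vmem(2) Umem(2) this] show ?thesis .
qed

text \<open>The diagonal entries of \<open>T\<close> and of \<open>I - T\<close> are close to scalars adding up to \<open>1\<close>, so
  those of \<open>T\<close> or those of \<open>I - T\<close> have modulus at least \<open>1/2\<close> infinitely often.\<close>

lemma primary_factorisation_lp_C01:
  assumes p: "1 < p"
  shows "primary_factorisation_property 4 (lp_space p (C01 :: ('k::{real_normed_field,banach}, real \<Rightarrow> 'k) nspace))"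
  unfolding primary_factorisation_property_def
proof (intro allI impI)
  let ?C = "C01 :: ('k, real \<Rightarrow> 'k) nspace"
  let ?X = "lp_space p ?C"
  fix T assume T: "bounded_op ?X ?X T"
  have nX: "normed_nspace ?X" using p normed_nspace_C01 by (rule normed_nspace_lp_space)
  define T' where "T' x = x - T x" for x
  have T': "bounded_op ?X ?X T'"
    unfolding T'_def using bounded_op_minus[OF nX nX bounded_op_id T] .
  have unit: "open_piece {0<..<1}" by (auto simp: open_piece_def)
  have "\<exists>J a. open_piece J \<and> (\<forall>t\<in>J. \<forall>f\<in>C01_on J.
      norm (T (single i f) i t - a * f t) \<le> 1/8 * nrm C01 f)" for i
  proof -
    have "bounded_op ?C ?C (\<lambda>f. T (single i f) i)"
      by (rule bounded_op_comp[OF normed_nspace_C01 nX _ bounded_op_coordinate[OF p normed_nspace_C01]])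
         (rule bounded_op_comp[OF normed_nspace_C01 nX bounded_op_single(1)[OF p normed_nspace_C01] T])
    from locally_scalar[OF this _ unit, of "1/8"] show ?thesis by (metis zero_less_divide_1_iff zero_less_numeral)
  qed
  then obtain J a where J: "\<And>i. open_piece (J i)" and
    a: "\<And>i t f. t \<in> J i \<Longrightarrow> f \<in> C01_on (J i) \<Longrightarrow> norm (T (single i f) i t - a i * f t) \<le> 1/8 * nrm C01 f"
    by metis
  have a': "norm (T' (single i f) i t - (1 - a i) * f t) \<le> 1/8 * nrm C01 f" if "t \<in> J i" "f \<in> C01_on (J i)" for i t f
  proof -
    have "T' (single i f) i t - (1 - a i) * f t = - (T (single i f) i t - a i * f t)"
      by (simp add: T'_def single_def algebra_simps)
    then show ?thesis using a[OF that] by (simp only: norm_minus_cancel)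
  qed
  have "{i. 1/2 \<le> norm (a i)} \<union> {i. 1/2 \<le> norm (1 - a i)} = UNIV"
  proof -
    have "1 \<le> norm (a i) + norm (1 - a i)" for i using norm_triangle_ineq[of "a i" "1 - a i"] by simp
    then have "1/2 \<le> norm (a i) \<or> 1/2 \<le> norm (1 - a i)" for i by (smt (verit) field_sum_of_halves)
    then show ?thesis by auto
  qed
  then have "infinite {i. 1/2 \<le> norm (a i)} \<or> infinite {i. 1/2 \<le> norm (1 - a i)}"
    by (metis finite_Un infinite_UNIV_nat)
  then show "factors_through 4 ?X ?X (\<lambda>x. x) ?X ?X T \<or> factors_through 4 ?X ?X (\<lambda>x. x) ?X ?X (\<lambda>x. x - T x)"
  proof
    assume inf: "infinite {i. 1/2 \<le> norm (a i)}"
    have "factors_through 4 ?X ?X (\<lambda>x. x) ?X ?X T"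
      by (rule identity_factors_if_diagonal_large[OF p T inf, of J a]) (use J a in auto)
    then show ?thesis ..
  next
    assume inf: "infinite {i. 1/2 \<le> norm (1 - a i)}"
    have "factors_through 4 ?X ?X (\<lambda>x. x) ?X ?X T'"
      by (rule identity_factors_if_diagonal_large[OF p T' inf, of J "\<lambda>i. 1 - a i"]) (use J a' in auto)
    then show ?thesis unfolding T'_def ..
  qed
qed

section \<open>Primariness by the decomposition method\<close>

text \<open>Arranging the coordinates in an infinite array identifies \<open>X\<close> with the \<open>l\<^sub>p\<close> sum of infinitely many
  copies of itself; the next two lemmas are the two estimates behind this.\<close>

lemma lp_le_rows:
  assumes p: "1 < p" and a: "lp_le p a B"
  shows "lp_le p (\<lambda>n. lp_norm p (\<lambda>m. a (prod_encode (n, m)))) B"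
proof -
  have rowle: "lp_le p (\<lambda>m. a (prod_encode (n, m))) B" for n
    by (rule lp_le_reindex[OF p a, where h = "\<lambda>m. prod_encode (n, m)" and S = UNIV]) (auto intro: injI)
  have B: "0 \<le> B" using a by (rule lp_le_nonneg)
  note row = rowle[unfolded lp_le_iff[OF p B]]
  have L0: "0 \<le> lp_norm p (\<lambda>m. a (prod_encode (n, m)))" for n
    using row[of n] lp_le_norm(2)[OF p] by blast
  show ?thesis
    using p
  proof (cases rule: exponent_cases)
    case 1
    have "\<bar>lp_norm p (\<lambda>m. a (prod_encode (n, m)))\<bar> \<le> B" for n using L0[of n] row[of n] by linarith
    then show ?thesis using 1 B by (simp add: lp_le_def)
  next
    case (2 r)
    define f where "f n m = \<bar>a (prod_encode (n, m))\<bar> powr r" for n m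
    have sf: "summable (f n)" for n using row[of n] 2 by (simp add: lp_seqs_def f_def[abs_def])
    have L: "lp_norm p (\<lambda>m. a (prod_encode (n, m))) powr r = suminf (f n)" for n
      using 2 suminf_nonneg[OF sf[of n]] by (simp add: lp_norm_def f_def[abs_def] powr_powr)
    have "(\<Sum>n\<in>F. suminf (f n)) \<le> B powr r" if F: "finite F" for F
    proof (rule LIMSEQ_le_const2)
      show "(\<lambda>K. \<Sum>n\<in>F. \<Sum>m<K. f n m) \<longlonglongrightarrow> (\<Sum>n\<in>F. suminf (f n))"
        by (intro tendsto_sum summable_LIMSEQ sf)
      have "(\<Sum>n\<in>F. \<Sum>m<K. f n m) \<le> B powr r" for K
      proof -
        have "(\<Sum>n\<in>F. \<Sum>m<K. f n m) = (\<Sum>q\<in>F \<times> {..<K}. \<bar>a (prod_encode q)\<bar> powr r)"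
          by (simp add: sum.cartesian_product f_def case_prod_unfold)
        also have "\<dots> = (\<Sum>k\<in>prod_encode ` (F \<times> {..<K}). \<bar>a k\<bar> powr r)"
          by (subst sum.reindex) (auto intro: inj_on_subset[OF inj_prod_encode])
        also have "\<dots> \<le> B powr r" using a F 2 by (auto simp: lp_le_def)
        finally show ?thesis .
      qed
      then show "\<exists>K0. \<forall>K\<ge>K0. (\<Sum>n\<in>F. \<Sum>m<K. f n m) \<le> B powr r" by blast
    qed
    then show ?thesis using 2 B L0 by (simp add: lp_le_def L[unfolded 2(1)])
  qed
qed

lemma lp_le_from_rows:
  assumes p: "1 < p" and rows: "\<And>n. lp_le p (\<lambda>m. a (prod_encode (n, m))) (L n)" and L: "lp_le p L B"
  shows "lp_le p a B"
  using p
proof (cases rule: exponent_cases)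
  case 1
  have "\<bar>a k\<bar> \<le> B" for k
  proof -
    obtain n m where k: "k = prod_encode (n, m)" by (metis prod_decode_inverse surj_pair)
    have "\<bar>a k\<bar> \<le> L n" unfolding k using lp_le_coord[OF p rows] .
    also have "\<dots> \<le> B" using lp_le_coord[OF p L, of n] by linarith
    finally show ?thesis .
  qed
  then show ?thesis using 1 lp_le_nonneg[OF L] by (simp add: lp_le_def)
next
  case (2 r)
  have L0: "0 \<le> L n" for n using rows by (rule lp_le_nonneg)
  have "(\<Sum>k\<in>G. \<bar>a k\<bar> powr r) \<le> B powr r" if G: "finite G" for G
  proof -
    define F H where "F = fst ` prod_decode ` G" and "H = snd ` prod_decode ` G"
    have FH: "finite F" "finite H" using G by (auto simp: F_def H_def)
    have "G \<subseteq> prod_encode ` (F \<times> H)"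
    proof
      fix k assume "k \<in> G"
      then have "prod_decode k \<in> F \<times> H" by (auto simp: F_def H_def mem_Times_iff)
      then show "k \<in> prod_encode ` (F \<times> H)" by (metis image_eqI prod_decode_inverse)
    qed
    then have "(\<Sum>k\<in>G. \<bar>a k\<bar> powr r) \<le> (\<Sum>k\<in>prod_encode ` (F \<times> H). \<bar>a k\<bar> powr r)"
      using FH by (intro sum_mono2) auto
    also have "\<dots> = (\<Sum>n\<in>F. \<Sum>m\<in>H. \<bar>a (prod_encode (n, m))\<bar> powr r)"
      by (subst sum.reindex) (auto intro: inj_on_subset[OF inj_prod_encode] simp: sum.cartesian_product case_prod_unfold)
    also have "\<dots> \<le> (\<Sum>n\<in>F. \<bar>L n\<bar> powr r)"
      using rows FH 2 L0 by (intro sum_mono) (auto simp: lp_le_def)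
    also have "\<dots> \<le> B powr r" using L FH 2 by (auto simp: lp_le_def)
    finally show ?thesis .
  qed
  then show ?thesis using 2 lp_le_nonneg[OF L] by (simp add: lp_le_def)
qed

definition rows :: "(nat \<Rightarrow> 'a) \<Rightarrow> nat \<Rightarrow> nat \<Rightarrow> 'a" where
  "rows x = (\<lambda>n m. x (prod_encode (n, m)))"

definition join_rows :: "(nat \<Rightarrow> nat \<Rightarrow> 'a) \<Rightarrow> nat \<Rightarrow> 'a" where
  "join_rows w = (\<lambda>k. w (fst (prod_decode k)) (snd (prod_decode k)))"

lemma rows_join_rows [simp]: "rows (join_rows w) = w" "join_rows (rows x) = x"
  by (auto simp: rows_def join_rows_def)

lemma bounded_op_rows:
  assumes p: "1 < p" and Y: "normed_nspace Y"
  shows "bounded_op (lp_space p Y) (lp_space p (lp_space p Y)) rows"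
proof (rule bounded_opI[where B = 1])
  fix x assume x: "x \<in> elems (lp_space p Y)"
  note D = lp_space_memD[OF p x]
  have "lp_le p (\<lambda>m. nrm Y (rows x n m)) (nrm (lp_space p Y) x)" for n
    by (rule lp_le_reindex[OF p D(2), where h = "\<lambda>m. prod_encode (n, m)" and S = UNIV])
       (auto intro: injI simp: rows_def)
  then have mem: "rows x n \<in> elems (lp_space p Y)" for n
    using D(1) by (intro lp_space_memI[OF p]) (auto simp: rows_def)
  have "lp_le p (\<lambda>n. nrm (lp_space p Y) (rows x n)) (nrm (lp_space p Y) x)"
    using lp_le_rows[OF p D(2)] by (simp add: rows_def)
  from lp_space_memI[OF p mem this]
  show "rows x \<in> elems (lp_space p (lp_space p Y))"
    "nrm (lp_space p (lp_space p Y)) (rows x) \<le> 1 * nrm (lp_space p Y) x" by auto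
qed (auto simp: rows_def fun_eq_iff)

lemma bounded_op_join_rows:
  assumes p: "1 < p" and Y: "normed_nspace Y"
  shows "bounded_op (lp_space p (lp_space p Y)) (lp_space p Y) join_rows"
proof (rule bounded_opI[where B = 1])
  fix w assume w: "w \<in> elems (lp_space p (lp_space p Y))"
  note D = lp_space_memD[OF p w]
  have "lp_le p (\<lambda>m. nrm Y (join_rows w (prod_encode (n, m)))) (nrm (lp_space p Y) (w n))" for n
    using lp_space_memD(2)[OF p D(1)[of n]] by (simp add: join_rows_def)
  then have "lp_le p (\<lambda>k. nrm Y (join_rows w k)) (nrm (lp_space p (lp_space p Y)) w)"
    by (rule lp_le_from_rows[OF p _ D(2)])
  moreover have "join_rows w k \<in> elems Y" for k
    using lp_space_memD(1)[OF p D(1)] by (simp add: join_rows_def)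
  ultimately show "join_rows w \<in> elems (lp_space p Y)"
    "nrm (lp_space p Y) (join_rows w) \<le> 1 * nrm (lp_space p (lp_space p Y)) w"
    using lp_space_memI[OF p, of "join_rows w" Y] by auto
qed (auto simp: join_rows_def fun_eq_iff)

lemma bounded_op_lp_map:
  assumes p: "1 < p" and Y: "normed_nspace Y" and Z: "normed_nspace Z" and G: "bounded_op Y Z G"
  shows "bounded_op (lp_space p Y) (lp_space p Z) (\<lambda>w n. G (w n))"
proof -
  obtain M where M: "0 < M" "\<And>x. x \<in> elems Y \<Longrightarrow> nrm Z (G x) \<le> M * nrm Y x"
    using normed_nspace.bounded_opE[OF Y G] by blast
  show ?thesis
  proof (rule bounded_opI[where B = M])
    fix w assume w: "w \<in> elems (lp_space p Y)"
    note D = lp_space_memD[OF p w]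
    have mem: "G (w n) \<in> elems Z" for n using G D(1) by (rule bounded_op_mem)
    have "lp_le p (\<lambda>n. nrm Z (G (w n))) (M * nrm (lp_space p Y) w)"
    proof (rule lp_le_dominated[OF p lp_le_scale[OF p D(2), of M]])
      show "\<bar>nrm Z (G (w n))\<bar> \<le> \<bar>M * nrm Y (w n)\<bar>" for n
        using M(2)[OF D(1), of n] normed_nspace.nrm_nonneg[OF Z mem, of n] by simp
    qed (use M in simp)
    from lp_space_memI[OF p mem this]
    show "(\<lambda>n. G (w n)) \<in> elems (lp_space p Z)"
      "nrm (lp_space p Z) (\<lambda>n. G (w n)) \<le> M * nrm (lp_space p Y) w" .
    show "(\<lambda>n. G (smul (lp_space p Y) c w n)) = smul (lp_space p Z) c (\<lambda>n. G (w n))" for c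
      using bounded_op_smul[OF G D(1)] by simp
  next
    fix v w assume "v \<in> elems (lp_space p Y)" "w \<in> elems (lp_space p Y)"
    from lp_space_memD(1)[OF p this(1)] lp_space_memD(1)[OF p this(2)]
    show "(\<lambda>n. G ((v + w) n)) = (\<lambda>n. G (v n)) + (\<lambda>n. G (w n))"
      using bounded_op_add[OF G] by (auto simp: fun_eq_iff)
  qed
qed

lemma bounded_op_shift:
  assumes p: "1 < p" and Y: "normed_nspace Y" and h: "inj_on h S"
  shows "bounded_op (lp_space p Y) (lp_space p Y) (\<lambda>w n. if n \<in> S then w (h n) else 0)"
proof (rule bounded_opI[where B = 1])
  interpret Y: normed_nspace Y by fact
  show "(\<lambda>n. if n \<in> S then smul (lp_space p Y) c w (h n) else 0) =
      smul (lp_space p Y) c (\<lambda>n. if n \<in> S then w (h n) else 0)" for c w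
    by (auto simp: fun_eq_iff Y.smul_zero)
  fix w assume w: "w \<in> elems (lp_space p Y)"
  note D = lp_space_memD[OF p w]
  have "lp_le p (\<lambda>n. nrm Y (if n \<in> S then w (h n) else 0)) (nrm (lp_space p Y) w)"
    by (rule lp_le_reindex[OF p D(2) h]) (auto simp: Y.nrm_zero)
  moreover have "(if n \<in> S then w (h n) else 0) \<in> elems Y" for n using D(1) Y.zero_mem by simp
  ultimately show "(\<lambda>n. if n \<in> S then w (h n) else 0) \<in> elems (lp_space p Y)"
    "nrm (lp_space p Y) (\<lambda>n. if n \<in> S then w (h n) else 0) \<le> 1 * nrm (lp_space p Y) w"
    using lp_space_memI[OF p, of "\<lambda>n. if n \<in> S then w (h n) else 0" Y] by auto
qed (auto simp: fun_eq_iff)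

lemma bounded_op_plus:
  assumes X: "normed_nspace X" and Y: "normed_nspace Y" and T: "bounded_op X Y T" and S: "bounded_op X Y S"
  shows "bounded_op X Y (\<lambda>x. T x + S x)"
proof -
  interpret Y: normed_nspace Y by fact
  have "bounded_op X Y (\<lambda>x. 0)"
    by (rule bounded_opI[where B = 0]) (auto simp: Y.zero_mem Y.smul_zero Y.nrm_zero)
  from bounded_op_minus[OF X Y T bounded_op_minus[OF X Y this S]] show ?thesis by simp
qed

lemma bounded_projection_complement:
  assumes X: "normed_nspace X" and P: "bounded_projection X P"
  shows "bounded_projection X (\<lambda>x. x - P x)"
proof -
  have b: "bounded_op X X P" and idem: "\<And>x. x \<in> elems X \<Longrightarrow> P (P x) = P x"
    using P by (auto simp: bounded_projection_def)
  have "x - P x - P (x - P x) = x - P x" if x: "x \<in> elems X" for x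
    using bounded_op_diff[OF X b x bounded_op_mem[OF b x]] idem[OF x] by simp
  then show ?thesis
    using bounded_op_minus[OF X X bounded_op_id b] by (simp add: bounded_projection_def)
qed

text \<open>Suppose \<open>U P V = I\<close>. Then \<open>A = P V\<close> embeds \<open>X\<close> into the range of \<open>P\<close>, with left inverse
  \<open>U\<close>, and \<open>G = (I - A U) P\<close> projects \<open>X\<close> onto a complement \<open>W\<close> of that copy inside the
  range. An element \<open>y\<close> of the range is thus a sequence \<open>x\<^sub>0, x\<^sub>1, \<dots>\<close> of elements of \<open>X\<close>, namely
  the rows of \<open>U y\<close>, together with an element \<open>G y\<close> of \<open>W\<close>. Pushing the \<open>W\<close>-components of the
  \<open>x\<^sub>n\<close> one step to the right makes room for \<open>G y\<close>, and this is an isomorphism onto \<open>X\<close>: it is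
  Pelczynski's chain of isomorphisms written as a formula.\<close>

lemma range_isomorphic_if_identity_factors:
  assumes p: "1 < p" and Y: "normed_nspace Y"
    and P: "bounded_projection (lp_space p Y) P"
    and fac: "factors_through C (lp_space p Y) (lp_space p Y) (\<lambda>x. x) (lp_space p Y) (lp_space p Y) P"
  shows "isomorphic_nspaces (range_space (lp_space p Y) P) (lp_space p Y)"
proof -
  let ?X = "lp_space p Y"
  let ?L = "lp_space p ?X"
  have X: "normed_nspace ?X" using p Y by (rule normed_nspace_lp_space)
  have L: "normed_nspace ?L" using p X by (rule normed_nspace_lp_space)
  interpret X: normed_nspace ?X by fact
  have bP: "bounded_op ?X ?X P" and PP: "\<And>x. x \<in> elems ?X \<Longrightarrow> P (P x) = P x"
    using P by (auto simp: bounded_projection_def)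
  obtain V U where V: "bounded_op ?X ?X V" and U: "bounded_op ?X ?X U"
    and UPV: "\<And>x. x \<in> elems ?X \<Longrightarrow> U (P (V x)) = x"
    using fac by (auto simp: factors_through_def)
  define A where "A x = P (V x)" for x
  define G where "G x = P x - A (U (P x))" for x
  have A: "bounded_op ?X ?X A" unfolding A_def using bounded_op_comp[OF X X V bP] .
  have UP: "bounded_op ?X ?X (\<lambda>x. U (P x))" using bounded_op_comp[OF X X bP U] .
  have G: "bounded_op ?X ?X G"
    unfolding G_def using bounded_op_minus[OF X X bP bounded_op_comp[OF X X UP A]] .
  note mem = bounded_op_mem[OF bP] bounded_op_mem[OF U] bounded_op_mem[OF A] bounded_op_mem[OF G]
    bounded_op_mem[OF V]
  have UA: "U (A x) = x" and PA: "P (A x) = A x" if "x \<in> elems ?X" for x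
    using UPV[OF that] PP[OF mem(5)[OF that]] by (auto simp: A_def)
  have GA: "G (A x) = 0" if "x \<in> elems ?X" for x using UA[OF that] PA[OF that] by (simp add: G_def)
  have PG: "P (G x) = G x" and UG: "U (G x) = 0" if x: "x \<in> elems ?X" for x
  proof -
    have m: "P x \<in> elems ?X" "A (U (P x)) \<in> elems ?X" "U (P x) \<in> elems ?X" using x by (auto intro: mem)
    show "P (G x) = G x"
      unfolding G_def bounded_op_diff[OF X bP m(1,2)] using PP[OF x] PA[OF m(3)] by simp
    show "U (G x) = 0"
      unfolding G_def bounded_op_diff[OF X U m(1,2)] using UA[OF m(3)] by simp
  qed
  have zero: "A 0 = 0" "G 0 = 0"
    using bounded_op_diff[OF X A X.zero_mem X.zero_mem] bounded_op_diff[OF X G X.zero_mem X.zero_mem] by auto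
  have GG: "G (G x) = G x" if "x \<in> elems ?X" for x
    using PG[OF that] UG[OF that] zero(1) by (simp add: G_def[of "G x"])
  define w where "w y = single 0 y + (\<lambda>n. if n \<in> {0<..} then rows (U y) (n - 1) else 0)" for y
  define T where "T y = join_rows (\<lambda>n. (rows (U y) n - G (rows (U y) n)) + G (w y n))" for y
  define z where "z x = (\<lambda>n. (rows x n - G (rows x n)) + G (rows x (Suc n)))" for x
  define S where "S x = A (join_rows (z x)) + G (rows x 0)" for x
  have w_simps: "w y 0 = y" "w y (Suc n) = rows (U y) n" for y n
    by (auto simp: w_def single_def)
  note R = bounded_op_rows[OF p Y] and J = bounded_op_join_rows[OF p Y]
  note GL = bounded_op_lp_map[OF p X X G]
  have RU: "bounded_op ?X ?L (\<lambda>y. rows (U y))" using bounded_op_comp[OF X X U R] .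
  have sh: "bounded_op ?L ?L (\<lambda>v n. if n \<in> {0<..} then v (n - 1) else 0)"
    by (rule bounded_op_shift[OF p X]) (auto simp: inj_on_def)
  have w: "bounded_op ?X ?L w"
    unfolding w_def
    by (rule bounded_op_plus[OF X L bounded_op_single(1)[OF p X] bounded_op_comp[OF X L RU sh]])
  have "bounded_op ?X ?L (\<lambda>y. (rows (U y) - (\<lambda>n. G (rows (U y) n))) + (\<lambda>n. G (w y n)))"
    by (rule bounded_op_plus[OF X L bounded_op_minus[OF X L RU bounded_op_comp[OF X L RU GL]]
          bounded_op_comp[OF X L w GL]])
  from bounded_op_comp[OF X L this J] have T: "bounded_op ?X ?X T"
    by (simp add: T_def[abs_def] plus_fun_def fun_diff_def)
  have sh': "bounded_op ?L ?L (\<lambda>v n. if n \<in> UNIV then v (Suc n) else 0)"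
    by (rule bounded_op_shift[OF p X]) simp
  have RS: "bounded_op ?X ?L (\<lambda>x n. rows x (Suc n))" using bounded_op_comp[OF X L R sh'] by simp
  have "bounded_op ?X ?L (\<lambda>x. (rows x - (\<lambda>n. G (rows x n))) + (\<lambda>n. G (rows x (Suc n))))"
    by (rule bounded_op_plus[OF X L bounded_op_minus[OF X L R bounded_op_comp[OF X L R GL]]
          bounded_op_comp[OF X L RS GL]])
  then have z: "bounded_op ?X ?L z"
    by (simp add: z_def[abs_def] plus_fun_def fun_diff_def)
  have R0: "bounded_op ?X ?X (\<lambda>x. rows x 0)"
    using bounded_op_comp[OF X L R bounded_op_coordinate[OF p X]] .
  have S: "bounded_op ?X ?X S"
    unfolding S_def
    by (rule bounded_op_plus[OF X X bounded_op_comp[OF X X bounded_op_comp[OF X L z J] A]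
          bounded_op_comp[OF X X R0 G]])
  have rm: "rows x n \<in> elems ?X" if "x \<in> elems ?X" for x n
    using lp_space_memD(1)[OF p bounded_op_mem[OF R that]] .
  have jm: "join_rows (z x) \<in> elems ?X" if "x \<in> elems ?X" for x
    using bounded_op_mem[OF J bounded_op_mem[OF z that]] .
  have Gcomb: "G ((u - G u) + G v) = G v" if "u \<in> elems ?X" "v \<in> elems ?X" for u v
    using that by (simp add: bounded_op_add[OF G] bounded_op_diff[OF X G] GG mem X.diff_mem)
  have PS: "P (S x) = S x" if x: "x \<in> elems ?X" for x
    unfolding S_def using x by (simp add: bounded_op_add[OF bP] PA PG mem rm jm)
  have ST: "S (T y) = y" if y: "y \<in> elems ?X" "P y = y" for y
  proof -
    have Uy: "rows (U y) n \<in> elems ?X" for n using y by (intro rm mem)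
    have wy: "w y n \<in> elems ?X" for n using lp_space_memD(1)[OF p bounded_op_mem[OF w y(1)]] .
    have rT: "rows (T y) n = (rows (U y) n - G (rows (U y) n)) + G (w y n)" for n by (simp add: T_def)
    have "z (T y) = rows (U y)"
      unfolding z_def rT Gcomb[OF Uy wy] by (auto simp: fun_eq_iff w_simps)
    then have "S (T y) = A (U y) + G (w y 0)" unfolding S_def rT Gcomb[OF Uy wy] by simp
    then show ?thesis using y(2) by (simp add: w_simps G_def)
  qed
  have TS: "T (S x) = x" if x: "x \<in> elems ?X" for x
  proof -
    have m: "A (join_rows (z x)) \<in> elems ?X" "G (rows x 0) \<in> elems ?X" using x by (auto intro: mem rm jm)
    have US: "U (S x) = join_rows (z x)"
      unfolding S_def bounded_op_add[OF U m] using UA[OF jm[OF x]] UG[OF rm[OF x]] by simp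
    have GS: "G (S x) = G (rows x 0)"
      unfolding S_def bounded_op_add[OF G m] using GA[OF jm[OF x]] GG[OF rm[OF x]] by simp
    have Gz: "G (z x n) = G (rows x (Suc n))" for n
      unfolding z_def using Gcomb[OF rm[OF x] rm[OF x]] .
    have "G (w (S x) n) = G (rows x n)" for n
      by (cases n) (simp_all add: w_simps GS US Gz)
    then have "T (S x) = join_rows (\<lambda>n. z x n - G (rows x (Suc n)) + G (rows x n))"
      unfolding T_def US by (simp add: Gz)
    also have "(\<lambda>n. z x n - G (rows x (Suc n)) + G (rows x n)) = rows x"
      by (auto simp: z_def fun_eq_iff)
    finally show ?thesis by simp
  qed
  have rng: "elems (range_space ?X P) = P ` elems ?X" "nrm (range_space ?X P) = nrm ?X"
    "smul (range_space ?X P) = smul ?X" by (simp_all add: range_space_def)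
  have sub: "P ` elems ?X \<subseteq> elems ?X" using mem(1) by blast
  have "bounded_op (range_space ?X P) ?X T"
    using T sub unfolding bounded_op_def rng by (meson subsetD)
  moreover have "bounded_op ?X (range_space ?X P) S"
  proof -
    have "S x \<in> P ` elems ?X" if "x \<in> elems ?X" for x
      using PS[OF that] bounded_op_mem[OF S that] by (metis image_eqI)
    then show ?thesis using S unfolding bounded_op_def rng by blast
  qed
  ultimately show ?thesis
    unfolding isomorphic_nspaces_def rng using ST TS mem(1) PP
    by (intro exI[of _ T] exI[of _ S]) auto
qed

lemma primary_if_primary_factorisation:
  assumes p: "1 < p" and Y: "normed_nspace Y"
    and pfp: "primary_factorisation_property C (lp_space p Y)"
  shows "primary_space (lp_space p Y)"
  unfolding primary_space_def
proof (intro allI impI)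
  fix P assume P: "bounded_projection (lp_space p Y) P"
  note iso = range_isomorphic_if_identity_factors[OF p Y]
  from P have "bounded_op (lp_space p Y) (lp_space p Y) P" by (simp add: bounded_projection_def)
  with pfp show "isomorphic_nspaces (range_space (lp_space p Y) P) (lp_space p Y) \<or>
      isomorphic_nspaces (range_space (lp_space p Y) (\<lambda>x. x - P x)) (lp_space p Y)"
    unfolding primary_factorisation_property_def
    using iso[OF P] iso[OF bounded_projection_complement[OF normed_nspace_lp_space[OF p Y] P]] by blast
qed

lemma uniform_primary_factorisation_lp_C01:
  assumes "1 < p"
  shows "uniform_primary_factorisation_property
    (lp_space p (C01 :: ('k::{real_normed_field,banach}, real \<Rightarrow> 'k) nspace))"
  unfolding uniform_primary_factorisation_property_def
  using primary_factorisation_lp_C01[OF assms] by (intro exI[of _ 4]) simp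

lemma primary_lp_C01:
  assumes "1 < p"
  shows "primary_space (lp_space p (C01 :: ('k::{real_normed_field,banach}, real \<Rightarrow> 'k) nspace))"
  using primary_if_primary_factorisation[OF assms normed_nspace_C01 primary_factorisation_lp_C01[OF assms]] .

theorem theorem1p2:
  fixes p :: ereal
  assumes "1 < p"
  shows "(uniform_primary_factorisation_property (lp_space p (C01 :: (real, real \<Rightarrow> real) nspace)) \<and>
          primary_space (lp_space p (C01 :: (real, real \<Rightarrow> real) nspace))) \<and>
         (uniform_primary_factorisation_property (lp_space p (C01 :: (complex, real \<Rightarrow> complex) nspace)) \<and>
          primary_space (lp_space p (C01 :: (complex, real \<Rightarrow> complex) nspace)))"
  by (intro conjI uniform_primary_factorisation_lp_C01 primary_lp_C01 assms)

end
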